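(* If $$\sum_{k=1}^\infty d_k^2=\infty,$$ then the operator $H_{X,\Lambda}$ is self-adjoint.
   Context: Let $p\in\mathbb{N}$, $\mathbb{R}_+=(0,\infty)$. Let $X=\{x_k\}_{k=0}^\infty$ be strictly increasing with $x_0=0$ and $\lim_{k\to\infty}x_k=\infty$; $d_k:=x_k-x_{k-1}$ for $k\in\mathbb{N}$, and assume $\sup_kd_k<\infty$. Let $\Lambda=\{\Lambda_k\}_{k=1}^\infty\subset\mathbb{C}^{p\times p}$ with $\Lambda_k=\Lambda_k^*$. $H_{X,\Lambda}$ is the closure in $L^2(\mathbb{R}_+;\mathbb{C}^p)$ of the operator acting as $f\mapsto-f''$ (on each interval $(x_{k-1},x_k)$) on all $f$ with compact support in $[0,\infty)$, with restrictions in $W^{2,2}([x_{k-1},x_k];\mathbb{C}^p)$ for every $k$, and with $f'(0)=0$, $f(x_k+)=f(x_k-)$, $f'(x_k+)-f'(x_k-)=\Lambda_kf(x_k)$, $k\in\mathbb{N}$. *)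

theory Defs
  imports "HOL-Analysis.Analysis"
begin

section \<open>Square-integrable vector functions\<close>

text \<open>
  Elements of L2 are represented by functions; two functions represent the same element iff
  they agree almost everywhere. An operator in L2 is represented by its graph, a set of pairs of
  functions. \<open>graph_closure\<close> and \<open>graph_adjoint\<close> below only depend on the L2-classes and return
  sets that are saturated with respect to almost-everywhere equality, so that set equality
  of such graphs is equality of operators.
\<close>

definition L2 :: "real measure \<Rightarrow> (real \<Rightarrow> complex ^ 'p) set" where
  "L2 M = {f. f \<in> borel_measurable M \<and> integrable M (\<lambda>t. (norm (f t))\<^sup>2)}"

definition L2_inner :: "real measure \<Rightarrow> (real \<Rightarrow> complex ^ 'p) \<Rightarrow> (real \<Rightarrow> complex ^ 'p) \<Rightarrow> complex" where
  "L2_inner M f g = (LINT t|M. (\<Sum>i\<in>UNIV. f t $ i * cnj (g t $ i)))"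

definition L2_norm :: "real measure \<Rightarrow> (real \<Rightarrow> complex ^ 'p) \<Rightarrow> real" where
  "L2_norm M f = sqrt (LINT t|M. (norm (f t))\<^sup>2)"

type_synonym 'p op_graph = "((real \<Rightarrow> complex ^ 'p) \<times> (real \<Rightarrow> complex ^ 'p)) set"

definition graph_closure :: "real measure \<Rightarrow> ('p::finite) op_graph \<Rightarrow> 'p op_graph" where
  "graph_closure M A = {(f, g). f \<in> L2 M \<and> g \<in> L2 M \<and>
     (\<exists>F G. (\<forall>n. (F n, G n) \<in> A) \<and>
        (\<lambda>n. L2_norm M (\<lambda>t. F n t - f t)) \<longlonglongrightarrow> 0 \<and>
        (\<lambda>n. L2_norm M (\<lambda>t. G n t - g t)) \<longlonglongrightarrow> 0)}"

definition graph_adjoint :: "real measure \<Rightarrow> ('p::finite) op_graph \<Rightarrow> 'p op_graph" where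
  "graph_adjoint M A = {(u, v). u \<in> L2 M \<and> v \<in> L2 M \<and>
     (\<forall>(f, g) \<in> A. L2_inner M g u = L2_inner M f v)}"

definition densely_defined :: "real measure \<Rightarrow> ('p::finite) op_graph \<Rightarrow> bool" where
  "densely_defined M A \<longleftrightarrow>
     (\<forall>u \<in> L2 M. \<forall>e>0. \<exists>f \<in> Domain A. L2_norm M (\<lambda>t. f t - u t) < e)"

text \<open>
  The adjoint of a densely defined graph is linear and single-valued up to null sets, hence so is
  every graph that is self-adjoint in the following sense.
\<close>

definition self_adjoint :: "real measure \<Rightarrow> ('p::finite) op_graph \<Rightarrow> bool" where
  "self_adjoint M A \<longleftrightarrow> densely_defined M A \<and> graph_adjoint M A = A"


section \<open>Sobolev spaces on a bounded interval\<close>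

definition test_function :: "real \<Rightarrow> real \<Rightarrow> (real \<Rightarrow> real) \<Rightarrow> bool" where
  "test_function a b \<phi> \<longleftrightarrow> \<phi> C1_differentiable_on UNIV \<and>
     compact (closure {t. \<phi> t \<noteq> 0}) \<and> closure {t. \<phi> t \<noteq> 0} \<subseteq> {a<..<b}"

text \<open>As usual in one dimension, weak derivatives are tested against compactly supported
  \<open>C\<^sup>1\<close> functions.\<close>

definition has_L2_weak_deriv ::
    "real \<Rightarrow> real \<Rightarrow> (real \<Rightarrow> complex ^ 'p) \<Rightarrow> (real \<Rightarrow> complex ^ 'p) \<Rightarrow> bool" where
  "has_L2_weak_deriv a b u v \<longleftrightarrow>
     u \<in> L2 (lebesgue_on {a<..<b}) \<and> v \<in> L2 (lebesgue_on {a<..<b}) \<and>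
     (\<forall>\<phi>. test_function a b \<phi> \<longrightarrow>
        (LINT t|lebesgue_on {a<..<b}. deriv \<phi> t *\<^sub>R u t) =
        - (LINT t|lebesgue_on {a<..<b}. \<phi> t *\<^sub>R v t))"

definition W12 :: "real \<Rightarrow> real \<Rightarrow> (real \<Rightarrow> complex ^ 'p) set" where
  "W12 a b = {u. \<exists>v. has_L2_weak_deriv a b u v}"

definition W22 :: "real \<Rightarrow> real \<Rightarrow> (real \<Rightarrow> complex ^ 'p) set" where
  "W22 a b = {u. \<exists>v \<in> W12 a b. has_L2_weak_deriv a b u v}"


section \<open>The Hamiltonian with delta interactions\<close>

definition gap :: "(nat \<Rightarrow> real) \<Rightarrow> nat \<Rightarrow> real" where
  "gap x k = x k - x (k - 1)"

definition conj_transpose :: "complex ^ 'n ^ 'm \<Rightarrow> complex ^ 'm ^ 'n" where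
  "conj_transpose A = (\<chi> i j. cnj (A $ j $ i))"

abbreviation half_line :: "real measure" where
  "half_line \<equiv> lebesgue_on {0<..}"

text \<open>
  A pair \<open>(f, g)\<close> below satisfies \<open>g = - f''\<close> on each interval. The function \<open>f\<close> and its first
  derivative \<open>f'\<close> are taken as the representatives that are continuous on each open interval
  between consecutive points, as needed for the one-sided limits; the vector \<open>c\<close> is the
  common one-sided limit, that is, the value of \<open>f\<close> at \<open>x k\<close>.
\<close>

definition H_pre :: "(nat \<Rightarrow> real) \<Rightarrow> (nat \<Rightarrow> complex ^ 'p ^ 'p) \<Rightarrow> ('p::finite) op_graph" where
  "H_pre x \<Lambda> = {(f, g). f \<in> L2 half_line \<and> g \<in> L2 half_line \<and>
     (\<exists>R. \<forall>t>R. f t = 0) \<and>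
     (\<exists>f'.
        (\<forall>k\<ge>1. f \<in> W22 (x (k - 1)) (x k) \<and>
           has_L2_weak_deriv (x (k - 1)) (x k) f f' \<and>
           has_L2_weak_deriv (x (k - 1)) (x k) f' (\<lambda>t. - g t) \<and>
           continuous_on {x (k - 1)<..<x k} f \<and>
           continuous_on {x (k - 1)<..<x k} f') \<and>
        (f' \<longlongrightarrow> 0) (at_right 0) \<and>
        (\<forall>k\<ge>1. \<exists>c l r.
           (f \<longlongrightarrow> c) (at_left (x k)) \<and> (f \<longlongrightarrow> c) (at_right (x k)) \<and>
           (f' \<longlongrightarrow> l) (at_left (x k)) \<and> (f' \<longlongrightarrow> r) (at_right (x k)) \<and>
           r - l = \<Lambda> k *v c))}"

definition H :: "(nat \<Rightarrow> real) \<Rightarrow> (nat \<Rightarrow> complex ^ 'p ^ 'p) \<Rightarrow> ('p::finite) op_graph" where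
  "H x \<Lambda> = graph_closure half_line (H_pre x \<Lambda>)"

end

theory Submission imports Defs
begin

text \<open>
  Integration by parts on each interval shows that the minimal operator is symmetric, and testing
  its adjoint shows that every element of the adjoint domain agrees almost everywhere with a
  function that is piecewise in \<open>W22\<close> and satisfies the interface conditions. It remains to
  approximate such a \<open>u\<close> in the graph norm by functions of compact support. Multiply \<open>u\<close> by a
  cutoff whose slope vanishes at every \<open>x k\<close>, so that the interface conditions survive, and which
  drops by \<open>d k\<^sup>2 / S\<close> across the interval of length \<open>d k\<close>, where \<open>S\<close> is the sum of the \<open>d k\<^sup>2\<close>
  over the block of intervals on which the cutoff passes from 1 to 0. Its first two derivatives are
  of size \<open>d k / S\<close> and \<open>1 / S\<close>, and an interior estimate bounds \<open>d k\<close> times \<open>u'\<close>, away from the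
  endpoints, by \<open>u\<close> and \<open>u''\<close>, however large the jumps of \<open>u'\<close> are. So the error is of size \<open>1 / S\<close>,
  and \<open>S\<close> can be taken as large as desired because the \<open>d k\<^sup>2\<close> are not summable.
\<close>

text \<open>The matrices \<open>\<Lambda> k\<close> obey no bound, so the equation gives no control
  of \<open>u'\<close> near a node that is uniform in the node. Inside a cell from a to b of length
  d, what survives is a bound for \<open>u'\<close> multiplied by the weight (t - a) (b - t) / d,
  which is comparable with the distance to the nearest node. The weight is at most d/4 and its slope
  at most 1 in absolute value, so short cells do no harm and the supremum of the lengths takes care
  of long ones. The cutoff is designed backwards from this weight: its slope is -6/S times the
  weight, so the first-order error is exactly what the weighted bound can absorb. The weight has
  integral d^2/6 over the cell, hence the drop d^2/S, and a total drop of 1 forces S to be the sum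
  of the squares. This is where the exponent in the hypothesis comes from. Elements of the adjoint
  domain start out as mere L2 classes. Tests with zero data at the nodes give regularity inside the
  cells; only then do boundary values exist, and tests with prescribed data at a node can read off
  the interface conditions.\<close>

section \<open>Absolutely continuous functions\<close>

text \<open>\<open>ac a b u v\<close>: on the closed interval, \<open>u\<close> is absolutely continuous with derivative \<open>v\<close>.\<close>

definition ac :: "real \<Rightarrow> real \<Rightarrow> (real \<Rightarrow> 'a::euclidean_space) \<Rightarrow> (real \<Rightarrow> 'a) \<Rightarrow> bool" where
  "ac a b u v \<longleftrightarrow> v absolutely_integrable_on {a..b} \<and>
     (\<forall>t\<in>{a..b}. u t = u a + integral {a..t} v)"

lemma ac_integrable: "ac a b u v \<Longrightarrow> v absolutely_integrable_on {a..b}"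
  by (simp add: ac_def)

lemma ac_integrable_sub:
  assumes "ac a b u v" "a \<le> s" "t \<le> b"
  shows "v absolutely_integrable_on {s..t}"
  by (rule absolutely_integrable_on_subinterval[OF ac_integrable[OF assms(1)]]) (use assms in auto)

lemma ac_integrable_on_sub:
  assumes "ac a b u v" "a \<le> s" "t \<le> b"
  shows "v integrable_on {s..t}"
  using ac_integrable_sub[OF assms] by (rule set_lebesgue_integral_eq_integral(1))

lemma ac_diff:
  assumes "ac a b u v" "a \<le> s" "s \<le> t" "t \<le> b"
  shows "integral {s..t} v = u t - u s"
proof -
  have "integral {a..s} v + integral {s..t} v = integral {a..t} v"
    using assms ac_integrable_on_sub[OF assms(1), of a t]
    by (intro Henstock_Kurzweil_Integration.integral_combine) auto
  moreover have "u t = u a + integral {a..t} v" "u s = u a + integral {a..s} v"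
    using assms unfolding ac_def by (meson atLeastAtMost_iff order_trans)+
  ultimately show ?thesis by (simp add: algebra_simps)
qed

lemma ac_subinterval:
  assumes "ac a b u v" "a \<le> s" "t \<le> b"
  shows "ac s t u v"
  unfolding ac_def
proof (intro conjI ballI)
  show "v absolutely_integrable_on {s..t}" by (rule ac_integrable_sub[OF assms])
  fix r assume "r \<in> {s..t}"
  then show "u r = u s + integral {s..r} v"
    using ac_diff[OF assms(1,2), of r] assms(3) by simp
qed

lemma ac_continuous_on:
  assumes "ac a b u v"
  shows "continuous_on {a..b} u"
proof -
  have "continuous_on {a..b} (\<lambda>t. u a + integral {a..t} v)"
    using ac_integrable_on_sub[OF assms, of a b]
    by (intro continuous_intros indefinite_integral_continuous_1) auto
  then show ?thesis
    by (rule continuous_on_eq) (use ac_diff[OF assms, of a] in auto)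
qed

lemma ac_integral:
  assumes "v absolutely_integrable_on {a..b}"
  shows "ac a b (\<lambda>t. c + integral {a..t} v) v"
  using assms unfolding ac_def by simp

text \<open>Endpoints form a null set for the derivative, but the end values of the function itself
  matter. This asymmetry suits glued functions: at the right end of a cell \<open>glue\<close> has
  already passed to the next cell.\<close>

lemma ac_cong:
  assumes "ac a b u v" "\<And>t. a \<le> t \<Longrightarrow> t \<le> b \<Longrightarrow> u' t = u t" "\<And>t. a < t \<Longrightarrow> t < b \<Longrightarrow> v' t = v t"
  shows "ac a b u' v'"
  unfolding ac_def
proof (intro conjI ballI)
  show "v' absolutely_integrable_on {a..b}"
    by (rule absolutely_integrable_spike[OF ac_integrable[OF assms(1)], of "{a,b}"])
       (use assms(3) in auto)
  fix t assume t: "t \<in> {a..b}"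
  have "integral {a..t} v' = integral {a..t} v"
    using t assms(3) by (intro integral_spike[of "{a,b}"]) auto
  then show "u' t = u' a + integral {a..t} v'"
    using t assms(2)[of a] assms(2)[of t] ac_diff[OF assms(1), of a t] by simp
qed

lemma ac_C1:
  assumes "\<And>t. a \<le> t \<Longrightarrow> t \<le> b \<Longrightarrow> (u has_vector_derivative v t) (at t within {a..b})"
    and "continuous_on {a..b} v"
  shows "ac a b u v"
proof -
  have "integral {a..t} v = u t - u a" if "t \<in> {a..b}" for t
    using that assms(1)
    by (intro integral_unique fundamental_theorem_of_calculus)
       (auto intro: has_vector_derivative_within_subset[of u _ _ "{a..b}"])
  moreover have "v absolutely_integrable_on {a..b}"
    using assms(2) by (rule absolutely_integrable_continuous_real)
  ultimately show ?thesis
    unfolding ac_def by (auto simp del: integral_unique)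
qed

lemma ac_const: "ac a b (\<lambda>t. c) (\<lambda>t. 0)"
  by (rule ac_C1) auto

lemma ac_add:
  assumes "ac a b u u'" "ac a b v v'"
  shows "ac a b (\<lambda>t. u t + v t) (\<lambda>t. u' t + v' t)"
proof -
  have "integral {a..t} (\<lambda>t. u' t + v' t) = integral {a..t} u' + integral {a..t} v'" if "t \<in> {a..b}" for t
    using that ac_integrable_on_sub[OF assms(1), of a t] ac_integrable_on_sub[OF assms(2), of a t]
    by (intro Henstock_Kurzweil_Integration.integral_add) auto
  then have *: "u t + v t = u a + v a + integral {a..t} (\<lambda>t. u' t + v' t)" if "t \<in> {a..b}" for t
    using that ac_diff[OF assms(1), of a t] ac_diff[OF assms(2), of a t] by simp
  show ?thesis
    unfolding ac_def
  proof (intro conjI ballI)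
    show "(\<lambda>t. u' t + v' t) absolutely_integrable_on {a..b}"
      using ac_integrable[OF assms(1)] ac_integrable[OF assms(2)] by (rule set_integral_add(1))
  qed (rule *)
qed

lemma ac_linear:
  assumes "ac a b u u'" "bounded_linear h"
  shows "ac a b (\<lambda>t. h (u t)) (\<lambda>t. h (u' t))"
proof -
  have "h (u t) = h (u a) + integral {a..t} (\<lambda>t. h (u' t))" if "t \<in> {a..b}" for t
  proof -
    have "u' integrable_on {a..t}"
      using that ac_integrable_on_sub[OF assms(1), of a t] by auto
    then have "integral {a..t} (\<lambda>t. h (u' t)) = h (integral {a..t} u')"
      using integral_linear[OF _ assms(2), of u' "{a..t}"] by (simp only: o_def)
    also have "\<dots> = h (u t - u a)"
      using ac_diff[OF assms(1), of a t] that by simp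
    also have "\<dots> = h (u t) - h (u a)"
      by (rule linear_diff) (rule bounded_linear.linear[OF assms(2)])
    finally show ?thesis by simp
  qed
  moreover have "(\<lambda>t. h (u' t)) absolutely_integrable_on {a..b}"
    using absolutely_integrable_linear[OF ac_integrable[OF assms(1)] assms(2)] by (simp only: o_def)
  ultimately show ?thesis
    unfolding ac_def by blast
qed

lemma ac_uminus: "ac a b u u' \<Longrightarrow> ac a b (\<lambda>t. - u t) (\<lambda>t. - u' t)"
  by (erule ac_linear) (rule bounded_linear_minus[OF bounded_linear_ident])

lemma ac_diff_fun:
  "ac a b u u' \<Longrightarrow> ac a b v v' \<Longrightarrow> ac a b (\<lambda>t. u t - v t) (\<lambda>t. u' t - v' t)"
  using ac_add[of a b u u' "\<lambda>t. - v t" "\<lambda>t. - v' t"] ac_uminus[of a b v v'] by simp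

section \<open>Product rule for bilinear products\<close>

lemma absolutely_integrable_continuous_bilinear:
  fixes prod :: "'a::euclidean_space \<Rightarrow> 'b::euclidean_space \<Rightarrow> 'c::euclidean_space"
  assumes "bounded_bilinear prod" "continuous_on {a..b} u" "v absolutely_integrable_on {a..b::real}"
  shows "(\<lambda>t. prod (u t) (v t)) absolutely_integrable_on {a..b}"
proof (rule absolutely_integrable_bounded_measurable_product[where h=prod and f=u and g=v])
  show "bilinear prod" using assms(1) by (simp add: bilinear_conv_bounded_bilinear)
  show "u \<in> borel_measurable (lebesgue_on {a..b})"
    using assms(2) by (rule continuous_imp_measurable_on_sets_lebesgue) simp
  show "bounded (u ` {a..b})"
    using assms(2) by (intro compact_imp_bounded compact_continuous_image) auto
qed (use assms in auto)

text \<open>Freeze \<open>u\<close> at the right end and \<open>v\<close> at the left end. The two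
  frozen terms integrate to \<open>prod (u q) (v q - v p)\<close> and
  \<open>prod (u q - u p) (v p)\<close>, whose sum telescopes to the exact increment. The defect is
  therefore an integral of oscillations of \<open>u\<close> and \<open>v\<close> against the
  derivatives.\<close>

lemma ac_prod_estimate:
  fixes prod :: "'a::euclidean_space \<Rightarrow> 'b::euclidean_space \<Rightarrow> 'c::euclidean_space"
  assumes bil: "bounded_bilinear prod" and u: "ac p q u u'" and v: "ac p q v v'" and pq: "p \<le> q"
    and K: "K \<ge> 0" "\<And>x y. norm (prod x y) \<le> norm x * norm y * K"
    and e: "\<And>r. p \<le> r \<Longrightarrow> r \<le> q \<Longrightarrow> norm (u q - u r) \<le> e \<and> norm (v p - v r) \<le> e"
  shows "norm (prod (u q) (v q) - prod (u p) (v p) -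
            integral {p..q} (\<lambda>t. prod (u t) (v' t) + prod (u' t) (v t)))
         \<le> (K * e) * integral {p..q} (\<lambda>r. norm (u' r) + norm (v' r))"
proof -
  interpret bounded_bilinear prod by fact
  define w where "w = (\<lambda>t. prod (u t) (v' t) + prod (u' t) (v t))"
  have "(\<lambda>t. prod (u t) (v' t)) absolutely_integrable_on {p..q}"
    by (rule absolutely_integrable_continuous_bilinear[OF bil ac_continuous_on[OF u] ac_integrable[OF v]])
  moreover have "(\<lambda>t. prod (u' t) (v t)) absolutely_integrable_on {p..q}"
    by (rule absolutely_integrable_continuous_bilinear[OF flip ac_continuous_on[OF v] ac_integrable[OF u]])
  ultimately have w: "w integrable_on {p..q}"
    unfolding w_def by (intro integrable_add set_lebesgue_integral_eq_integral(1))
  have iu: "u' integrable_on {p..q}" "v' integrable_on {p..q}"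
    using ac_integrable_on_sub[OF u] ac_integrable_on_sub[OF v] by auto
  have nuv: "(\<lambda>r. norm (u' r) + norm (v' r)) integrable_on {p..q}"
    using absolutely_integrable_norm[OF ac_integrable[OF u]] absolutely_integrable_norm[OF ac_integrable[OF v]]
    by (intro integrable_add set_lebesgue_integral_eq_integral(1)) (auto simp: o_def)
  have hu: "((\<lambda>r. prod (u q) (v' r)) has_integral prod (u q) (v q - v p)) {p..q}"
    using has_integral_linear[OF integrable_integral[OF iu(2)] bounded_linear_right[of "u q"]]
      ac_diff[OF v, of p q] pq by (simp add: o_def)
  have hv: "((\<lambda>r. prod (u' r) (v p)) has_integral prod (u q - u p) (v p)) {p..q}"
    using has_integral_linear[OF integrable_integral[OF iu(1)] bounded_linear_left[of "v p"]]
      ac_diff[OF u, of p q] pq by (simp add: o_def)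
  have "((\<lambda>r. prod (u q) (v' r) + prod (u' r) (v p) - w r) has_integral
      prod (u q) (v q - v p) + prod (u q - u p) (v p) - integral {p..q} w) {p..q}"
    using hu hv w by (intro has_integral_diff has_integral_add) auto
  moreover have "prod (u q) (v q - v p) + prod (u q - u p) (v p) - integral {p..q} w
      = prod (u q) (v q) - prod (u p) (v p) - integral {p..q} w"
    by (simp add: diff_right diff_left)
  moreover have "prod (u q) (v' r) + prod (u' r) (v p) - w r = prod (u q - u r) (v' r) + prod (u' r) (v p - v r)" for r
    by (simp add: w_def diff_right diff_left)
  ultimately have hi: "((\<lambda>r. prod (u q - u r) (v' r) + prod (u' r) (v p - v r)) has_integral
      prod (u q) (v q) - prod (u p) (v p) - integral {p..q} w) {p..q}"
    by simp
  have "norm (integral {p..q} (\<lambda>r. prod (u q - u r) (v' r) + prod (u' r) (v p - v r)))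
     \<le> integral {p..q} (\<lambda>r. (K * e) * (norm (u' r) + norm (v' r)))"
  proof (rule integral_norm_bound_integral)
    show "(\<lambda>r. prod (u q - u r) (v' r) + prod (u' r) (v p - v r)) integrable_on {p..q}"
      using hi by auto
    show "(\<lambda>r. K * e * (norm (u' r) + norm (v' r))) integrable_on {p..q}"
      using integrable_on_cmult_left[OF nuv, of "K * e"] by simp
    fix r assume r: "r \<in> {p..q}"
    have "norm (u q - u r) * norm (v' r) * K \<le> e * norm (v' r) * K"
      using e[of r] r K(1) by (intro mult_right_mono) auto
    moreover have "norm (u' r) * norm (v p - v r) * K \<le> norm (u' r) * e * K"
      using e[of r] r K(1) by (intro mult_right_mono mult_left_mono) auto
    ultimately show "norm (prod (u q - u r) (v' r) + prod (u' r) (v p - v r)) \<le> K * e * (norm (u' r) + norm (v' r))"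
      using norm_triangle_ineq[of "prod (u q - u r) (v' r)" "prod (u' r) (v p - v r)"]
        K(2)[of "u q - u r" "v' r"] K(2)[of "u' r" "v p - v r"]
      by (simp add: algebra_simps)
  qed
  then show ?thesis
    using hi by (simp add: integral_unique w_def)
qed

text \<open>The defect of the product rule is additive over adjacent intervals and, on short ones,
  arbitrarily small compared with the integral of \<open>norm u' + norm v'\<close>; hence it vanishes.\<close>

lemma ac_prod:
  fixes prod :: "'a::euclidean_space \<Rightarrow> 'b::euclidean_space \<Rightarrow> 'c::euclidean_space"
  assumes bil: "bounded_bilinear prod" and u: "ac a b u u'" and v: "ac a b v v'"
  shows "ac a b (\<lambda>t. prod (u t) (v t)) (\<lambda>t. prod (u t) (v' t) + prod (u' t) (v t))"
proof -
  interpret bounded_bilinear prod by fact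
  obtain K where K: "K > 0" "\<And>x y. norm (prod x y) \<le> norm x * norm y * K"
    using pos_bounded by blast
  define w where "w = (\<lambda>t. prod (u t) (v' t) + prod (u' t) (v t))"
  have w: "w absolutely_integrable_on {a..b}"
    unfolding w_def
    by (intro set_integral_add absolutely_integrable_continuous_bilinear[OF bil ac_continuous_on[OF u] ac_integrable[OF v]]
       absolutely_integrable_continuous_bilinear[OF flip ac_continuous_on[OF v] ac_integrable[OF u]])
  have nuv: "(\<lambda>r. norm (u' r) + norm (v' r)) absolutely_integrable_on {a..b}"
    using absolutely_integrable_norm[OF ac_integrable[OF u]] absolutely_integrable_norm[OF ac_integrable[OF v]]
    by (intro set_integral_add) (auto simp: o_def)
  have sub: "f integrable_on {p..q}" if "f absolutely_integrable_on {a..b}" "a \<le> p" "q \<le> b"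
    for f :: "real \<Rightarrow> 'z::euclidean_space" and p q
    using absolutely_integrable_on_subinterval[OF that(1), of p q] that set_lebesgue_integral_eq_integral(1) by auto
  have *: "prod (u t) (v t) - prod (u s) (v s) = integral {s..t} w"
    if st: "a \<le> s" "s \<le> t" "t \<le> b" for s t
  proof -
    define E where "E s t = prod (u t) (v t) - prod (u s) (v s) - integral {s..t} w" for s t
    define m where "m s t = integral {s..t} (\<lambda>r. norm (u' r) + norm (v' r))" for s t
    have E_add: "E p r = E p q + E q r" if "a \<le> p" "p \<le> q" "q \<le> r" "r \<le> b" for p q r
      using Henstock_Kurzweil_Integration.integral_combine[of p q r w] that sub[OF w, of p r] by (simp add: E_def algebra_simps)
    have m_add: "m p r = m p q + m q r" if "a \<le> p" "p \<le> q" "q \<le> r" "r \<le> b" for p q r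
      using Henstock_Kurzweil_Integration.integral_combine[of p q r "\<lambda>r. norm (u' r) + norm (v' r)"] that sub[OF nuv, of p r]
      by (simp add: m_def)
    have small: "norm (E s t) \<le> (K * e) * m s t" if e: "e > 0" for e
    proof -
      \<comment> \<open>The local case of \<open>Bolzano\<close> also supplies intervals that stick
        out of \<open>{a..b}\<close>; the two guards make the claim vacuous for them.\<close>
      have "a \<le> s \<longrightarrow> t \<le> b \<longrightarrow> norm (E s t) \<le> (K * e) * m s t"
        using st(2)
      proof (induction rule: Bolzano)
        case (trans p q r)
        show ?case
        proof (intro impI)
          assume pr: "a \<le> p" "r \<le> b"
          have "norm (E p r) \<le> norm (E p q) + norm (E q r)"
            using E_add[of p q r] trans pr norm_triangle_ineq[of "E p q" "E q r"] by simp
          also have "\<dots> \<le> K * e * m p q + K * e * m q r"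
            using trans pr by (intro add_mono) auto
          also have "\<dots> = K * e * m p r"
            using m_add[of p q r] trans pr by (simp add: algebra_simps)
          finally show "norm (E p r) \<le> K * e * m p r" .
        qed
      next
        case (local r)
        then have r: "r \<in> {a..b}" using st by auto
        have uv: "continuous_on {a..b} u" "continuous_on {a..b} v"
          using u v ac_continuous_on by auto
        have e2: "e / 2 > 0" using e by simp
        obtain d1 where d1: "d1 > 0" "\<And>q. q \<in> {a..b} \<Longrightarrow> dist q r < d1 \<Longrightarrow> dist (u q) (u r) < e / 2"
          using uv(1) r e2 unfolding continuous_on_iff by blast
        obtain d2 where d2: "d2 > 0" "\<And>q. q \<in> {a..b} \<Longrightarrow> dist q r < d2 \<Longrightarrow> dist (v q) (v r) < e / 2"
          using uv(2) r e2 unfolding continuous_on_iff by blast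
        show ?case
        proof (intro exI[of _ "min d1 d2"] conjI allI impI)
          fix p q assume pq: "p \<le> r \<and> r \<le> q \<and> q - p < min d1 d2" "a \<le> p" "q \<le> b"
          show "norm (E p q) \<le> K * e * m p q"
            unfolding E_def m_def w_def
          proof (rule ac_prod_estimate[OF bil])
            fix z assume z: "p \<le> z" "z \<le> q"
            have "dist (u q) (u r) < e/2" "dist (u z) (u r) < e/2"
              by (rule d1; use z pq in \<open>simp add: dist_real_def abs_less_iff\<close>)+
            moreover have "dist (v p) (v r) < e/2" "dist (v z) (v r) < e/2"
              by (rule d2; use z pq in \<open>simp add: dist_real_def abs_less_iff\<close>)+
            ultimately show "norm (u q - u z) \<le> e \<and> norm (v p - v z) \<le> e"
              using dist_triangle_half_l[of "u q" "u r" e "u z"] dist_triangle_half_l[of "v p" "v r" e "v z"]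
              by (simp add: dist_norm)
          qed (use pq K ac_subinterval[OF u] ac_subinterval[OF v] in auto)
        qed (use d1 d2 in auto)
      qed
      then show ?thesis using st by auto
    qed
    have "m s t \<ge> 0"
      unfolding m_def using sub[OF nuv, of s t] st
      by (intro Henstock_Kurzweil_Integration.integral_nonneg) auto
    have "norm (E s t) \<le> 0 + e" if "e > 0" for e
    proof -
      \<comment> \<open>The summand 1 keeps the quotient defined when
        \<open>m s t = 0\<close>.\<close>
      have "norm (E s t) \<le> (K * (e / (K * (m s t + 1)))) * m s t"
        using that K \<open>m s t \<ge> 0\<close> by (intro small) auto
      also have "\<dots> = e * (m s t / (m s t + 1))"
        using K by simp
      also have "\<dots> \<le> e * 1"
        using that \<open>m s t \<ge> 0\<close> by (intro mult_left_mono) auto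
      finally show ?thesis by simp
    qed
    then have "norm (E s t) \<le> 0" by (rule field_le_epsilon)
    then show ?thesis by (simp add: E_def)
  qed
  show ?thesis
    unfolding ac_def w_def[symmetric]
  proof (intro conjI ballI w)
    fix t assume "t \<in> {a..b}"
    then show "prod (u t) (v t) = prod (u a) (v a) + integral {a..t} w"
      using *[of a t] by (simp add: algebra_simps)
  qed
qed

section \<open>Square-integrable functions\<close>

lemma L2_measurable: "f \<in> L2 M \<Longrightarrow> f \<in> borel_measurable M"
  and L2_square_integrable: "f \<in> L2 M \<Longrightarrow> integrable M (\<lambda>t. (norm (f t))\<^sup>2)"
  by (auto simp: L2_def)

lemma L2_dominated:
  assumes "f \<in> borel_measurable M" "integrable M w" "\<And>t. t \<in> space M \<Longrightarrow> (norm (f t))\<^sup>2 \<le> w t"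
  shows "f \<in> L2 M"
proof -
  have "integrable M (\<lambda>t. (norm (f t))\<^sup>2)"
  proof (rule Bochner_Integration.integrable_bound[OF assms(2)])
    show "AE t in M. norm ((norm (f t))\<^sup>2) \<le> norm (w t)"
      using assms(3) by (intro AE_I2) (smt (verit) real_norm_def zero_le_power2)
  qed (use assms(1) in measurable)
  then show ?thesis using assms by (simp add: L2_def)
qed

lemma norm_add_square_le: "(norm (a + b))\<^sup>2 \<le> 2 * (norm a)\<^sup>2 + 2 * (norm (b :: 'a::real_normed_vector))\<^sup>2"
proof -
  have "(norm (a + b))\<^sup>2 \<le> (norm a + norm b)\<^sup>2"
    by (intro power_mono norm_triangle_ineq) auto
  also have "\<dots> \<le> 2 * (norm a)\<^sup>2 + 2 * (norm b)\<^sup>2"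
    using sum_squares_ge_zero[of "norm a - norm b" 0] by (simp add: power2_eq_square algebra_simps)
  finally show ?thesis .
qed

lemma L2_add:
  assumes "f \<in> L2 M" "g \<in> L2 M"
  shows "(\<lambda>t. f t + g t) \<in> L2 M"
proof (rule L2_dominated)
  show "integrable M (\<lambda>t. 2 * (norm (f t))\<^sup>2 + 2 * (norm (g t))\<^sup>2)"
    using assms by (intro Bochner_Integration.integrable_add integrable_mult_right) (auto simp: L2_def)
  show "(\<lambda>t. f t + g t) \<in> borel_measurable M"
    using assms by (intro borel_measurable_add L2_measurable)
qed (rule norm_add_square_le)

lemma L2_scaleR_bounded:
  assumes "f \<in> L2 M" "c \<in> borel_measurable M" "\<And>t. t \<in> space M \<Longrightarrow> \<bar>c t\<bar> \<le> C"
  shows "(\<lambda>t. c t *\<^sub>R f t) \<in> L2 M"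
proof (rule L2_dominated)
  show "integrable M (\<lambda>t. C\<^sup>2 * (norm (f t))\<^sup>2)"
    using assms by (auto simp: L2_def)
  show "(norm (c t *\<^sub>R f t))\<^sup>2 \<le> C\<^sup>2 * (norm (f t))\<^sup>2" if "t \<in> space M" for t
  proof -
    have "\<bar>c t\<bar>\<^sup>2 \<le> C\<^sup>2"
      using assms(3)[OF that] by (intro power_mono) auto
    then show ?thesis
      by (simp add: power_mult_distrib mult_right_mono)
  qed
  show "(\<lambda>t. c t *\<^sub>R f t) \<in> borel_measurable M"
    using assms(2) L2_measurable[OF assms(1)] by (rule borel_measurable_scaleR)
qed

lemma L2_uminus: "f \<in> L2 M \<Longrightarrow> (\<lambda>t. - f t) \<in> L2 M"
  using L2_scaleR_bounded[of f M "\<lambda>t. -1" 1] by simp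

lemma L2_diff: "f \<in> L2 M \<Longrightarrow> g \<in> L2 M \<Longrightarrow> (\<lambda>t. f t - g t) \<in> L2 M"
  using L2_add[of f M "\<lambda>t. - g t"] L2_uminus[of g M] by simp

lemma L2_zero: "(\<lambda>t. 0) \<in> L2 M"
  by (simp add: L2_def)

lemma L2_bilinear_integrable:
  fixes h :: "complex ^ 'p \<Rightarrow> complex ^ 'p \<Rightarrow> 'b::{banach, second_countable_topology}"
  assumes "bounded_bilinear h" "f \<in> L2 M" "g \<in> L2 M"
  shows "integrable M (\<lambda>t. h (f t) (g t))"
proof -
  interpret bounded_bilinear h by fact
  obtain K where K: "K > 0" "\<And>x y. norm (h x y) \<le> norm x * norm y * K"
    using pos_bounded by blast
  have "integrable M (\<lambda>t. K * ((norm (f t))\<^sup>2 + (norm (g t))\<^sup>2))"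
    using assms by (auto simp: L2_def)
  then show ?thesis
  proof (rule Bochner_Integration.integrable_bound)
    have [measurable]: "f \<in> borel_measurable M" "g \<in> borel_measurable M"
      using assms L2_measurable by auto
    \<comment> \<open>Measurability of the product comes from joint continuity of \<open>h\<close>,
      composed with the measurable pair of \<open>f\<close> and \<open>g\<close>.\<close>
    have "continuous_on UNIV (\<lambda>z. h (fst z) (snd z))"
      by (intro continuous_on continuous_intros)
    then have "(\<lambda>z. h (fst z) (snd z)) \<in> borel_measurable (borel \<Otimes>\<^sub>M borel)"
      by (simp add: borel_prod borel_measurable_continuous_onI)
    then have "(\<lambda>t. (\<lambda>z. h (fst z) (snd z)) (f t, g t)) \<in> borel_measurable M"
      by (rule measurable_compose[rotated]) measurable
    then show "(\<lambda>t. h (f t) (g t)) \<in> borel_measurable M" by simp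
    show "AE t in M. norm (h (f t) (g t)) \<le> norm (K * ((norm (f t))\<^sup>2 + (norm (g t))\<^sup>2))"
    proof (intro AE_I2)
      fix t
      have "norm (f t) * norm (g t) \<le> (norm (f t))\<^sup>2 + (norm (g t))\<^sup>2"
        using sum_squares_bound[of "norm (f t)" "norm (g t)"] mult_nonneg_nonneg[OF norm_ge_zero norm_ge_zero, of "f t" "g t"]
        by linarith
      then have "norm (h (f t) (g t)) \<le> ((norm (f t))\<^sup>2 + (norm (g t))\<^sup>2) * K"
        using K(2)[of "f t" "g t"] K(1) by (meson mult_right_mono less_imp_le order_trans)
      then show "norm (h (f t) (g t)) \<le> norm (K * ((norm (f t))\<^sup>2 + (norm (g t))\<^sup>2))"
        using K(1) by (simp add: mult.commute abs_of_nonneg)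
    qed
  qed
qed

lemma L2_subset:
  assumes "f \<in> L2 (lebesgue_on T)" "S \<subseteq> T" "S \<in> sets lebesgue" "T \<in> sets lebesgue"
  shows "f \<in> L2 (lebesgue_on S)"
proof -
  have "set_integrable lebesgue T (\<lambda>t. (norm (f t))\<^sup>2)"
    using assms by (simp add: L2_def integrable_restrict_space set_integrable_def)
  then have "set_integrable lebesgue S (\<lambda>t. (norm (f t))\<^sup>2)"
    using assms(2,3) by (auto intro: set_integrable_subset)
  moreover have "f \<in> borel_measurable (lebesgue_on S)"
    using L2_measurable[OF assms(1)] assms(2) by (rule measurable_restrict_mono)
  ultimately show ?thesis
    using assms by (simp add: L2_def integrable_restrict_space set_integrable_def)
qed

text \<open>The pieces of a function fit together, or agree with an adjoint element, only off a null
  set that need not be Borel. Lebesgue measurability tolerates this, and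
  \<open>measurable_on\<close> is the form in which negligible sets can be ignored.\<close>

lemma L2_spike:
  fixes f g :: "real \<Rightarrow> complex ^ 'p"
  assumes f: "f \<in> L2 (lebesgue_on S)" and N: "negligible N" "\<And>t. t \<in> S - N \<Longrightarrow> g t = f t"
    and S: "S \<in> sets lebesgue"
  shows "g \<in> L2 (lebesgue_on S)"
proof -
  have "f measurable_on S"
    using L2_measurable[OF f] S by (simp add: measurable_on_iff_borel_measurable)
  then have "g measurable_on S"
    using N by (rule measurable_on_spike)
  then have "g \<in> borel_measurable (lebesgue_on S)"
    using S by (rule measurable_on_imp_borel_measurable_lebesgue)
  moreover have "(\<lambda>t. (norm (f t))\<^sup>2) absolutely_integrable_on S"
    using L2_square_integrable[OF f] S by (simp add: integrable_restrict_space set_integrable_def)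
  then have "(\<lambda>t. (norm (g t))\<^sup>2) absolutely_integrable_on S"
    by (rule absolutely_integrable_spike[OF _ N(1)]) (simp add: N(2))
  ultimately show ?thesis
    using S by (simp add: L2_def integrable_restrict_space set_integrable_def)
qed

text \<open>On a set of finite measure \<open>1 + (norm (f t))\<^sup>2\<close> dominates
  \<open>norm (f t)\<close>. The conclusion is on the closed interval because \<open>ac\<close> asks
  for it there.\<close>

lemma L2_absolutely_integrable:
  fixes f :: "real \<Rightarrow> complex ^ 'p"
  assumes "f \<in> L2 (lebesgue_on {a<..<b})"
  shows "f absolutely_integrable_on {a..b}"
proof -
  have "integrable (lebesgue_on {a<..<b}) (\<lambda>t. 1 + (norm (f t))\<^sup>2)"
    using assms finite_measure.integrable_const[OF finite_measure_lebesgue_on, of "{a<..<b}"]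
    by (intro Bochner_Integration.integrable_add) (auto simp: L2_def)
  then have "integrable (lebesgue_on {a<..<b}) f"
  proof (rule Bochner_Integration.integrable_bound)
    show "AE t in lebesgue_on {a<..<b}. norm (f t) \<le> norm (1 + (norm (f t))\<^sup>2)"
    proof (intro AE_I2)
      fix t
      show "norm (f t) \<le> norm (1 + (norm (f t))\<^sup>2)"
        using sum_squares_bound[of "norm (f t)" 1] zero_le_power2[of "norm (f t)"] by (simp only: real_norm_def power_one)
    qed
  qed (rule L2_measurable[OF assms])
  then have "f absolutely_integrable_on {a<..<b}"
    by (simp add: integrable_restrict_space set_integrable_def)
  then show ?thesis
    using absolutely_integrable_on_Icc_iff_Ioo by blast
qed

lemma L2_continuous:
  fixes f :: "real \<Rightarrow> complex ^ 'p"
  assumes "continuous_on {a..b} f"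
  shows "f \<in> L2 (lebesgue_on {a<..<b})"
proof (rule L2_subset)
  have "(\<lambda>t. (norm (f t))\<^sup>2) absolutely_integrable_on {a..b}"
    by (intro absolutely_integrable_continuous_real continuous_intros assms)
  moreover have "f \<in> borel_measurable (lebesgue_on {a..b})"
    using assms by (rule continuous_imp_measurable_on_sets_lebesgue) simp
  ultimately show "f \<in> L2 (lebesgue_on {a..b})"
    by (simp add: L2_def integrable_restrict_space set_integrable_def)
qed auto

text \<open>The integrand of \<open>L2_inner\<close>. It is conjugate linear in the second argument
  but bilinear over the reals, so the product rule \<open>ac_prod\<close> and the bilinear
  integrability lemmas apply to it.\<close>

definition hip :: "complex ^ 'p \<Rightarrow> complex ^ 'p \<Rightarrow> complex" where
  "hip u v = (\<Sum>i\<in>UNIV. u $ i * cnj (v $ i))"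

lemma hip_bilinear: "bounded_bilinear (hip :: complex ^ 'p \<Rightarrow> complex ^ 'p \<Rightarrow> complex)"
proof -
  have "bilinear (hip :: complex ^ 'p \<Rightarrow> complex ^ 'p \<Rightarrow> complex)"
    unfolding bilinear_def
    by (intro conjI allI linearI)
       (auto simp: hip_def algebra_simps sum.distrib scaleR_sum_right)
  then show ?thesis by (simp add: bilinear_conv_bounded_bilinear)
qed

lemma hip_self: "hip u u = of_real ((norm u)\<^sup>2)"
proof -
  have "(norm u)\<^sup>2 = (\<Sum>i\<in>UNIV. (cmod (u $ i))\<^sup>2)"
    by (simp add: norm_vec_def L2_set_def sum_nonneg)
  then show ?thesis
    by (simp add: hip_def complex_norm_square del: of_real_power)
qed

lemma hip_commute: "hip v u = cnj (hip u v)"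
  by (simp add: hip_def mult.commute)

lemma hip_selfadjoint_matrix:
  assumes "conj_transpose A = A"
  shows "hip (A *v u) v = hip u (A *v v)"
proof -
  have A: "cnj (A $ j $ i) = A $ i $ j" for i j
  proof -
    have "conj_transpose A $ i $ j = A $ i $ j" using assms by simp
    then show ?thesis by (simp add: conj_transpose_def)
  qed
  have "hip (A *v u) v = (\<Sum>i\<in>UNIV. \<Sum>j\<in>UNIV. A $ i $ j * u $ j * cnj (v $ i))"
    by (simp add: hip_def matrix_vector_mult_def sum_distrib_right)
  also have "\<dots> = (\<Sum>j\<in>UNIV. \<Sum>i\<in>UNIV. A $ i $ j * u $ j * cnj (v $ i))"
    by (rule sum.swap)
  also have "\<dots> = hip u (A *v v)"
    by (simp add: hip_def matrix_vector_mult_def sum_distrib_left A mult_ac)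
  finally show ?thesis .
qed

lemma hip_eq_0_all: "(\<And>c. hip c u = 0) \<Longrightarrow> u = 0"
  using hip_self[of u] by simp

lemma L2_inner_eq_hip: "L2_inner M f g = (LINT t|M. hip (f t) (g t))"
  by (simp add: L2_inner_def hip_def)

lemma hip_L2_integrable:
  "f \<in> L2 M \<Longrightarrow> g \<in> L2 M \<Longrightarrow> integrable M (\<lambda>t. hip (f t) (g t))"
  by (rule L2_bilinear_integrable[OF hip_bilinear])

section \<open>Weak derivatives\<close>

text \<open>The bridge between the Lebesgue integrals over open intervals that define weak
  derivatives and the gauge integrals over closed intervals on which \<open>ac\<close>
  rests.\<close>

lemma lint_Ioo_eq_integral:
  fixes f :: "real \<Rightarrow> 'a::euclidean_space"
  assumes "f absolutely_integrable_on {a..b}"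
  shows "(LINT t|lebesgue_on {a<..<b}. f t) = integral {a..b} f"
proof -
  have "f absolutely_integrable_on {a<..<b}"
    using assms absolutely_integrable_on_Icc_iff_Ioo by blast
  then have "integrable (lebesgue_on {a<..<b}) f"
    by (simp add: integrable_restrict_space set_integrable_def)
  then have "(LINT t|lebesgue_on {a<..<b}. f t) = integral {a<..<b} f"
    by (simp add: lebesgue_integral_eq_integral)
  then show ?thesis by (simp add: integral_open_interval_real)
qed

lemma C1_has_vector_derivative_deriv:
  fixes \<phi> :: "real \<Rightarrow> real"
  assumes "\<phi> C1_differentiable_on UNIV"
  shows "(\<phi> has_vector_derivative deriv \<phi> t) (at t)" "continuous_on UNIV (deriv \<phi>)"
proof -
  obtain D where D: "\<And>t. (\<phi> has_vector_derivative D t) (at t)" "continuous_on UNIV D"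
    using assms unfolding C1_differentiable_on_def by auto
  have "deriv \<phi> = D"
    using D(1) DERIV_imp_deriv has_real_derivative_iff_has_vector_derivative by blast
  then show "(\<phi> has_vector_derivative deriv \<phi> t) (at t)" "continuous_on UNIV (deriv \<phi>)"
    using D by auto
qed

lemma test_function_zero:
  assumes "test_function a b \<phi>" "t \<le> a \<or> b \<le> t"
  shows "\<phi> t = 0"
  using assms closure_subset[of "{t. \<phi> t \<noteq> 0}"] unfolding test_function_def by force

lemma test_function_ac:
  assumes "test_function a b \<phi>"
  shows "ac a b \<phi> (deriv \<phi>)"
  using assms C1_has_vector_derivative_deriv[of \<phi>] unfolding test_function_def
  by (intro ac_C1) (auto intro: has_vector_derivative_at_within continuous_on_subset)

text \<open>Integrate the derivative of \<open>\<phi> t *\<^sub>R U t\<close>; the boundary terms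
  vanish with the test function.\<close>

lemma ac_imp_weak_deriv:
  fixes U :: "real \<Rightarrow> complex ^ 'p"
  assumes "a < b" and U: "ac a b U v" and v: "v \<in> L2 (lebesgue_on {a<..<b})"
    and u: "\<And>t. a < t \<Longrightarrow> t < b \<Longrightarrow> u t = U t"
  shows "has_L2_weak_deriv a b u v"
  unfolding has_L2_weak_deriv_def
proof (intro conjI allI impI v)
  show "u \<in> L2 (lebesgue_on {a<..<b})"
    by (rule L2_spike[OF L2_continuous[OF ac_continuous_on[OF U]], of "{}"]) (use u in auto)
  fix \<phi> assume \<phi>: "test_function a b \<phi>"
  have ac: "ac a b (\<lambda>t. \<phi> t *\<^sub>R U t) (\<lambda>t. \<phi> t *\<^sub>R v t + deriv \<phi> t *\<^sub>R U t)"
    by (rule ac_prod[OF bounded_bilinear_scaleR test_function_ac[OF \<phi>] U])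
  have i1: "(\<lambda>t. \<phi> t *\<^sub>R v t) absolutely_integrable_on {a..b}"
    by (rule absolutely_integrable_continuous_bilinear[OF bounded_bilinear_scaleR
      ac_continuous_on[OF test_function_ac[OF \<phi>]] ac_integrable[OF U]])
  have "continuous_on {a..b} (deriv \<phi>)"
    using C1_has_vector_derivative_deriv(2)[of \<phi>] \<phi>
    by (auto simp: test_function_def intro: continuous_on_subset)
  then have i2: "(\<lambda>t. deriv \<phi> t *\<^sub>R U t) absolutely_integrable_on {a..b}"
    by (intro absolutely_integrable_continuous_real continuous_intros ac_continuous_on[OF U])
  have "integral {a..b} (\<lambda>t. \<phi> t *\<^sub>R v t + deriv \<phi> t *\<^sub>R U t) = 0"
    using ac_diff[OF ac, of a b] test_function_zero[OF \<phi>] assms(1) by simp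
  then have "integral {a..b} (\<lambda>t. \<phi> t *\<^sub>R v t) + integral {a..b} (\<lambda>t. deriv \<phi> t *\<^sub>R U t) = 0"
    using i1 i2 by (simp add: Henstock_Kurzweil_Integration.integral_add set_lebesgue_integral_eq_integral(1))
  moreover have "(LINT t|lebesgue_on {a<..<b}. deriv \<phi> t *\<^sub>R u t) =
      (LINT t|lebesgue_on {a<..<b}. deriv \<phi> t *\<^sub>R U t)"
    by (rule Bochner_Integration.integral_cong) (use u in auto)
  ultimately show "(LINT t|lebesgue_on {a<..<b}. deriv \<phi> t *\<^sub>R u t) = - (LINT t|lebesgue_on {a<..<b}. \<phi> t *\<^sub>R v t)"
    using lint_Ioo_eq_integral[OF i1] lint_Ioo_eq_integral[OF i2] by (simp add: eq_neg_iff_add_eq_0 add.commute)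
qed

section \<open>From weak derivatives to absolute continuity\<close>

lemma test_function_of_derivative:
  fixes \<rho> :: "real \<Rightarrow> real"
  assumes "continuous_on UNIV \<rho>" "\<And>t. t \<notin> {s..r} \<Longrightarrow> \<rho> t = 0" "integral {s..r} \<rho> = 0" "a < s" "s < r" "r < b"
  obtains \<phi> where "test_function a b \<phi>" "deriv \<phi> = \<rho>"
proof -
  \<comment> \<open>Starting at \<open>s - 1\<close> rather than \<open>s\<close> makes each point
    from \<open>s\<close> on interior to an interval on which the fundamental theorem applies, so
    the derivative is two-sided at \<open>s\<close> as well. Zero mean brings the primitive back to
    0 at \<open>r\<close>.\<close>
  define \<phi> where "\<phi> t = integral {s - 1..t} \<rho>" for t
  have io: "\<rho> integrable_on {p..q}" for p q
    using assms(1) by (intro integrable_continuous_real) (auto intro: continuous_on_subset)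
  have below: "\<phi> t = 0" if "t \<le> s" for t
  proof -
    have "integral {s - 1..t} \<rho> = integral {s - 1..t} (\<lambda>_. 0)"
      using that assms(2) by (intro integral_spike[of "{s}"]) auto
    then show ?thesis by (simp add: \<phi>_def)
  qed
  have above: "\<phi> t = 0" if "r \<le> t" for t
  proof -
    have "integral {r..t} \<rho> = integral {r..t} (\<lambda>_. 0)"
      using assms(2) by (intro integral_spike[of "{r}"]) auto
    moreover have "integral {s - 1..r} \<rho> + integral {r..t} \<rho> = \<phi> t"
      unfolding \<phi>_def using that assms(5)
      by (intro Henstock_Kurzweil_Integration.integral_combine io) auto
    moreover have "integral {s - 1..s} \<rho> + integral {s..r} \<rho> = integral {s-1..r} \<rho>"
      using assms(5) by (intro Henstock_Kurzweil_Integration.integral_combine io) auto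
    ultimately show ?thesis
      using below[of s] assms(3) by (simp add: \<phi>_def)
  qed
  have der: "(\<phi> has_vector_derivative \<rho> t) (at t)" for t
  proof (cases "t < s")
    case True
    have "((\<lambda>_. 0) has_vector_derivative \<rho> t) (at t)"
      using assms(2)[of t] True by auto
    then show ?thesis
      by (rule has_vector_derivative_transform_within_open[of _ _ _ "{..<s}"]) (use True below in auto)
  next
    case False
    have "(\<phi> has_vector_derivative \<rho> t) (at t within {s-1..t+1})"
      unfolding \<phi>_def using False assms(1)
      by (intro integral_has_vector_derivative) (auto intro: continuous_on_subset)
    moreover have "at t within {s-1..t+1} = at t"
      using False by (intro at_within_interior) auto
    ultimately show ?thesis by simp
  qed
  have supp: "closure {t. \<phi> t \<noteq> 0} \<subseteq> {s..r}"
  proof (rule closure_minimal)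
    show "{t. \<phi> t \<noteq> 0} \<subseteq> {s..r}"
    proof
      fix t assume "t \<in> {t. \<phi> t \<noteq> 0}"
      then show "t \<in> {s..r}"
        using below[of t] above[of t] by (cases "t \<le> s"; cases "r \<le> t"; simp)
    qed
  qed simp
  show ?thesis
  proof
    show "deriv \<phi> = \<rho>"
      using der DERIV_imp_deriv has_real_derivative_iff_has_vector_derivative by blast
    show "test_function a b \<phi>"
      unfolding test_function_def C1_differentiable_on_def
    proof (intro conjI exI[of _ \<rho>] ballI der assms(1))
      show "compact (closure {t. \<phi> t \<noteq> 0})"
        using supp bounded_subset[of "{s..r}"] by (auto simp: compact_eq_bounded_closed)
    qed (use supp assms in auto)
  qed
qed

text \<open>Test with the primitive of \<open>w (y - c)\<close>, where \<open>w\<close> is a bump and \<open>c\<close> the \<open>w\<close>-mean of \<open>y\<close>.\<close>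

lemma du_Bois_Reymond_constant:
  fixes y :: "real \<Rightarrow> real"
  assumes y: "continuous_on {a<..<b} y"
    and test: "\<And>\<phi>. test_function a b \<phi> \<Longrightarrow> (LINT t|lebesgue_on {a<..<b}. deriv \<phi> t * y t) = 0"
    and sr: "a < s" "s < r" "r < b"
  shows "\<exists>c. \<forall>t\<in>{s<..<r}. y t = c"
proof -
  \<comment> \<open>The bump vanishes at \<open>s\<close> and \<open>r\<close>, which makes
    \<open>w (y - c)\<close>, extended by 0, continuous.\<close>
  define w where "w t = (t - s) * (r - t)" for t
  have w: "continuous_on S w" for S unfolding w_def by (intro continuous_intros)
  have ys: "continuous_on {s..r} y" using y sr by (auto intro: continuous_on_subset)
  have w_pos: "w t > 0" if "t \<in> {s<..<r}" for t using that by (simp add: w_def)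
  have w_nn: "w t \<ge> 0" if "t \<in> {s..r}" for t using that by (simp add: w_def)
  have "integral {s..r} w \<noteq> 0"
    using integral_eq_0_iff[of s r w] w w_nn w_pos[of "(s+r)/2"] sr by (auto simp: field_simps)
  define c where "c = integral {s..r} (\<lambda>t. w t * y t) / integral {s..r} w"
  define \<rho> where "\<rho> t = (if t \<in> {s..r} then w t * (y t - c) else 0)" for t
  have wio: "w integrable_on {s..r}" "(\<lambda>t. w t * y t) integrable_on {s..r}"
    by (intro integrable_continuous_real continuous_intros w ys)+
  have rho_int: "integral {s..r} \<rho> = 0"
  proof -
    have "integral {s..r} \<rho> = integral {s..r} (\<lambda>t. w t * y t - c * w t)"
      by (rule integral_cong) (simp add: \<rho>_def algebra_simps)
    also have "\<dots> = integral {s..r} (\<lambda>t. w t * y t) - c * integral {s..r} w"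
      using wio integrable_on_cmult_left[OF wio(1), of c]
      by (subst Henstock_Kurzweil_Integration.integral_diff) auto
    also have "\<dots> = 0" using \<open>integral {s..r} w \<noteq> 0\<close> by (simp add: c_def)
    finally show ?thesis .
  qed
  have rho_cont: "continuous_on UNIV \<rho>"
  proof -
    have "continuous_on ({s..r} \<union> ({..s} \<union> {r..})) (\<lambda>t. if t \<in> {s..r} then w t * (y t - c) else 0)"
      by (rule continuous_on_cases) (auto intro!: continuous_intros w ys simp: w_def)
    moreover have "{s..r} \<union> ({..s} \<union> {r..}) = UNIV" by auto
    ultimately show ?thesis by (simp add: \<rho>_def[abs_def])
  qed
  obtain \<phi> where \<phi>: "test_function a b \<phi>" "deriv \<phi> = \<rho>"
    by (rule test_function_of_derivative[OF rho_cont _ rho_int sr]) (auto simp: \<rho>_def)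
  have "(LINT t|lebesgue_on {a<..<b}. \<rho> t * y t) = 0"
    using test[OF \<phi>(1)] \<phi>(2) by simp
  moreover have cont: "continuous_on {s..r} (\<lambda>t. \<rho> t * y t)"
    by (intro continuous_intros ys continuous_on_subset[OF rho_cont]) auto
  have "(\<lambda>t. \<rho> t * y t) absolutely_integrable_on {s..r}"
    by (rule absolutely_integrable_continuous_real[OF cont])
  moreover have "(LINT t|lebesgue_on {a<..<b}. \<rho> t * y t) = integral {s..r} (\<lambda>t. \<rho> t * y t)"
  proof -
    have 1: "(LINT t|lebesgue_on {a<..<b}. \<rho> t * y t) = (LINT t|lebesgue_on {s<..<r}. \<rho> t * y t)"
      by (simp add: integral_restrict_space)
         (intro Bochner_Integration.integral_cong; use sr in \<open>auto simp: indicator_def \<rho>_def w_def\<close>)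
    show ?thesis
      unfolding 1 by (intro lint_Ioo_eq_integral absolutely_integrable_continuous_real[OF cont])
  qed
  ultimately have "integral {s..r} (\<lambda>t. \<rho> t * y t) = 0" by simp
  \<comment> \<open>Since \<open>\<rho>\<close> has mean zero, \<open>c\<close> may be subtracted
    from \<open>y\<close> for free. This turns the tested integral into that of the nonnegative
    function \<open>w (y - c)^2\<close>.\<close>
  then have "integral {s..r} (\<lambda>t. \<rho> t * y t - c * \<rho> t) = 0"
    using rho_int integrable_continuous_real[OF cont]
      integrable_on_cmult_left[OF integrable_continuous_real[OF continuous_on_subset[OF rho_cont subset_UNIV], of s r], of c]
    by (subst Henstock_Kurzweil_Integration.integral_diff) auto
  moreover have "integral {s..r} (\<lambda>t. \<rho> t * y t - c * \<rho> t) = integral {s..r} (\<lambda>t. w t * (y t - c)\<^sup>2)"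
    by (rule integral_cong) (simp add: \<rho>_def algebra_simps power2_eq_square)
  ultimately have "integral {s..r} (\<lambda>t. w t * (y t - c)\<^sup>2) = 0" by simp
  moreover have "continuous_on {s..r} (\<lambda>t. w t * (y t - c)\<^sup>2)"
    by (intro continuous_intros w ys)
  ultimately have "\<forall>t\<in>{s..r}. w t * (y t - c)\<^sup>2 = 0"
    using integral_eq_0_iff[of s r "\<lambda>t. w t * (y t - c)\<^sup>2"] w_nn sr by auto
  then have "\<forall>t\<in>{s<..<r}. y t = c"
    using w_pos by force
  then show ?thesis by blast
qed

text \<open>Subtract a primitive of \<open>v\<close>: the difference has weak derivative zero, so
  each real component is constant by \<open>du_Bois_Reymond_constant\<close>.\<close>

lemma weak_deriv_imp_ac:
  fixes u :: "real \<Rightarrow> complex ^ 'p"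
  assumes "a < b" and weak: "has_L2_weak_deriv a b u v" and u: "continuous_on {a<..<b} u"
  shows "\<exists>U. ac a b U v \<and> (\<forall>t\<in>{a<..<b}. u t = U t)"
proof -
  have v: "v \<in> L2 (lebesgue_on {a<..<b})" and uL: "u \<in> L2 (lebesgue_on {a<..<b})"
    using weak by (auto simp: has_L2_weak_deriv_def)
  define V where "V t = 0 + integral {a..t} v" for t
  have V: "ac a b V v"
    unfolding V_def by (rule ac_integral[OF L2_absolutely_integrable[OF v]])
  have weakV: "has_L2_weak_deriv a b V v"
    by (rule ac_imp_weak_deriv[OF assms(1) V v]) simp
  define m where "m = (a + b) / 2"
  define z where "z t = u t - V t" for t
  have zL: "z \<in> L2 (lebesgue_on {a<..<b})"
    using L2_diff[OF uL, of V] weakV by (simp add: z_def[abs_def] has_L2_weak_deriv_def)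
  have zc: "continuous_on {a<..<b} z"
    unfolding z_def by (intro continuous_intros u continuous_on_subset[OF ac_continuous_on[OF V]]) auto
  have int: "integrable (lebesgue_on {a<..<b}) (\<lambda>t. deriv \<phi> t *\<^sub>R f t)"
    if "test_function a b \<phi>" "f \<in> L2 (lebesgue_on {a<..<b})" for \<phi> and f :: "real \<Rightarrow> complex ^ 'p"
  proof -
    have "continuous_on {a..b} (deriv \<phi>)"
      using C1_has_vector_derivative_deriv(2)[of \<phi>] that(1)
      by (auto simp: test_function_def intro: continuous_on_subset)
    then have "(\<lambda>t. deriv \<phi> t *\<^sub>R f t) absolutely_integrable_on {a..b}"
      by (rule absolutely_integrable_continuous_bilinear[OF bounded_bilinear_scaleR _ L2_absolutely_integrable[OF that(2)]])
    then show ?thesis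
      unfolding absolutely_integrable_on_Icc_iff_Ioo
      by (simp add: integrable_restrict_space set_integrable_def)
  qed
  have z0: "(LINT t|lebesgue_on {a<..<b}. deriv \<phi> t *\<^sub>R z t) = 0" if \<phi>: "test_function a b \<phi>" for \<phi>
  proof -
    have "(LINT t|lebesgue_on {a<..<b}. deriv \<phi> t *\<^sub>R z t) =
       (LINT t|lebesgue_on {a<..<b}. deriv \<phi> t *\<^sub>R u t) - (LINT t|lebesgue_on {a<..<b}. deriv \<phi> t *\<^sub>R V t)"
      using int[OF \<phi> uL] int[OF \<phi>, of V] weakV
      by (simp add: z_def scaleR_diff_right has_L2_weak_deriv_def)
    also have "\<dots> = 0"
      using weak weakV \<phi> by (simp add: has_L2_weak_deriv_def)
    finally show ?thesis .
  qed
  have const: "z t = z m" if t: "t \<in> {a<..<b}" for t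
  proof (rule vector_eq_rdot[THEN iffD1, rule_format])
    fix e :: "complex ^ 'p"
    \<comment> \<open>The constant obtained depends on the compactly contained interval. Choosing
      the interval to contain both \<open>t\<close> and the midpoint \<open>m\<close> ties every
      such constant to the value at \<open>m\<close>.\<close>
    define s where "s = (a + min t m) / 2"
    define r where "r = (b + max t m) / 2"
    have "a < m" "m < b" using assms(1) by (auto simp: m_def)
    then have sr: "a < s" "s < r" "r < b" "t \<in> {s<..<r}" "m \<in> {s<..<r}"
      using t by (auto simp: s_def r_def min_def max_def)
    have "\<exists>c. \<forall>t\<in>{s<..<r}. z t \<bullet> e = c"
    proof (rule du_Bois_Reymond_constant[OF _ _ sr(1-3)])
      show "continuous_on {a<..<b} (\<lambda>t. z t \<bullet> e)"
        by (intro continuous_intros zc)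
      fix \<phi> assume \<phi>: "test_function a b \<phi>"
      have "(LINT t|lebesgue_on {a<..<b}. deriv \<phi> t * (z t \<bullet> e)) =
            (LINT t|lebesgue_on {a<..<b}. (deriv \<phi> t *\<^sub>R z t) \<bullet> e)"
        by simp
      also have "\<dots> = 0"
        using int[OF \<phi> zL] z0[OF \<phi>] by (subst integral_inner_left) auto
      finally show "(LINT t|lebesgue_on {a<..<b}. deriv \<phi> t * (z t \<bullet> e)) = 0" .
    qed
    then show "z t \<bullet> e = z m \<bullet> e" using sr by metis
  qed
  have "ac a b (\<lambda>t. z m + integral {a..t} v) v"
    by (rule ac_integral[OF L2_absolutely_integrable[OF v]])
  moreover have "u t = z m + integral {a..t} v" if "t \<in> {a<..<b}" for t
    using const[OF that] by (simp add: z_def V_def algebra_simps)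
  ultimately show ?thesis by blast
qed

section \<open>Piecewise description of the Hamiltonian\<close>

text \<open>This makes cells half open: cell \<open>k\<close> contains its left end
  \<open>x (k - 1)\<close> and not \<open>x k\<close>, so each nonnegative number lies in exactly
  one cell.\<close>

definition cell :: "(nat \<Rightarrow> real) \<Rightarrow> real \<Rightarrow> nat" where
  "cell x t = (LEAST k. t < x k)"

definition glue :: "(nat \<Rightarrow> real) \<Rightarrow> (nat \<Rightarrow> real \<Rightarrow> 'a) \<Rightarrow> real \<Rightarrow> 'a" where
  "glue x F t = F (cell x t) t"

text \<open>The functions \<open>U k\<close> and \<open>U' k\<close> live on the closed interval between \<open>x (k - 1)\<close> and \<open>x k\<close>,
  so that the one-sided limits in \<open>H_pre\<close> become values.\<close>

definition interface_solution ::
    "(nat \<Rightarrow> real) \<Rightarrow> (nat \<Rightarrow> complex ^ 'p ^ 'p) \<Rightarrow> (nat \<Rightarrow> real \<Rightarrow> complex ^ ('p::finite)) \<Rightarrow>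
     (nat \<Rightarrow> real \<Rightarrow> complex ^ 'p) \<Rightarrow> (real \<Rightarrow> complex ^ 'p) \<Rightarrow> bool" where
  "interface_solution x \<Lambda> U U' g \<longleftrightarrow>
     (\<forall>k\<ge>1. ac (x (k - 1)) (x k) (U k) (U' k) \<and> ac (x (k - 1)) (x k) (U' k) (\<lambda>t. - g t)) \<and>
     U' 1 (x 0) = 0 \<and>
     (\<forall>k\<ge>1. U (Suc k) (x k) = U k (x k) \<and> U' (Suc k) (x k) - U' k (x k) = \<Lambda> k *v U k (x k))"

lemma tendsto_at_left_eq:
  fixes U :: "real \<Rightarrow> 'a::topological_space"
  assumes "continuous_on {a..b} U" "a < b" "\<And>t. a < t \<Longrightarrow> t < b \<Longrightarrow> f t = U t"
  shows "(f \<longlongrightarrow> U b) (at_left b)"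
proof -
  have "(U \<longlongrightarrow> U b) (at_left b)"
    using assms(1,2) by (rule continuous_on_Icc_at_leftD)
  moreover have "\<forall>\<^sub>F t in at_left b. U t = f t"
    using eventually_at_left_real[OF assms(2)] by eventually_elim (use assms(3) in auto)
  ultimately show ?thesis by (rule Lim_transform_eventually)
qed

lemma tendsto_at_right_eq:
  fixes U :: "real \<Rightarrow> 'a::topological_space"
  assumes "continuous_on {a..b} U" "a < b" "\<And>t. a < t \<Longrightarrow> t < b \<Longrightarrow> f t = U t"
  shows "(f \<longlongrightarrow> U a) (at_right a)"
proof -
  have "(U \<longlongrightarrow> U a) (at_right a)"
    using assms(1,2) by (rule continuous_on_Icc_at_rightD)
  moreover have "\<forall>\<^sub>F t in at_right a. U t = f t"
    using eventually_at_right_real[OF assms(2)] by eventually_elim (use assms(3) in auto)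
  ultimately show ?thesis by (rule Lim_transform_eventually)
qed

locale partition =
  fixes x :: "nat \<Rightarrow> real"
  assumes mono_x: "strict_mono x" and x_0: "x 0 = 0" and x_top: "filterlim x at_top sequentially"
begin

lemma x_less: "k \<ge> 1 \<Longrightarrow> x (k - 1) < x k"
  using mono_x by (simp add: strict_mono_def)

lemma x_le: "i \<le> j \<Longrightarrow> x i \<le> x j"
  using mono_x by (simp add: strict_mono_less_eq)

lemma x_nonneg: "0 \<le> x k"
  using x_le[of 0 k] x_0 by simp

lemma cell_eq:
  assumes "k \<ge> 1" "x (k - 1) \<le> t" "t < x k"
  shows "cell x t = k"
  unfolding cell_def
proof (rule Least_equality)
  fix j assume "t < x j"
  then have "x (k - 1) < x j" using assms by simp
  then show "k \<le> j" using mono_x strict_mono_less[of x "k - 1" j] by auto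
qed (rule assms(3))

lemma glue_eq:
  assumes "k \<ge> 1" "x (k - 1) \<le> t" "t < x k"
  shows "glue x F t = F k t"
  using cell_eq[OF assms] by (simp add: glue_def)

lemma eventually_x_gt: "\<exists>N. \<forall>n\<ge>N. R < x n"
  using x_top unfolding filterlim_at_top_dense eventually_sequentially by blast

lemma exists_cell:
  assumes "0 \<le> t"
  obtains k where "k \<ge> 1" "x (k - 1) \<le> t" "t < x k"
proof
  have ex: "\<exists>k. t < x k" using eventually_x_gt[of t] by blast
  then have lt: "t < x (cell x t)" unfolding cell_def by (rule LeastI_ex)
  show "t < x (cell x t)" by (rule lt)
  show ge: "cell x t \<ge> 1" using lt assms x_0 by (cases "cell x t") auto
  have "cell x t - 1 < cell x t" using ge by simp
  then have "\<not> t < x (cell x t - 1)" unfolding cell_def by (rule not_less_Least)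
  then show "x (cell x t - 1) \<le> t" by simp
qed

lemma L2_cell:
  "f \<in> L2 half_line \<Longrightarrow> f \<in> L2 (lebesgue_on {x (k - 1)<..<x k})"
  by (erule L2_subset) (use x_nonneg[of "k - 1"] in auto)

text \<open>Dominated convergence along the exhaustion by the intervals from 0 to
  \<open>x N\<close>. It reduces integrals over the half-line to single cells, where the calculus of
  \<open>ac\<close> is available.\<close>

lemma sum_cell_integrals_tendsto:
  fixes q :: "real \<Rightarrow> 'a::euclidean_space"
  assumes q: "integrable half_line q"
  shows "(\<lambda>N. \<Sum>k=1..N. integral {x (k - 1)..x k} q) \<longlonglongrightarrow> (LINT t|half_line. q t)"
proof -
  have q': "q absolutely_integrable_on {0<..}"
    using q by (simp add: integrable_restrict_space set_integrable_def)
  have sub: "q absolutely_integrable_on {0..b}" for b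
  proof -
    have "q absolutely_integrable_on {0<..<b}"
      using q' by (rule set_integrable_subset) auto
    then show ?thesis by (simp add: absolutely_integrable_on_Icc_iff_Ioo)
  qed
  have sum: "(\<Sum>k=1..N. integral {x (k - 1)..x k} q) = integral {0..x N} q" for N
  proof (induction N)
    case (Suc N)
    have "integral {0..x N} q + integral {x N..x (Suc N)} q = integral {0..x (Suc N)} q"
      using x_nonneg[of N] x_le[of N "Suc N"] set_lebesgue_integral_eq_integral(1)[OF sub]
      by (intro Henstock_Kurzweil_Integration.integral_combine) auto
    then show ?case using Suc by simp
  qed (simp add: x_0)
  have eq: "(LINT t|half_line. indicator {..<x N} t *\<^sub>R q t) = integral {0..x N} q" for N
  proof -
    have "(LINT t|half_line. indicator {..<x N} t *\<^sub>R q t) = (LINT t|lebesgue_on {0<..<x N}. q t)"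
      by (simp add: integral_restrict_space)
         (intro Bochner_Integration.integral_cong; auto simp: indicator_def)
    then show ?thesis by (simp add: lint_Ioo_eq_integral[OF sub])
  qed
  have "(\<lambda>N. LINT t|half_line. indicator {..<x N} t *\<^sub>R q t) \<longlonglongrightarrow> (LINT t|half_line. q t)"
  proof (rule integral_dominated_convergence[where w="\<lambda>t. norm (q t)"])
    show q_meas: "q \<in> borel_measurable half_line" using q by auto
    show "(\<lambda>t. indicator {..<x N} t *\<^sub>R q t) \<in> borel_measurable half_line" for N
      by (intro borel_measurable_scaleR q_meas measurable_restrict_space1 borel_measurable_indicator) auto
    show "AE t in half_line. (\<lambda>N. indicator {..<x N} t *\<^sub>R q t) \<longlonglongrightarrow> q t"
    proof (intro AE_I2)
      fix t
      obtain N where "\<forall>n\<ge>N. t < x n" using eventually_x_gt by blast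
      then have "\<forall>\<^sub>F n in sequentially. q t = indicator {..<x n} t *\<^sub>R q t"
        unfolding eventually_sequentially by (intro exI[of _ N]) auto
      then show "(\<lambda>N. indicator {..<x N} t *\<^sub>R q t) \<longlonglongrightarrow> q t"
        by (rule Lim_transform_eventually[OF tendsto_const])
    qed
    show "integrable half_line (\<lambda>t. norm (q t))" using q by auto
  qed (auto simp: indicator_def)
  then show ?thesis by (simp only: eq sum)
qed

text \<open>With its converse \<open>H_preD\<close> this confines weak derivatives and one-sided
  limits to the definition of \<open>H_pre\<close>; all later arguments handle values on closed
  cells. The function \<open>f\<close> is tied to the pieces only inside the cells.\<close>

lemma H_preI:
  fixes \<Lambda> :: "nat \<Rightarrow> complex ^ 'p ^ 'p"
  assumes sol: "interface_solution x \<Lambda> U U' g" and f: "f \<in> L2 half_line" and g: "g \<in> L2 half_line"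
    and R: "\<And>t. t > R \<Longrightarrow> f t = 0"
    and fU: "\<And>k t. k \<ge> 1 \<Longrightarrow> x (k - 1) < t \<Longrightarrow> t < x k \<Longrightarrow> f t = U k t"
  shows "(f, g) \<in> H_pre x \<Lambda>"
proof -
  define f' where "f' = glue x U'"
  have f'U: "f' t = U' k t" if "k \<ge> 1" "x (k - 1) < t" "t < x k" for k t
    using glue_eq[of k t U'] that by (simp add: f'_def)
  have acU: "ac (x (k - 1)) (x k) (U k) (U' k)" "ac (x (k - 1)) (x k) (U' k) (\<lambda>t. - g t)" if "k \<ge> 1" for k
    using sol that by (auto simp: interface_solution_def)
  have w2: "has_L2_weak_deriv (x (k - 1)) (x k) f' (\<lambda>t. - g t)" if k: "k \<ge> 1" for k
    by (rule ac_imp_weak_deriv[OF x_less[OF k] acU(2)[OF k]])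
       (use f'U[OF k] L2_uminus[OF L2_cell[OF g]] in auto)
  have w1: "has_L2_weak_deriv (x (k - 1)) (x k) f f'" if k: "k \<ge> 1" for k
  proof (rule ac_imp_weak_deriv[OF x_less[OF k]])
    show "ac (x (k - 1)) (x k) (U k) f'"
      by (rule ac_cong[OF acU(1)[OF k]]) (use f'U[OF k] in auto)
    show "f' \<in> L2 (lebesgue_on {x (k - 1)<..<x k})"
      using w2[OF k] by (simp add: has_L2_weak_deriv_def)
  qed (use fU[OF k] in auto)
  have cont: "continuous_on {x (k - 1)..x k} (U k)" "continuous_on {x (k - 1)..x k} (U' k)" if "k \<ge> 1" for k
    using acU[OF that] by (auto dest: ac_continuous_on)
  have left: "(f \<longlongrightarrow> U k (x k)) (at_left (x k))" "(f' \<longlongrightarrow> U' k (x k)) (at_left (x k))" if k: "k \<ge> 1" for k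
    using tendsto_at_left_eq[OF cont(1)[OF k] x_less[OF k] fU[OF k]]
      tendsto_at_left_eq[OF cont(2)[OF k] x_less[OF k] f'U[OF k]] by auto
  have right: "(f \<longlongrightarrow> U k (x (k - 1))) (at_right (x (k - 1)))" "(f' \<longlongrightarrow> U' k (x (k - 1))) (at_right (x (k - 1)))"
    if k: "k \<ge> 1" for k
    using tendsto_at_right_eq[OF cont(1)[OF k] x_less[OF k] fU[OF k]]
      tendsto_at_right_eq[OF cont(2)[OF k] x_less[OF k] f'U[OF k]] by auto
  show ?thesis
    unfolding H_pre_def
  proof (intro CollectI case_prodI conjI f g exI[of _ R] exI[of _ f'] allI impI R)
    fix k :: nat assume k: "1 \<le> k"
    show "f \<in> W22 (x (k - 1)) (x k)"
      using w1[OF k] w2[OF k] by (auto simp: W22_def W12_def)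
    show "has_L2_weak_deriv (x (k - 1)) (x k) f f'" "has_L2_weak_deriv (x (k - 1)) (x k) f' (\<lambda>t. - g t)"
      by (fact w1[OF k] w2[OF k])+
    show "continuous_on {x (k - 1)<..<x k} f"
      by (rule continuous_on_eq[OF continuous_on_subset[OF cont(1)[OF k]]]) (use fU[OF k] in auto)
    show "continuous_on {x (k - 1)<..<x k} f'"
      by (rule continuous_on_eq[OF continuous_on_subset[OF cont(2)[OF k]]]) (use f'U[OF k] in auto)
    show "\<exists>c l r. (f \<longlongrightarrow> c) (at_left (x k)) \<and> (f \<longlongrightarrow> c) (at_right (x k)) \<and>
           (f' \<longlongrightarrow> l) (at_left (x k)) \<and> (f' \<longlongrightarrow> r) (at_right (x k)) \<and> r - l = \<Lambda> k *v c"
    proof (intro exI conjI)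
      show "(f \<longlongrightarrow> U k (x k)) (at_right (x k))"
        using right(1)[of "Suc k"] sol k by (simp add: interface_solution_def)
      show "(f' \<longlongrightarrow> U' (Suc k) (x k)) (at_right (x k))"
        using right(2)[of "Suc k"] by simp
      show "U' (Suc k) (x k) - U' k (x k) = \<Lambda> k *v U k (x k)"
        using sol k by (simp add: interface_solution_def)
    qed (use left[OF k] in auto)
  next
    show "(f' \<longlongrightarrow> 0) (at_right 0)"
      using right(2)[of 1] sol x_0 by (simp add: interface_solution_def)
  qed
qed

text \<open>Continuity inside the cells selects the representatives that extend to closed cells;
  uniqueness of one-sided limits then identifies their end values with the limits in the
  definition.\<close>

lemma H_preD:
  fixes \<Lambda> :: "nat \<Rightarrow> complex ^ 'p ^ 'p"
  assumes "(f, g) \<in> H_pre x \<Lambda>"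
  obtains U U' where "interface_solution x \<Lambda> U U' g"
    "\<And>k t. k \<ge> 1 \<Longrightarrow> x (k - 1) < t \<Longrightarrow> t < x k \<Longrightarrow> f t = U k t"
proof -
  obtain f' where weak: "\<And>k. k \<ge> 1 \<Longrightarrow> has_L2_weak_deriv (x (k - 1)) (x k) f f' \<and>
           has_L2_weak_deriv (x (k - 1)) (x k) f' (\<lambda>t. - g t) \<and>
           continuous_on {x (k - 1)<..<x k} f \<and> continuous_on {x (k - 1)<..<x k} f'"
    and zero: "(f' \<longlongrightarrow> 0) (at_right 0)"
    and jump: "\<And>k. k \<ge> 1 \<Longrightarrow> \<exists>c l r.
           (f \<longlongrightarrow> c) (at_left (x k)) \<and> (f \<longlongrightarrow> c) (at_right (x k)) \<and>
           (f' \<longlongrightarrow> l) (at_left (x k)) \<and> (f' \<longlongrightarrow> r) (at_right (x k)) \<and>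
           r - l = \<Lambda> k *v c"
    using assms unfolding H_pre_def by blast
  have "\<exists>V. ac (x (k - 1)) (x k) V f' \<and> (\<forall>t\<in>{x (k - 1)<..<x k}. f t = V t)" if k: "k \<ge> 1" for k
    using weak[OF k] by (intro weak_deriv_imp_ac[OF x_less[OF k]]) auto
  then obtain U where U: "\<And>k. k \<ge> 1 \<Longrightarrow> ac (x (k - 1)) (x k) (U k) f'"
    "\<And>k t. k \<ge> 1 \<Longrightarrow> x (k - 1) < t \<Longrightarrow> t < x k \<Longrightarrow> f t = U k t"
    by (metis greaterThanLessThan_iff)
  have "\<exists>V. ac (x (k - 1)) (x k) V (\<lambda>t. - g t) \<and> (\<forall>t\<in>{x (k - 1)<..<x k}. f' t = V t)" if k: "k \<ge> 1" for k
    using weak[OF k] by (intro weak_deriv_imp_ac[OF x_less[OF k]]) auto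
  then obtain U' where U': "\<And>k. k \<ge> 1 \<Longrightarrow> ac (x (k - 1)) (x k) (U' k) (\<lambda>t. - g t)"
    "\<And>k t. k \<ge> 1 \<Longrightarrow> x (k - 1) < t \<Longrightarrow> t < x k \<Longrightarrow> f' t = U' k t"
    by (metis greaterThanLessThan_iff)
  have UU': "ac (x (k - 1)) (x k) (U k) (U' k)" if k: "k \<ge> 1" for k
    by (rule ac_cong[OF U(1)[OF k]]) (use U'(2)[OF k] in auto)
  have cont: "continuous_on {x (k - 1)..x k} (U k)" "continuous_on {x (k - 1)..x k} (U' k)" if "k \<ge> 1" for k
    using U(1)[OF that] U'(1)[OF that] by (auto dest: ac_continuous_on)
  have left: "(f \<longlongrightarrow> U k (x k)) (at_left (x k))" "(f' \<longlongrightarrow> U' k (x k)) (at_left (x k))" if k: "k \<ge> 1" for k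
    using tendsto_at_left_eq[OF cont(1)[OF k] x_less[OF k] U(2)[OF k]]
      tendsto_at_left_eq[OF cont(2)[OF k] x_less[OF k] U'(2)[OF k]] by auto
  have right: "(f \<longlongrightarrow> U k (x (k - 1))) (at_right (x (k - 1)))" "(f' \<longlongrightarrow> U' k (x (k - 1))) (at_right (x (k - 1)))"
    if k: "k \<ge> 1" for k
    using tendsto_at_right_eq[OF cont(1)[OF k] x_less[OF k] U(2)[OF k]]
      tendsto_at_right_eq[OF cont(2)[OF k] x_less[OF k] U'(2)[OF k]] by auto
  show ?thesis
  proof
    show "interface_solution x \<Lambda> U U' g"
      unfolding interface_solution_def
    proof (intro conjI allI impI UU' U'(1))
      show "U' 1 (x 0) = 0"
        using tendsto_unique[OF _ right(2)[of 1], of 0] zero x_0 by simp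
      fix k :: nat assume k: "1 \<le> k"
      obtain c l r where clr: "(f \<longlongrightarrow> c) (at_left (x k))" "(f \<longlongrightarrow> c) (at_right (x k))"
        "(f' \<longlongrightarrow> l) (at_left (x k))" "(f' \<longlongrightarrow> r) (at_right (x k))" "r - l = \<Lambda> k *v c"
        using jump[OF k] by blast
      have "U k (x k) = c" "U' k (x k) = l"
        using tendsto_unique[OF trivial_limit_at_left_real left(1)[OF k] clr(1)]
          tendsto_unique[OF trivial_limit_at_left_real left(2)[OF k] clr(3)] by auto
      moreover have "U (Suc k) (x k) = c" "U' (Suc k) (x k) = r"
        using tendsto_unique[OF trivial_limit_at_right_real _ clr(2)] right(1)[of "Suc k"]
          tendsto_unique[OF trivial_limit_at_right_real _ clr(4)] right(2)[of "Suc k"] by auto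
      ultimately show "U (Suc k) (x k) = U k (x k)" "U' (Suc k) (x k) - U' k (x k) = \<Lambda> k *v U k (x k)"
        using clr(5) by auto
    qed
  qed (rule U(2))
qed

end

section \<open>Green's formula and symmetry\<close>

text \<open>The right-hand side is the increment of the Wronskian-type form
  \<open>hip u v' - hip u' v\<close>; in its derivative the two terms \<open>hip u' v'\<close>
  cancel.\<close>

lemma green_interval:
  fixes u v :: "real \<Rightarrow> complex ^ 'p"
  assumes u: "ac a b u u'" "ac a b u' (\<lambda>t. - g t)" and v: "ac a b v v'" "ac a b v' (\<lambda>t. - w t)"
    and "a \<le> b"
  shows "integral {a..b} (\<lambda>t. hip (g t) (v t) - hip (u t) (w t)) =
    (hip (u b) (v' b) - hip (u' b) (v b)) - (hip (u a) (v' a) - hip (u' a) (v a))"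
proof -
  interpret hip: bounded_bilinear "hip :: complex ^ 'p \<Rightarrow> complex ^ 'p \<Rightarrow> complex"
    by (rule hip_bilinear)
  have "ac a b (\<lambda>t. hip (u t) (v' t) - hip (u' t) (v t))
     (\<lambda>t. (hip (u t) (- w t) + hip (u' t) (v' t)) - (hip (u' t) (v' t) + hip (- g t) (v t)))"
    by (intro ac_diff_fun ac_prod[OF hip_bilinear] u v)
  then have "ac a b (\<lambda>t. hip (u t) (v' t) - hip (u' t) (v t)) (\<lambda>t. hip (g t) (v t) - hip (u t) (w t))"
    by (rule ac_cong) (simp_all add: hip.minus_left hip.minus_right)
  from ac_diff[OF this, of a b] show ?thesis using assms(5) by simp
qed

text \<open>Compact support says only that \<open>f\<close> vanishes inside distant cells. Here this
  passes to the end values of the piece and of its derivative, which are what Green's formula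
  contains. As \<open>u'\<close> is continuous it is a genuine derivative, so it vanishes as
  well.\<close>

lemma ac_vanishing:
  fixes u :: "real \<Rightarrow> 'a::euclidean_space"
  assumes "ac a b u u'" "continuous_on {a..b} u'" "a < b" "\<And>t. a < t \<Longrightarrow> t < b \<Longrightarrow> u t = 0"
    and t: "t \<in> {a..b}"
  shows "u t = 0" "u' t = 0"
proof -
  have cl: "closure {a<..<b} = {a..b}" using assms(3) by simp
  show "u t = 0"
    by (rule continuous_constant_on_closure[of "{a<..<b}" u]) (use assms ac_continuous_on cl in auto)
  have "u' s = 0" if s: "s \<in> {a<..<b}" for s
  proof -
    have "((\<lambda>t. integral {a..t} u') has_vector_derivative u' s) (at s within {a..b})"
      using s by (intro integral_has_vector_derivative assms(2)) auto
    moreover have "at s within {a..b} = at s"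
      using s by (intro at_within_interior) auto
    ultimately have "((\<lambda>t. integral {a..t} u') has_vector_derivative u' s) (at s)" by simp
    moreover have "((\<lambda>t. - u a) has_vector_derivative 0) (at s)" by simp
    then have "((\<lambda>t. integral {a..t} u') has_vector_derivative 0) (at s)"
    proof (rule has_vector_derivative_transform_within_open[of _ _ _ "{a<..<b}"])
      fix y assume "y \<in> {a<..<b}"
      then show "- u a = integral {a..y} u'"
        using ac_diff[OF assms(1), of a y] assms(4)[of y] by simp
    qed (use s in auto)
    ultimately show ?thesis using vector_derivative_unique_at by blast
  qed
  then show "u' t = 0"
    using continuous_constant_on_closure[of "{a<..<b}" u' 0 t] assms(2) cl t by auto
qed

text \<open>Interior estimate: integrate the derivative of \<open>\<eta>\<^sup>2 (u \<bullet> u')\<close>, which vanishes at both ends.\<close>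

lemma interior_gradient_estimate:
  fixes u :: "real \<Rightarrow> complex ^ 'p"
  assumes u: "ac a b u u'" "ac a b u' w" and wL: "w \<in> L2 (lebesgue_on {a<..<b})"
    and \<eta>: "ac a b \<eta> \<eta>'" "continuous_on {a..b} \<eta>'" "\<eta> a = 0" "\<eta> b = 0"
    and A: "\<And>t. t \<in> {a..b} \<Longrightarrow> \<bar>\<eta> t\<bar> \<le> A" and B: "\<And>t. t \<in> {a..b} \<Longrightarrow> \<bar>\<eta>' t\<bar> \<le> B"
    and "a \<le> b"
  shows "integral {a..b} (\<lambda>t. (\<eta> t)\<^sup>2 * (norm (u' t))\<^sup>2)
    \<le> (A\<^sup>2 + 4 * B\<^sup>2) * integral {a..b} (\<lambda>t. (norm (u t))\<^sup>2 + (norm (w t))\<^sup>2)"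
proof -
  define Q' where "Q' = (\<lambda>t. (\<eta> t * \<eta> t) * (u t \<bullet> w t + u' t \<bullet> u' t) + (\<eta> t * \<eta>' t + \<eta>' t * \<eta> t) * (u t \<bullet> u' t))"
  have Q: "ac a b (\<lambda>t. (\<eta> t * \<eta> t) * (u t \<bullet> u' t)) Q'"
    unfolding Q'_def
    by (intro ac_prod[OF bounded_bilinear_mult] ac_prod[OF bounded_bilinear_inner] u \<eta>)
  have Q0: "(Q' has_integral 0) {a..b}"
    using ac_diff[OF Q, of a b] \<eta> integrable_integral[OF ac_integrable_on_sub[OF Q, of a b]] assms(10) by simp
  have cu: "continuous_on {a..b} u" "continuous_on {a..b} u'" "continuous_on {a..b} \<eta>"
    using u \<eta>(1) by (auto dest: ac_continuous_on)
  have i1: "(\<lambda>t. (\<eta> t)\<^sup>2 * (norm (u' t))\<^sup>2) integrable_on {a..b}"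
    by (intro integrable_continuous_real continuous_intros cu)
  have iu: "(\<lambda>t. (norm (u t))\<^sup>2) integrable_on {a..b}"
    by (intro integrable_continuous_real continuous_intros cu)
  have "integrable (lebesgue_on {a<..<b}) (\<lambda>t. (norm (w t))\<^sup>2)"
    using wL by (simp add: L2_def)
  then have "(\<lambda>t. (norm (w t))\<^sup>2) absolutely_integrable_on {a<..<b}"
    by (simp add: integrable_restrict_space set_integrable_def)
  then have iw: "(\<lambda>t. (norm (w t))\<^sup>2) integrable_on {a..b}"
    unfolding absolutely_integrable_on_Icc_iff_Ioo[symmetric] by (rule set_lebesgue_integral_eq_integral(1))
  have iuw: "(\<lambda>t. (norm (u t))\<^sup>2 + (norm (w t))\<^sup>2) integrable_on {a..b}"
    by (intro integrable_add iu iw)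
  \<comment> \<open>Adding \<open>Q'\<close> costs nothing because its integral is 0. It contributes
    one full copy of the weighted \<open>u'\<close> term, half of which pays for the mixed
    term.\<close>
  have "integral {a..b} (\<lambda>t. (1/2) * ((\<eta> t)\<^sup>2 * (norm (u' t))\<^sup>2))
     \<le> integral {a..b} (\<lambda>t. Q' t + (A\<^sup>2 / 2 + 2 * B\<^sup>2) * ((norm (u t))\<^sup>2 + (norm (w t))\<^sup>2))"
  proof (rule integral_le)
    show "(\<lambda>t. (1/2) * ((\<eta> t)\<^sup>2 * (norm (u' t))\<^sup>2)) integrable_on {a..b}"
      using integrable_on_cmult_left[OF i1, of "1/2"] by simp
    show "(\<lambda>t. Q' t + (A\<^sup>2 / 2 + 2 * B\<^sup>2) * ((norm (u t))\<^sup>2 + (norm (w t))\<^sup>2)) integrable_on {a..b}"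
      using Q0 integrable_on_cmult_left[OF iuw, of "A\<^sup>2 / 2 + 2 * B\<^sup>2"] by (intro integrable_add) auto
    fix t assume t: "t \<in> {a..b}"
    have A2: "(\<eta> t)\<^sup>2 \<le> A\<^sup>2" using A[OF t] by (metis abs_ge_zero power2_abs power_mono)
    have B2: "(\<eta>' t)\<^sup>2 \<le> B\<^sup>2" using B[OF t] by (metis abs_ge_zero power2_abs power_mono)
    have "- (u t \<bullet> w t) \<le> norm (u t) * norm (w t)"
      using Cauchy_Schwarz_ineq2[of "u t" "w t"] by simp
    also have "\<dots> \<le> ((norm (u t))\<^sup>2 + (norm (w t))\<^sup>2) / 2"
      using sum_squares_bound[of "norm (u t)" "norm (w t)"] by simp
    finally have "(\<eta> t)\<^sup>2 * (- (u t \<bullet> w t)) \<le> (\<eta> t)\<^sup>2 * (((norm (u t))\<^sup>2 + (norm (w t))\<^sup>2) / 2)"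
      by (intro mult_left_mono) auto
    also have "\<dots> \<le> A\<^sup>2 * (((norm (u t))\<^sup>2 + (norm (w t))\<^sup>2) / 2)"
      using A2 by (intro mult_right_mono) auto
    finally have 1: "- ((\<eta> t)\<^sup>2 * (u t \<bullet> w t)) \<le> A\<^sup>2 / 2 * ((norm (u t))\<^sup>2 + (norm (w t))\<^sup>2)"
      by simp
    have "- (2 * (\<eta> t * \<eta>' t) * (u t \<bullet> u' t)) \<le> \<bar>2 * (\<eta> t * \<eta>' t) * (u t \<bullet> u' t)\<bar>"
      by simp
    also have "\<dots> = 2 * \<bar>\<eta> t\<bar> * \<bar>\<eta>' t\<bar> * \<bar>u t \<bullet> u' t\<bar>"
      by (simp add: abs_mult)
    also have "\<dots> \<le> 2 * \<bar>\<eta> t\<bar> * \<bar>\<eta>' t\<bar> * (norm (u t) * norm (u' t))"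
      by (intro mult_left_mono Cauchy_Schwarz_ineq2) auto
    \<comment> \<open>The factors \<open>sqrt 2\<close> split the mixed term so that exactly half of
      the weighted \<open>u'\<close> term is spent.\<close>
    also have "\<dots> = 2 * (\<bar>\<eta> t\<bar> * norm (u' t) / sqrt 2) * (sqrt 2 * (\<bar>\<eta>' t\<bar> * norm (u t)))"
      by simp
    also have "\<dots> \<le> (\<bar>\<eta> t\<bar> * norm (u' t) / sqrt 2)\<^sup>2 + (sqrt 2 * (\<bar>\<eta>' t\<bar> * norm (u t)))\<^sup>2"
      by (rule sum_squares_bound)
    also have "\<dots> = (1/2) * ((\<eta> t)\<^sup>2 * (norm (u' t))\<^sup>2) + 2 * ((\<eta>' t)\<^sup>2 * (norm (u t))\<^sup>2)"
      by (simp add: power_mult_distrib power_divide)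
    also have "\<dots> \<le> (1/2) * ((\<eta> t)\<^sup>2 * (norm (u' t))\<^sup>2) + 2 * (B\<^sup>2 * ((norm (u t))\<^sup>2 + (norm (w t))\<^sup>2))"
      using B2 by (intro add_left_mono mult_left_mono mult_mono) auto
    finally have 2: "- (2 * (\<eta> t * \<eta>' t) * (u t \<bullet> u' t)) \<le> (1/2) * ((\<eta> t)\<^sup>2 * (norm (u' t))\<^sup>2) + 2 * B\<^sup>2 * ((norm (u t))\<^sup>2 + (norm (w t))\<^sup>2)"
      by simp
    have "Q' t = (\<eta> t)\<^sup>2 * (u t \<bullet> w t) + (\<eta> t)\<^sup>2 * (norm (u' t))\<^sup>2 + 2 * (\<eta> t * \<eta>' t) * (u t \<bullet> u' t)"
      by (simp add: Q'_def power2_eq_square[of "\<eta> t"] dot_square_norm algebra_simps)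
    moreover have "(A\<^sup>2 / 2 + 2 * B\<^sup>2) * ((norm (u t))\<^sup>2 + (norm (w t))\<^sup>2) =
        A\<^sup>2 / 2 * ((norm (u t))\<^sup>2 + (norm (w t))\<^sup>2) + 2 * B\<^sup>2 * ((norm (u t))\<^sup>2 + (norm (w t))\<^sup>2)"
      by (rule distrib_right)
    ultimately show "(1/2) * ((\<eta> t)\<^sup>2 * (norm (u' t))\<^sup>2) \<le> Q' t + (A\<^sup>2 / 2 + 2 * B\<^sup>2) * ((norm (u t))\<^sup>2 + (norm (w t))\<^sup>2)"
      using 1 2 by linarith
  qed
  also have "\<dots> = (A\<^sup>2 / 2 + 2 * B\<^sup>2) * integral {a..b} (\<lambda>t. (norm (u t))\<^sup>2 + (norm (w t))\<^sup>2)"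
    using Q0 integrable_on_cmult_left[OF iuw, of "A\<^sup>2 / 2 + 2 * B\<^sup>2"]
    by (subst Henstock_Kurzweil_Integration.integral_add) (auto simp: integral_unique)
  finally show ?thesis
    by (simp add: algebra_simps)
qed

section \<open>Symmetry of the minimal operator\<close>

context partition
begin

text \<open>The boundary forms telescope. At a node the jumps contribute
  \<open>hip U (\<Lambda> V) - hip (\<Lambda> U) V\<close>, which is zero for a Hermitian matrix,
  and at 0 the Neumann condition removes the form; only the last end remains.\<close>

lemma green_partial_sum:
  fixes \<Lambda> :: "nat \<Rightarrow> complex ^ 'p ^ 'p"
  assumes U: "interface_solution x \<Lambda> U U' g" and V: "interface_solution x \<Lambda> V V' w"
    and herm: "\<And>k. k \<ge> 1 \<Longrightarrow> conj_transpose (\<Lambda> k) = \<Lambda> k"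
  shows "(\<Sum>k=1..Suc N. integral {x (k - 1)..x k} (\<lambda>t. hip (g t) (V k t) - hip (U k t) (w t))) =
    hip (U (Suc N) (x (Suc N))) (V' (Suc N) (x (Suc N))) - hip (U' (Suc N) (x (Suc N))) (V (Suc N) (x (Suc N)))"
proof (induction N)
  interpret hip: bounded_bilinear "hip :: complex ^ 'p \<Rightarrow> complex ^ 'p \<Rightarrow> complex"
    by (rule hip_bilinear)
  have acU: "ac (x (k - 1)) (x k) (U k) (U' k)" "ac (x (k - 1)) (x k) (U' k) (\<lambda>t. - g t)" if "k \<ge> 1" for k
    using U that by (auto simp: interface_solution_def)
  have acV: "ac (x (k - 1)) (x k) (V k) (V' k)" "ac (x (k - 1)) (x k) (V' k) (\<lambda>t. - w t)" if "k \<ge> 1" for k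
    using V that by (auto simp: interface_solution_def)
  note cell = green_interval[OF acU acV less_imp_le[OF x_less]]
  {
    case 0
    show ?case
      using cell[of 1] U V by (simp add: interface_solution_def hip.zero_left hip.zero_right)
  next
    case (Suc N)
    define k where "k = Suc N"
    have U': "U' (Suc k) (x k) = U' k (x k) + \<Lambda> k *v U k (x k)"
      and V': "V' (Suc k) (x k) = V' k (x k) + \<Lambda> k *v V k (x k)"
      and UV: "U (Suc k) (x k) = U k (x k)" "V (Suc k) (x k) = V k (x k)"
      using U V by (auto simp: interface_solution_def k_def diff_eq_eq add.commute)
    have \<Lambda>k: "hip (\<Lambda> k *v a) b = hip a (\<Lambda> k *v b)" for a b
      by (rule hip_selfadjoint_matrix[OF herm]) (simp add: k_def)
    have "hip (U (Suc k) (x k)) (V' (Suc k) (x k)) - hip (U' (Suc k) (x k)) (V (Suc k) (x k))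
        = hip (U k (x k)) (V' k (x k)) - hip (U' k (x k)) (V k (x k))"
      unfolding U' V' UV
      by (simp add: hip.add_left hip.add_right \<Lambda>k)
    then show ?case
      using Suc cell[of "Suc k"] by (simp add: k_def)
  }
qed

lemma H_pre_symmetric:
  fixes \<Lambda> :: "nat \<Rightarrow> complex ^ 'p ^ 'p"
  assumes fg: "(f, g) \<in> H_pre x \<Lambda>" and uw: "(u, w) \<in> H_pre x \<Lambda>"
    and herm: "\<And>k. k \<ge> 1 \<Longrightarrow> conj_transpose (\<Lambda> k) = \<Lambda> k"
  shows "L2_inner half_line g u = L2_inner half_line f w"
proof -
  have L2: "f \<in> L2 half_line" "g \<in> L2 half_line" "u \<in> L2 half_line" "w \<in> L2 half_line"
    using fg uw by (auto simp: H_pre_def)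
  obtain R where R: "\<And>t. t > R \<Longrightarrow> f t = 0" using fg by (auto simp: H_pre_def)
  obtain U U' where U: "interface_solution x \<Lambda> U U' g"
    "\<And>k t. k \<ge> 1 \<Longrightarrow> x (k - 1) < t \<Longrightarrow> t < x k \<Longrightarrow> f t = U k t"
    using H_preD[OF fg] by metis
  obtain V V' where V: "interface_solution x \<Lambda> V V' w"
    "\<And>k t. k \<ge> 1 \<Longrightarrow> x (k - 1) < t \<Longrightarrow> t < x k \<Longrightarrow> u t = V k t"
    using H_preD[OF uw] by metis
  define q where "q t = hip (g t) (u t) - hip (f t) (w t)" for t
  have q: "integrable half_line q"
    unfolding q_def by (intro Bochner_Integration.integrable_diff hip_L2_integrable L2)
  obtain M where M: "\<forall>n\<ge>M. R < x n" using eventually_x_gt by blast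
  \<comment> \<open>The shift by one puts the left end of the last cell beyond \<open>R\<close>, so
    \<open>f\<close> vanishes on that whole cell and the remaining boundary form is zero.\<close>
  have "(\<Sum>k=1..N. integral {x (k - 1)..x k} q) = 0" if "N \<ge> Suc M" for N
  proof -
    obtain N' where N: "N = Suc N'" "N' \<ge> M" using \<open>N \<ge> Suc M\<close> by (cases N) auto
    have "(\<Sum>k=1..N. integral {x (k - 1)..x k} q) =
       (\<Sum>k=1..N. integral {x (k - 1)..x k} (\<lambda>t. hip (g t) (V k t) - hip (U k t) (w t)))"
    proof (rule sum.cong[OF refl])
      fix k assume k: "k \<in> {1..N}"
      show "integral {x (k - 1)..x k} q = integral {x (k - 1)..x k} (\<lambda>t. hip (g t) (V k t) - hip (U k t) (w t))"
        by (rule integral_spike[of "{x (k - 1), x k}"]) (use U(2)[of k] V(2)[of k] k in \<open>auto simp: q_def\<close>)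
    qed
    also have "\<dots> = hip (U N (x N)) (V' N (x N)) - hip (U' N (x N)) (V N (x N))"
      unfolding N(1) by (rule green_partial_sum[OF U(1) V(1) herm])
    also have "\<dots> = 0"
    proof -
      have ac: "ac (x N') (x N) (U N) (U' N)" "ac (x N') (x N) (U' N) (\<lambda>t. - g t)"
        using U(1) unfolding interface_solution_def N(1) by (metis diff_Suc_1 le_add1 plus_1_eq_Suc)+
      have lt: "x N' < x N" using x_less[of N] N by simp
      have "U N t = 0" if "x N' < t" "t < x N" for t
        using U(2)[of N t] R[of t] M N that by force
      then have "U N (x N) = 0" "U' N (x N) = 0"
        using ac_vanishing[OF ac(1) ac_continuous_on[OF ac(2)] lt, of "x N"] lt by auto
      then show ?thesis
        by (simp add: bounded_bilinear.zero_left[OF hip_bilinear])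
    qed
    finally show ?thesis .
  qed
  then have "(\<lambda>N. \<Sum>k=1..N. integral {x (k - 1)..x k} q) \<longlonglongrightarrow> 0"
    by (intro tendsto_eventually) (auto simp: eventually_sequentially)
  then have "(LINT t|half_line. q t) = 0"
    using sum_cell_integrals_tendsto[OF q] LIMSEQ_unique by blast
  then show ?thesis
    using hip_L2_integrable[OF L2(2,3)] hip_L2_integrable[OF L2(1,4)]
    by (simp add: q_def L2_inner_eq_hip)
qed

end

section \<open>Cutoffs\<close>

lemma L2_indicator:
  fixes F :: "real \<Rightarrow> complex ^ 'p"
  assumes F: "F \<in> L2 (lebesgue_on A)" and "A \<subseteq> T" "A \<in> sets lebesgue" "T \<in> sets lebesgue"
  shows "(\<lambda>t. indicator A t *\<^sub>R F t) \<in> L2 (lebesgue_on T)"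
proof -
  have "(\<lambda>t. if t \<in> A then F t else 0) \<in> borel_measurable lebesgue"
    using L2_measurable[OF F] assms(3) by (rule borel_measurable_if_I)
  then have "(\<lambda>t. indicator A t *\<^sub>R F t) \<in> borel_measurable lebesgue"
    by (rule measurable_cong[THEN iffD1, rotated]) (auto simp: indicator_def)
  then have m: "(\<lambda>t. indicator A t *\<^sub>R F t) \<in> borel_measurable (lebesgue_on T)"
    by (rule measurable_restrict_space1)
  have "integrable lebesgue (\<lambda>t. indicator A t *\<^sub>R (norm (F t))\<^sup>2)"
    using L2_square_integrable[OF F] assms(3) by (simp add: integrable_restrict_space)
  then have "integrable lebesgue (\<lambda>t. indicator T t *\<^sub>R (norm (indicator A t *\<^sub>R F t))\<^sup>2)"
    by (rule Bochner_Integration.integrable_cong[THEN iffD1, rotated -1])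
       (use assms(2) in \<open>auto simp: indicator_def\<close>)
  then show ?thesis
    using m assms(4) by (simp add: L2_def integrable_restrict_space)
qed

lemma L2_sum:
  "finite K \<Longrightarrow> (\<And>k. k \<in> K \<Longrightarrow> F k \<in> L2 M) \<Longrightarrow> (\<lambda>t. \<Sum>k\<in>K. F k t) \<in> L2 M"
  by (induction K rule: finite_induct) (auto intro: L2_add L2_zero)

context partition
begin

text \<open>Off the nodes the glued function is a finite sum of pieces cut off by indicators. The
  bound \<open>n\<close> makes the sum finite; no uniform bound over the cells is then
  required.\<close>

lemma L2_glue:
  fixes F :: "nat \<Rightarrow> real \<Rightarrow> complex ^ 'p"
  assumes F: "\<And>k. k \<ge> 1 \<Longrightarrow> F k \<in> L2 (lebesgue_on {x (k - 1)<..<x k})"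
    and zero: "\<And>k t. k > n \<Longrightarrow> x (k - 1) \<le> t \<Longrightarrow> t < x k \<Longrightarrow> F k t = 0"
  shows "glue x F \<in> L2 half_line"
proof (rule L2_spike)
  let ?I = "\<lambda>k. {x (k - 1)<..<x k}"
  show "(\<lambda>t. \<Sum>k=1..n. indicator (?I k) t *\<^sub>R F k t) \<in> L2 half_line"
  proof (intro L2_sum L2_indicator)
    fix k assume "k \<in> {1..n}"
    then show "F k \<in> L2 (lebesgue_on (?I k))" using F by auto
    show "?I k \<subseteq> {0<..}" using x_nonneg[of "k - 1"] by auto
  qed auto
  show "negligible (range x)"
    by (simp add: negligible_iff_null_sets null_sets_completionI countable_imp_null_set_lborel)
  fix t assume t: "t \<in> {0<..} - range x"
  then obtain k where k: "k \<ge> 1" "x (k - 1) \<le> t" "t < x k"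
    using exists_cell[of t] by auto
  have cell: "t \<in> ?I j \<longleftrightarrow> j = k" if "j \<ge> 1" for j
    using cell_eq[OF that, of t] cell_eq[OF k] k t
    by (metis DiffE greaterThanLessThan_iff less_eq_real_def rangeI)
  have "(\<Sum>j=1..n. indicator (?I j) t *\<^sub>R F j t) = (\<Sum>j=1..n. if j = k then F k t else 0)"
    by (intro sum.cong refl) (use cell in \<open>auto simp: indicator_def\<close>)
  also have "\<dots> = F k t"
    using k zero[of k t] by (auto simp: sum.delta)
  finally show "glue x F t = (\<Sum>j=1..n. indicator (?I j) t *\<^sub>R F j t)"
    using glue_eq[OF k] by simp
qed auto

text \<open>The derivative is \<open>c u' + c' u\<close>. Flatness of the cutoff at the nodes
  removes the second term there, so the jump is \<open>c\<close> times the old one, as the condition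
  for \<open>c u\<close> demands, and the Neumann condition persists. The glued function is the
  negative second derivative of \<open>c u\<close>.\<close>

lemma interface_solution_mult:
  fixes \<Lambda> :: "nat \<Rightarrow> complex ^ 'p ^ 'p"
  assumes U: "interface_solution x \<Lambda> U U' g"
    and c: "\<And>k. k \<ge> 1 \<Longrightarrow> ac (x (k - 1)) (x k) (c k) (c' k)" "\<And>k. k \<ge> 1 \<Longrightarrow> ac (x (k - 1)) (x k) (c' k) (c'' k)"
    and cont: "\<And>k. k \<ge> 1 \<Longrightarrow> c (Suc k) (x k) = c k (x k)"
    and flat: "\<And>k. k \<ge> 1 \<Longrightarrow> c' k (x k) = 0" "\<And>k. k \<ge> 1 \<Longrightarrow> c' k (x (k - 1)) = 0"
  shows "interface_solution x \<Lambda> (\<lambda>k t. c k t *\<^sub>R U k t) (\<lambda>k t. c k t *\<^sub>R U' k t + c' k t *\<^sub>R U k t)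
     (glue x (\<lambda>k t. c k t *\<^sub>R g t - (2 * c' k t) *\<^sub>R U' k t - c'' k t *\<^sub>R U k t))"
  unfolding interface_solution_def
proof (intro conjI allI impI)
  fix k :: nat assume k: "k \<ge> 1"
  have acU: "ac (x (k - 1)) (x k) (U k) (U' k)" "ac (x (k - 1)) (x k) (U' k) (\<lambda>t. - g t)"
    using U k by (auto simp: interface_solution_def)
  show "ac (x (k - 1)) (x k) (\<lambda>t. c k t *\<^sub>R U k t) (\<lambda>t. c k t *\<^sub>R U' k t + c' k t *\<^sub>R U k t)"
    by (rule ac_prod[OF bounded_bilinear_scaleR c(1)[OF k] acU(1)])
  have "ac (x (k - 1)) (x k) (\<lambda>t. c k t *\<^sub>R U' k t + c' k t *\<^sub>R U k t)
     (\<lambda>t. (c k t *\<^sub>R (- g t) + c' k t *\<^sub>R U' k t) + (c' k t *\<^sub>R U' k t + c'' k t *\<^sub>R U k t))"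
    by (intro ac_add ac_prod[OF bounded_bilinear_scaleR] c k acU)
  then show "ac (x (k - 1)) (x k) (\<lambda>t. c k t *\<^sub>R U' k t + c' k t *\<^sub>R U k t)
     (\<lambda>t. - glue x (\<lambda>k t. c k t *\<^sub>R g t - (2 * c' k t) *\<^sub>R U' k t - c'' k t *\<^sub>R U k t) t)"
  proof (rule ac_cong)
    fix t assume t: "x (k - 1) < t" "t < x k"
    have two: "(2 * c' k t) *\<^sub>R U' k t = c' k t *\<^sub>R U' k t + c' k t *\<^sub>R U' k t"
      by (simp only: scaleR_left_distrib[symmetric] mult_2)
    have alg: "- (r - (p + p) - q) = (- r + p) + (p + q)" for p q r :: "complex ^ 'p"
      by (simp add: algebra_simps)
    show "- glue x (\<lambda>k t. c k t *\<^sub>R g t - (2 * c' k t) *\<^sub>R U' k t - c'' k t *\<^sub>R U k t) t =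
      (c k t *\<^sub>R (- g t) + c' k t *\<^sub>R U' k t) + (c' k t *\<^sub>R U' k t + c'' k t *\<^sub>R U k t)"
      unfolding glue_eq[OF k less_imp_le[OF t(1)] t(2)] two scaleR_minus_right by (rule alg)
  qed simp
  show "c (Suc k) (x k) *\<^sub>R U (Suc k) (x k) = c k (x k) *\<^sub>R U k (x k)"
    using U k cont[OF k] by (simp add: interface_solution_def)
  have "U' (Suc k) (x k) = U' k (x k) + \<Lambda> k *v U k (x k)"
    using U k by (auto simp: interface_solution_def diff_eq_eq add.commute)
  moreover have "\<Lambda> k *v (r *\<^sub>R v) = r *\<^sub>R (\<Lambda> k *v v)" for r v
    by (simp add: vec_eq_iff matrix_vector_mult_def scaleR_sum_right)
  ultimately show "c (Suc k) (x k) *\<^sub>R U' (Suc k) (x k) + c' (Suc k) (x k) *\<^sub>R U (Suc k) (x k) -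
     (c k (x k) *\<^sub>R U' k (x k) + c' k (x k) *\<^sub>R U k (x k)) = \<Lambda> k *v (c k (x k) *\<^sub>R U k (x k))"
    using cont[OF k] flat(1)[OF k] flat(2)[of "Suc k"] by (simp add: scaleR_add_right)
next
  show "c 1 (x 0) *\<^sub>R U' 1 (x 0) + c' 1 (x 0) *\<^sub>R U 1 (x 0) = 0"
    using U flat(2)[of 1] by (simp add: interface_solution_def)
qed

lemma tail_tendsto_0:
  fixes f :: "real \<Rightarrow> complex ^ 'p"
  assumes f: "f \<in> L2 half_line"
  shows "(\<lambda>m. LINT t|half_line. indicator {x m..} t * (norm (f t))\<^sup>2) \<longlonglongrightarrow> 0"
proof -
  have "(\<lambda>m. LINT t|half_line. indicator {x m..} t * (norm (f t))\<^sup>2) \<longlonglongrightarrow> (LINT t|half_line. 0)"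
  proof (rule integral_dominated_convergence[where w="\<lambda>t. (norm (f t))\<^sup>2"])
    have m: "(\<lambda>t. (norm (f t))\<^sup>2) \<in> borel_measurable half_line"
      using L2_square_integrable[OF f] by auto
    show "(\<lambda>t. indicator {x m..} t * (norm (f t))\<^sup>2) \<in> borel_measurable half_line" for m
      by (intro borel_measurable_times m measurable_restrict_space1 borel_measurable_indicator) auto
    show "AE t in half_line. (\<lambda>m. indicator {x m..} t * (norm (f t))\<^sup>2) \<longlonglongrightarrow> 0"
    proof (intro AE_I2 tendsto_eventually)
      fix t
      obtain N where "\<forall>n\<ge>N. t < x n" using eventually_x_gt by blast
      then show "\<forall>\<^sub>F m in sequentially. indicator {x m..} t * (norm (f t))\<^sup>2 = 0"
        unfolding eventually_sequentially by (intro exI[of _ N]) auto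
    qed
    show "AE t in half_line. norm (indicator {x m..} t * (norm (f t))\<^sup>2) \<le> (norm (f t))\<^sup>2" for m
      by (intro AE_I2) (auto simp: indicator_def)
  qed (use L2_square_integrable[OF f] in auto)
  then show ?thesis by simp
qed

end

text \<open>The perturbation \<open>2 c' u' + c'' u\<close> created on one interval of length \<open>d\<close> by a cutoff \<open>c\<close> that
  decreases there by \<open>d\<^sup>2 / S\<close> along the smooth step \<open>3 s\<^sup>2 - 2 s\<^sup>3\<close>: the factor \<open>d\<^sup>2\<close> is exactly what
  makes the bound uniform in the length.\<close>

lemma cutoff_perturbation_bound:
  fixes u :: "real \<Rightarrow> complex ^ 'p"
  assumes u: "ac a b u u'" "ac a b u' w" and wL: "w \<in> L2 (lebesgue_on {a<..<b})" and ab: "a < b" "b - a \<le> D" and "S > 0"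
  defines "c' \<equiv> \<lambda>t. - (6 / S) * ((t - a) * (b - t)) / (b - a)"
    and "c'' \<equiv> \<lambda>t. - (6 / S) * (a + b - 2 * t) / (b - a)"
  shows "integral {a..b} (\<lambda>t. (norm ((2 * c' t) *\<^sub>R u' t + c'' t *\<^sub>R u t))\<^sup>2)
     \<le> (1224 + 18 * D\<^sup>2) / S\<^sup>2 * integral {a..b} (\<lambda>t. (norm (u t))\<^sup>2 + (norm (w t))\<^sup>2)"
proof -
  define d where "d = b - a"
  define \<eta> where "\<eta> t = (t - a) * (b - t) / d" for t
  define \<eta>' where "\<eta>' t = (a + b - 2 * t) / d" for t
  have d: "d > 0" "d \<le> D" using ab by (auto simp: d_def)
  have c': "c' t = - (6 / S) * \<eta> t" for t by (simp add: c'_def \<eta>_def d_def)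
  have c'': "c'' t = - (6 / S) * \<eta>' t" for t by (simp add: c''_def \<eta>'_def d_def)
  have eta_ac: "ac a b \<eta> \<eta>'"
  proof (rule ac_C1)
    fix t assume "a \<le> t" "t \<le> b"
    have "(\<eta> has_real_derivative \<eta>' t) (at t within {a..b})"
      unfolding \<eta>_def[abs_def] \<eta>'_def by (rule derivative_eq_intros refl | use d in \<open>force simp: field_simps\<close>)+
    then show "(\<eta> has_vector_derivative \<eta>' t) (at t within {a..b})"
      by (simp add: has_real_derivative_iff_has_vector_derivative)
  next
    show "continuous_on {a..b} \<eta>'" unfolding \<eta>'_def by (intro continuous_intros) (use d in auto)
  qed
  have eta'_cont: "continuous_on {a..b} \<eta>'"
    unfolding \<eta>'_def by (intro continuous_intros) (use d in auto)
  have eta'_le: "\<bar>\<eta>' t\<bar> \<le> 1" if "t \<in> {a..b}" for t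
  proof -
    have "\<bar>a + b - 2 * t\<bar> \<le> d" using that by (auto simp: d_def abs_le_iff)
    then show ?thesis using d by (simp add: \<eta>'_def abs_divide)
  qed
  have eta_le: "\<bar>\<eta> t\<bar> \<le> d / 4" if "t \<in> {a..b}" for t
  proof -
    have "(t - a) * (b - t) = d\<^sup>2 / 4 - ((a + b) / 2 - t)\<^sup>2"
      by (simp add: d_def power2_eq_square field_simps)
    then have "(t - a) * (b - t) \<le> d\<^sup>2 / 4" by simp
    then have "\<eta> t \<le> (d\<^sup>2 / 4) / d" unfolding \<eta>_def using d by (intro divide_right_mono) auto
    moreover have "\<eta> t \<ge> 0" using that d by (auto simp: \<eta>_def)
    ultimately show ?thesis using d by (simp add: power2_eq_square)
  qed
  define J where "J = integral {a..b} (\<lambda>t. (norm (u t))\<^sup>2 + (norm (w t))\<^sup>2)"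
  \<comment> \<open>The interior estimate is used with \<open>A = d / 4\<close>, the maximum of
    \<open>\<eta>\<close>, attained at the midpoint, and \<open>B = 1\<close>.\<close>
  have est: "integral {a..b} (\<lambda>t. (\<eta> t)\<^sup>2 * (norm (u' t))\<^sup>2) \<le> ((d / 4)\<^sup>2 + 4 * 1\<^sup>2) * J"
    unfolding J_def
    by (rule interior_gradient_estimate[OF u wL eta_ac eta'_cont]) (use eta_le eta'_le ab in \<open>auto simp: \<eta>_def\<close>)
  have cu: "continuous_on {a..b} u" "continuous_on {a..b} u'" "continuous_on {a..b} \<eta>"
    using u eta_ac by (auto dest: ac_continuous_on)
  have i1: "(\<lambda>t. (\<eta> t)\<^sup>2 * (norm (u' t))\<^sup>2) integrable_on {a..b}"
    by (intro integrable_continuous_real continuous_intros cu)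
  have iu: "(\<lambda>t. (norm (u t))\<^sup>2) integrable_on {a..b}"
    by (intro integrable_continuous_real continuous_intros cu)
  have "integrable (lebesgue_on {a<..<b}) (\<lambda>t. (norm (w t))\<^sup>2)"
    using wL by (simp add: L2_def)
  then have "(\<lambda>t. (norm (w t))\<^sup>2) absolutely_integrable_on {a<..<b}"
    by (simp add: integrable_restrict_space set_integrable_def)
  then have iw: "(\<lambda>t. (norm (w t))\<^sup>2) integrable_on {a..b}"
    unfolding absolutely_integrable_on_Icc_iff_Ioo[symmetric] by (rule set_lebesgue_integral_eq_integral(1))
  have iuw: "(\<lambda>t. (norm (u t))\<^sup>2 + (norm (w t))\<^sup>2) integrable_on {a..b}"
    by (intro integrable_add iu iw)
  \<comment> \<open>Here 72 = 2 * 6^2 and 288 = 4 * 72: one factor 2 from squaring a sum, 6 from the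
    slope of the smooth step, and 4 from squaring the 2 in \<open>2 c' u'\<close>. With the interior
    estimate, 288 * (d^2/16 + 4) + 72 gives 1224 + 18 d^2.\<close>
  have "integral {a..b} (\<lambda>t. (norm ((2 * c' t) *\<^sub>R u' t + c'' t *\<^sub>R u t))\<^sup>2)
     \<le> integral {a..b} (\<lambda>t. (288 / S\<^sup>2) * ((\<eta> t)\<^sup>2 * (norm (u' t))\<^sup>2) + (72 / S\<^sup>2) * ((norm (u t))\<^sup>2 + (norm (w t))\<^sup>2))"
  proof (rule integral_le)
    show "(\<lambda>t. (norm ((2 * c' t) *\<^sub>R u' t + c'' t *\<^sub>R u t))\<^sup>2) integrable_on {a..b}"
      unfolding c' c'' by (intro integrable_continuous_real continuous_intros cu eta'_cont)
    show "(\<lambda>t. (288 / S\<^sup>2) * ((\<eta> t)\<^sup>2 * (norm (u' t))\<^sup>2) + (72 / S\<^sup>2) * ((norm (u t))\<^sup>2 + (norm (w t))\<^sup>2)) integrable_on {a..b}"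
      using integrable_on_cmult_left[OF i1, of "288 / S\<^sup>2"] integrable_on_cmult_left[OF iuw, of "72 / S\<^sup>2"]
      by (intro integrable_add) auto
    fix t assume t: "t \<in> {a..b}"
    have "(norm ((2 * c' t) *\<^sub>R u' t + c'' t *\<^sub>R u t))\<^sup>2 \<le>
       2 * (norm ((2 * c' t) *\<^sub>R u' t))\<^sup>2 + 2 * (norm (c'' t *\<^sub>R u t))\<^sup>2"
      by (rule norm_add_square_le)
    also have "\<dots> = 8 * ((c' t)\<^sup>2 * (norm (u' t))\<^sup>2) + 2 * ((c'' t)\<^sup>2 * (norm (u t))\<^sup>2)"
      by (simp add: power_mult_distrib)
    also have "\<dots> = (288 / S\<^sup>2) * ((\<eta> t)\<^sup>2 * (norm (u' t))\<^sup>2) + (72 / S\<^sup>2) * ((\<eta>' t)\<^sup>2 * (norm (u t))\<^sup>2)"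
      by (simp add: c' c'' power_mult_distrib power_divide)
    also have "\<dots> \<le> (288 / S\<^sup>2) * ((\<eta> t)\<^sup>2 * (norm (u' t))\<^sup>2) + (72 / S\<^sup>2) * (1 * ((norm (u t))\<^sup>2 + (norm (w t))\<^sup>2))"
      using eta'_le[OF t] by (intro add_left_mono mult_left_mono mult_mono) (auto simp: abs_square_le_1)
    finally show "(norm ((2 * c' t) *\<^sub>R u' t + c'' t *\<^sub>R u t))\<^sup>2 \<le>
       (288 / S\<^sup>2) * ((\<eta> t)\<^sup>2 * (norm (u' t))\<^sup>2) + (72 / S\<^sup>2) * ((norm (u t))\<^sup>2 + (norm (w t))\<^sup>2)"
      by simp
  qed
  also have "\<dots> = (288 / S\<^sup>2) * integral {a..b} (\<lambda>t. (\<eta> t)\<^sup>2 * (norm (u' t))\<^sup>2) + (72 / S\<^sup>2) * J"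
    using integrable_on_cmult_left[OF i1, of "288 / S\<^sup>2"] integrable_on_cmult_left[OF iuw, of "72 / S\<^sup>2"]
    by (subst Henstock_Kurzweil_Integration.integral_add)
       (simp_all only: J_def Henstock_Kurzweil_Integration.integral_mult_right of_real_eq_id id_apply)
  also have "\<dots> \<le> (288 / S\<^sup>2) * (((d / 4)\<^sup>2 + 4 * 1\<^sup>2) * J) + (72 / S\<^sup>2) * J"
    using est by (intro add_right_mono mult_left_mono) auto
  also have "\<dots> = (1224 + 18 * d\<^sup>2) / S\<^sup>2 * J"
  proof -
    have "(288 / S\<^sup>2) * (P * J) + (72 / S\<^sup>2) * J = (288 * P + 72) / S\<^sup>2 * J" for P
      by (simp add: add_divide_distrib distrib_right)
    moreover have "288 * ((d / 4)\<^sup>2 + 4 * 1\<^sup>2) + 72 = 1224 + 18 * d\<^sup>2"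
      by (simp add: power2_eq_square)
    ultimately show ?thesis by simp
  qed
  also have "\<dots> \<le> (1224 + 18 * D\<^sup>2) / S\<^sup>2 * J"
  proof -
    have "J \<ge> 0" unfolding J_def by (intro Henstock_Kurzweil_Integration.integral_nonneg iuw) auto
    then show ?thesis
      using d by (intro mult_right_mono divide_right_mono add_left_mono mult_left_mono power_mono) auto
  qed
  finally show ?thesis by (simp add: J_def)
qed

text \<open>With s = (t - a)/(b - a) the quotient in the first formula is (b - a)^2 (3 s^2 - 2 s^3).
  The factor \<open>r\<close> is a switch, 1 on cells where the cutoff descends and 0
  elsewhere.\<close>

lemma smooth_step_derivatives:
  fixes a b :: real
  shows "((\<lambda>t. \<theta> - r * (1 / S) * ((t - a)\<^sup>2 * (3 * (b - a) - 2 * (t - a)) / (b - a))) has_real_derivative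
      r * (- (6 / S) * ((t - a) * (b - t)) / (b - a))) (at t within A)" (is ?c)
    and "((\<lambda>t. r * (- (6 / S) * ((t - a) * (b - t)) / (b - a))) has_real_derivative
      r * (- (6 / S) * (a + b - 2 * t) / (b - a))) (at t within A)" (is ?c')
proof -
  have "((\<lambda>t. (t - a)\<^sup>2 * (3 * (b - a) - 2 * (t - a))) has_real_derivative 6 * ((t - a) * (b - t))) (at t within A)"
    by (auto intro!: derivative_eq_intros simp: algebra_simps power2_eq_square)
  from DERIV_diff[OF DERIV_const[of \<theta>] DERIV_cmult[OF DERIV_cdivide[OF this, of "b - a"], of "r * (1 / S)"]]
  show ?c by simp
  have "((\<lambda>t. (t - a) * (b - t)) has_real_derivative (a + b - 2 * t)) (at t within A)"
    by (auto intro!: derivative_eq_intros simp: algebra_simps)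
  from DERIV_cmult[OF DERIV_cdivide[OF DERIV_cmult[OF this, of "- (6 / S)"], of "b - a"], of r]
  show ?c' .
qed

section \<open>Truncating a solution to compact support\<close>

context partition
begin

lemma lint_glue_le:
  fixes e :: "nat \<Rightarrow> real \<Rightarrow> complex ^ 'p"
  assumes e: "glue x e \<in> L2 half_line" and q: "integrable half_line q"
    and le: "\<And>k. k \<ge> 1 \<Longrightarrow> integral {x (k - 1)..x k} (\<lambda>t. (norm (e k t))\<^sup>2) \<le> C * integral {x (k - 1)..x k} q"
  shows "(LINT t|half_line. (norm (glue x e t))\<^sup>2) \<le> C * (LINT t|half_line. q t)"
proof (rule LIMSEQ_le)
  show "(\<lambda>N. \<Sum>k=1..N. integral {x (k - 1)..x k} (\<lambda>t. (norm (glue x e t))\<^sup>2)) \<longlonglongrightarrow> (LINT t|half_line. (norm (glue x e t))\<^sup>2)"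
    by (rule sum_cell_integrals_tendsto[OF L2_square_integrable[OF e]])
  show "(\<lambda>N. C * (\<Sum>k=1..N. integral {x (k - 1)..x k} q)) \<longlonglongrightarrow> C * (LINT t|half_line. q t)"
    by (intro tendsto_mult_left sum_cell_integrals_tendsto[OF q])
  have "integral {x (k - 1)..x k} (\<lambda>t. (norm (glue x e t))\<^sup>2) = integral {x (k - 1)..x k} (\<lambda>t. (norm (e k t))\<^sup>2)" if "k \<ge> 1" for k
  proof (rule integral_spike[of "{x (k - 1), x k}"])
    fix t assume "t \<in> {x (k - 1)..x k} - {x (k - 1), x k}"
    then have "glue x e t = e k t" by (intro glue_eq that) auto
    then show "(norm (e k t))\<^sup>2 = (norm (glue x e t))\<^sup>2" by simp
  qed simp
  then show "\<exists>N. \<forall>n\<ge>N. (\<Sum>k=1..n. integral {x (k - 1)..x k} (\<lambda>t. (norm (glue x e t))\<^sup>2)) \<le> C * (\<Sum>k=1..n. integral {x (k - 1)..x k} q)"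
    using le by (auto simp: sum_distrib_left intro!: sum_mono)
qed

text \<open>The cutoff is 1 on the first \<open>m\<close> cells, 0 beyond cell \<open>n\<close>, and
  spends its descent on the block between. Hence \<open>F\<close> errs only by a tail of
  \<open>u\<close>, and \<open>G\<close> by a tail of \<open>g\<close> plus the perturbation, which
  carries the factor 1/S^2.\<close>

lemma cutoff_in_H_pre:
  fixes \<Lambda> :: "nat \<Rightarrow> complex ^ 'p ^ 'p"
  assumes U: "interface_solution x \<Lambda> U U' g" and uL: "u \<in> L2 half_line" and gL: "g \<in> L2 half_line"
    and uU: "\<And>k t. k \<ge> 1 \<Longrightarrow> x (k - 1) < t \<Longrightarrow> t < x k \<Longrightarrow> u t = U k t"
    and D: "\<And>k. k \<ge> 1 \<Longrightarrow> gap x k \<le> D"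
    and S_def: "S = (\<Sum>k=Suc m..n. (gap x k)\<^sup>2)" and "S > 0"
  obtains F G where "(F, G) \<in> H_pre x \<Lambda>"
    "(LINT t|half_line. (norm (F t - u t))\<^sup>2) \<le> (LINT t|half_line. indicator {x m..} t * (norm (u t))\<^sup>2)"
    "(LINT t|half_line. (norm (G t - g t))\<^sup>2) \<le> 2 * (LINT t|half_line. indicator {x m..} t * (norm (g t))\<^sup>2)
      + 2 * ((1224 + 18 * D\<^sup>2) / S\<^sup>2 * (LINT t|half_line. (norm (u t))\<^sup>2 + (norm (g t))\<^sup>2))"
proof -
  have d_pos: "gap x k > 0" if "k \<ge> 1" for k using x_less[OF that] by (simp add: gap_def)
  define act where "act k = (if k \<in> {Suc m..n} then 1 else 0::real)" for k
  define A where "A k = (\<Sum>j=1..k. act j * (gap x j)\<^sup>2)" for k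
  have A_eq: "A k = (\<Sum>j\<in>{1..k} \<inter> {Suc m..n}. (gap x j)\<^sup>2)" for k
  proof -
    have "A k = (\<Sum>j\<in>{1..k}. if j \<in> {Suc m..n} then (gap x j)\<^sup>2 else 0)"
      unfolding A_def by (rule sum.cong) (auto simp: act_def)
    also have "\<dots> = (\<Sum>j\<in>{1..k} \<inter> {Suc m..n}. (gap x j)\<^sup>2)"
      by (rule sum.inter_restrict[symmetric]) simp
    finally show ?thesis .
  qed
  have A_bounds: "0 \<le> A k" "A k \<le> S" for k
    unfolding A_eq S_def by (intro sum_nonneg sum_mono2; simp)+
  have A_low: "A k = 0" if "k \<le> m" for k
    unfolding A_def using that by (intro sum.neutral) (auto simp: act_def)
  have A_high: "A k = S" if "k \<ge> n" for k
    unfolding A_eq S_def using that by (intro sum.cong) auto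
  have A_step: "A k = A (k - 1) + act k * (gap x k)\<^sup>2" if "k \<ge> 1" for k
    using that by (cases k) (auto simp: A_def)
  \<comment> \<open>The value of the cutoff at the node \<open>x k\<close>: what is left after the
    cells up to \<open>k\<close> have used their shares of \<open>S\<close>.\<close>
  define \<theta> where "\<theta> k = 1 - A k / S" for k
  have theta_step: "\<theta> k = \<theta> (k - 1) - act k * (gap x k)\<^sup>2 / S" if "k \<ge> 1" for k
    unfolding \<theta>_def A_step[OF that] by (simp add: add_divide_distrib)
  have theta01: "0 \<le> \<theta> k" "\<theta> k \<le> 1" for k
    using A_bounds[of k] \<open>S > 0\<close> by (auto simp: \<theta>_def)
  have theta1: "\<theta> k = 1" if "k \<le> m" for k
    using A_low[OF that] by (simp add: \<theta>_def)
  have theta0: "\<theta> k = 0" if "k \<ge> n" for k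
    using A_high[OF that] \<open>S > 0\<close> by (simp add: \<theta>_def)
  define c where "c k t = \<theta> (k - 1) - act k * (1 / S) * ((t - x (k - 1))\<^sup>2 * (3 * gap x k - 2 * (t - x (k - 1))) / gap x k)" for k t
  define c' where "c' k t = act k * (- (6 / S) * ((t - x (k - 1)) * (x k - t)) / (x k - x (k - 1)))" for k t
  define c'' where "c'' k t = act k * (- (6 / S) * (x (k - 1) + x k - 2 * t) / (x k - x (k - 1)))" for k t
  have c_cont: "continuous_on A (c k)" "continuous_on A (c' k)" "continuous_on A (c'' k)" if "k \<ge> 1" for A k
    unfolding c_def c'_def c''_def using d_pos[OF that] by (intro continuous_intros; simp add: gap_def)+
  have c_ac: "ac (x (k - 1)) (x k) (c k) (c' k)" if k: "k \<ge> 1" for k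
  proof (rule ac_C1[OF _ c_cont(2)[OF k]])
    fix t
    have "(c k has_real_derivative c' k t) (at t within {x (k - 1)..x k})"
      unfolding c_def[abs_def] c'_def gap_def by (rule smooth_step_derivatives(1))
    then show "(c k has_vector_derivative c' k t) (at t within {x (k - 1)..x k})"
      by (simp add: has_real_derivative_iff_has_vector_derivative)
  qed
  have c'_ac: "ac (x (k - 1)) (x k) (c' k) (c'' k)" if k: "k \<ge> 1" for k
  proof (rule ac_C1[OF _ c_cont(3)[OF k]])
    fix t
    have "(c' k has_real_derivative c'' k t) (at t within {x (k - 1)..x k})"
      unfolding c'_def[abs_def] c''_def by (rule smooth_step_derivatives(2))
    then show "(c' k has_vector_derivative c'' k t) (at t within {x (k - 1)..x k})"
      by (simp add: has_real_derivative_iff_has_vector_derivative)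
  qed
  have c_left: "c k (x (k - 1)) = \<theta> (k - 1)" for k by (simp add: c_def)
  have c_right: "c k (x k) = \<theta> k" if "k \<ge> 1" for k
    using d_pos[OF that] by (simp add: c_def theta_step[OF that] gap_def power2_eq_square)
  have c_range: "0 \<le> c k t \<and> c k t \<le> 1" if k: "k \<ge> 1" and t: "x (k - 1) \<le> t" "t \<le> x k" for k t
  proof -
    define s where "s = t - x (k - 1)"
    have s: "0 \<le> s" "s \<le> gap x k" using t by (auto simp: s_def gap_def)
    have "s\<^sup>2 * (3 * gap x k - 2 * s) \<le> (gap x k)\<^sup>2 * gap x k"
    proof -
      \<comment> \<open>This factorization shows that the step never overshoots, so the cutoff on a
        cell stays between its two node values.\<close>
      have "(gap x k)\<^sup>2 * gap x k - s\<^sup>2 * (3 * gap x k - 2 * s) = (gap x k - s)\<^sup>2 * (gap x k + 2 * s)"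
        by (simp add: power2_eq_square algebra_simps)
      moreover have "\<dots> \<ge> 0" using s by auto
      ultimately show ?thesis by linarith
    qed
    then have 1: "s\<^sup>2 * (3 * gap x k - 2 * s) / gap x k \<le> (gap x k)\<^sup>2"
      using d_pos[OF k] by (simp add: divide_le_eq)
    have 2: "0 \<le> s\<^sup>2 * (3 * gap x k - 2 * s) / gap x k"
      using s d_pos[OF k] by auto
    have a: "0 \<le> act k * (1 / S)" using \<open>S > 0\<close> by (simp add: act_def)
    have "act k * (1 / S) * (s\<^sup>2 * (3 * gap x k - 2 * s) / gap x k) \<le> act k * (1 / S) * (gap x k)\<^sup>2"
      by (rule mult_left_mono[OF 1 a])
    moreover have "0 \<le> act k * (1 / S) * (s\<^sup>2 * (3 * gap x k - 2 * s) / gap x k)"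
      by (rule mult_nonneg_nonneg[OF a 2])
    ultimately show ?thesis
      using theta_step[OF k] theta01[of k] theta01[of "k - 1"] by (simp add: c_def s_def)
  qed
  have c_one: "c k t = 1" if "k \<le> m" for k t
    using that theta1[of "k - 1"] by (simp add: c_def act_def)
  have c_zero: "c k t = 0" "c' k t = 0" "c'' k t = 0" if "k > n" for k t
    using that theta0[of "k - 1"] by (simp_all add: c_def c'_def c''_def act_def)
  define e where "e k t = (2 * c' k t) *\<^sub>R U' k t + c'' k t *\<^sub>R U k t" for k t
  define F where "F = glue x (\<lambda>k t. c k t *\<^sub>R u t)"
  define G where "G = glue x (\<lambda>k t. c k t *\<^sub>R g t - (2 * c' k t) *\<^sub>R U' k t - c'' k t *\<^sub>R U k t)"
  have acU: "ac (x (k - 1)) (x k) (U k) (U' k)" "ac (x (k - 1)) (x k) (U' k) (\<lambda>t. - g t)" if "k \<ge> 1" for k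
    using U that by (auto simp: interface_solution_def)
  have e_cont: "continuous_on {x (k - 1)..x k} (e k)" if k: "k \<ge> 1" for k
    unfolding e_def using acU[OF k] by (intro continuous_intros c_cont[OF k]) (auto dest: ac_continuous_on)
  have eL: "glue x e \<in> L2 half_line"
    by (rule L2_glue[where n=n]) (use e_cont c_zero in \<open>auto intro: L2_continuous simp: e_def\<close>)
  have cL: "glue x (\<lambda>k t. c k t *\<^sub>R f t) \<in> L2 half_line" if f: "f \<in> L2 half_line" for f :: "real \<Rightarrow> complex ^ 'p"
  proof (rule L2_glue[where n=n])
    fix k :: nat assume k: "k \<ge> 1"
    show "(\<lambda>t. c k t *\<^sub>R f t) \<in> L2 (lebesgue_on {x (k - 1)<..<x k})"
    proof (rule L2_scaleR_bounded[where C=1])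
      show "f \<in> L2 (lebesgue_on {x (k - 1)<..<x k})" by (rule L2_cell[OF f])
      show "c k \<in> borel_measurable (lebesgue_on {x (k - 1)<..<x k})"
        by (rule continuous_imp_measurable_on_sets_lebesgue[OF c_cont(1)[OF k]]) simp
    qed (use c_range[OF k] in \<open>auto simp: abs_le_iff intro: order_trans[of _ 0]\<close>)
  qed (use c_zero in auto)
  have FL: "F \<in> L2 half_line" unfolding F_def by (rule cL[OF uL])
  have Geq: "G t = glue x (\<lambda>k t. c k t *\<^sub>R g t) t - glue x e t" for t
    by (simp add: G_def glue_def e_def)
  have GL: "G \<in> L2 half_line"
    unfolding Geq[abs_def] by (rule L2_diff[OF cL[OF gL] eL])
  have tail: "(norm (glue x (\<lambda>k t. c k t *\<^sub>R f t) t - f t))\<^sup>2 \<le> indicator {x m..} t * (norm (f t))\<^sup>2"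
    if "t > 0" for f :: "real \<Rightarrow> complex ^ 'p" and t
  proof -
    obtain k where k: "k \<ge> 1" "x (k - 1) \<le> t" "t < x k" using exists_cell[of t] \<open>t > 0\<close> by auto
    have eq: "glue x (\<lambda>k t. c k t *\<^sub>R f t) t - f t = (c k t - 1) *\<^sub>R f t"
      using glue_eq[OF k] by (simp add: scaleR_left_diff_distrib)
    show ?thesis
    proof (cases "t < x m")
      case True
      have "x (k - 1) < x m" using True k by simp
      then have "k \<le> m" using mono_x strict_mono_less[of x "k - 1" m] by auto
      then show ?thesis unfolding eq using c_one by simp
    next
      case False
      have "\<bar>c k t - 1\<bar> \<le> 1" using c_range[OF k(1), of t] k by auto
      then have "(c k t - 1)\<^sup>2 \<le> 1" by (simp add: abs_square_le_1)
      then show ?thesis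
        unfolding eq using False mult_right_mono[of "(c k t - 1)\<^sup>2" 1 "(norm (f t))\<^sup>2"]
        by (simp add: power_mult_distrib)
    qed
  qed
  have tail_int: "integrable half_line (\<lambda>t. indicator {x m..} t * (norm (f t))\<^sup>2)" if f: "f \<in> L2 half_line" for f :: "real \<Rightarrow> complex ^ 'p"
  proof (rule Bochner_Integration.integrable_bound[OF L2_square_integrable[OF f]])
    have m: "(\<lambda>t. (norm (f t))\<^sup>2) \<in> borel_measurable half_line"
      using L2_square_integrable[OF f] by auto
    show "(\<lambda>t. indicator {x m..} t * (norm (f t))\<^sup>2) \<in> borel_measurable half_line"
      by (intro borel_measurable_times m measurable_restrict_space1 borel_measurable_indicator) auto
  qed (auto simp: indicator_def)
  show ?thesis
  proof
    show "(F, G) \<in> H_pre x \<Lambda>"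
    proof (rule H_preI[where R="x n"])
      show "interface_solution x \<Lambda> (\<lambda>k t. c k t *\<^sub>R U k t) (\<lambda>k t. c k t *\<^sub>R U' k t + c' k t *\<^sub>R U k t) G"
        unfolding G_def
      proof (rule interface_solution_mult[OF U c_ac c'_ac])
        show "c (Suc k) (x k) = c k (x k)" if "k \<ge> 1" for k
          using c_left[of "Suc k"] c_right[OF that] by simp
      qed (simp_all add: c'_def)
      show "F t = 0" if t: "t > x n" for t
      proof -
        obtain k where k: "k \<ge> 1" "x (k - 1) \<le> t" "t < x k"
          using exists_cell[of t] t x_nonneg[of n] by auto
        have "x n < x k" using t k by simp
        then have "n < k" using mono_x strict_mono_less by blast
        then show ?thesis unfolding F_def glue_eq[OF k] using c_zero by simp
      qed
      show "F t = c k t *\<^sub>R U k t" if "k \<ge> 1" "x (k - 1) < t" "t < x k" for k t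
        unfolding F_def glue_eq[OF that(1) less_imp_le[OF that(2)] that(3)] using uU[OF that] by simp
    qed (rule FL GL)+
    show "(LINT t|half_line. (norm (F t - u t))\<^sup>2) \<le> (LINT t|half_line. indicator {x m..} t * (norm (u t))\<^sup>2)"
      unfolding F_def
      by (rule integral_mono[OF L2_square_integrable[OF L2_diff[OF cL[OF uL] uL]] tail_int[OF uL]]) (use tail in auto)
    have "(LINT t|half_line. (norm (G t - g t))\<^sup>2) \<le>
      (LINT t|half_line. 2 * (indicator {x m..} t * (norm (g t))\<^sup>2) + 2 * (norm (glue x e t))\<^sup>2)"
    proof (rule integral_mono[OF L2_square_integrable[OF L2_diff[OF GL gL]]])
      show "integrable half_line (\<lambda>t. 2 * (indicator {x m..} t * (norm (g t))\<^sup>2) + 2 * (norm (glue x e t))\<^sup>2)"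
        by (intro Bochner_Integration.integrable_add integrable_mult_right tail_int gL L2_square_integrable eL)
      fix t assume t: "t \<in> space half_line"
      have "G t - g t = (glue x (\<lambda>k t. c k t *\<^sub>R g t) t - g t) + (- glue x e t)"
        by (simp add: Geq)
      then have "(norm (G t - g t))\<^sup>2 \<le> 2 * (norm (glue x (\<lambda>k t. c k t *\<^sub>R g t) t - g t))\<^sup>2 + 2 * (norm (- glue x e t))\<^sup>2"
        by (simp only: norm_add_square_le)
      then show "(norm (G t - g t))\<^sup>2 \<le> 2 * (indicator {x m..} t * (norm (g t))\<^sup>2) + 2 * (norm (glue x e t))\<^sup>2"
        using tail[of t g] t by simp
    qed
    also have "\<dots> = 2 * (LINT t|half_line. indicator {x m..} t * (norm (g t))\<^sup>2) + 2 * (LINT t|half_line. (norm (glue x e t))\<^sup>2)"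
      using tail_int[OF gL] L2_square_integrable[OF eL] by simp
    also have "(LINT t|half_line. (norm (glue x e t))\<^sup>2) \<le>
       (1224 + 18 * D\<^sup>2) / S\<^sup>2 * (LINT t|half_line. (norm (u t))\<^sup>2 + (norm (g t))\<^sup>2)"
    proof (rule lint_glue_le[OF eL])
      show "integrable half_line (\<lambda>t. (norm (u t))\<^sup>2 + (norm (g t))\<^sup>2)"
        by (intro Bochner_Integration.integrable_add L2_square_integrable uL gL)
      fix k :: nat assume k: "k \<ge> 1"
      \<comment> \<open>The cell estimate speaks of the piece \<open>U k\<close> and its second
        derivative \<open>- g\<close>; neither replacement changes the integral.\<close>
      have Ju: "integral {x (k - 1)..x k} (\<lambda>t. (norm (u t))\<^sup>2 + (norm (g t))\<^sup>2) =
         integral {x (k - 1)..x k} (\<lambda>t. (norm (U k t))\<^sup>2 + (norm (- g t))\<^sup>2)"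
        by (rule integral_spike[of "{x (k - 1), x k}"]) (use uU[OF k] in auto)
      show "integral {x (k - 1)..x k} (\<lambda>t. (norm (e k t))\<^sup>2)
        \<le> (1224 + 18 * D\<^sup>2) / S\<^sup>2 * integral {x (k - 1)..x k} (\<lambda>t. (norm (u t))\<^sup>2 + (norm (g t))\<^sup>2)"
      proof (cases "k \<in> {Suc m..n}")
        case True
        then have e: "e k t = (2 * (- (6 / S) * ((t - x (k - 1)) * (x k - t)) / (x k - x (k - 1)))) *\<^sub>R U' k t
            + (- (6 / S) * (x (k - 1) + x k - 2 * t) / (x k - x (k - 1))) *\<^sub>R U k t" for t
          by (simp add: e_def c'_def c''_def act_def)
        show ?thesis
          unfolding e Ju
          by (rule cutoff_perturbation_bound[OF acU[OF k] _ x_less[OF k]])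
             (use L2_uminus[OF L2_cell[OF gL]] D[OF k] \<open>S > 0\<close> in \<open>auto simp: gap_def\<close>)
      next
        case False
        then have e0: "e k t = 0" for t by (auto simp: e_def c'_def c''_def act_def)
        \<comment> \<open>Off the block the perturbation is zero, so a nonnegative right-hand side
          suffices; without integrability the integral has the default value 0.\<close>
        have "integral {x (k - 1)..x k} (\<lambda>t. (norm (U k t))\<^sup>2 + (norm (- g t))\<^sup>2) \<ge> 0"
        proof (cases "(\<lambda>t. (norm (U k t))\<^sup>2 + (norm (- g t))\<^sup>2) integrable_on {x (k - 1)..x k}")
          case True
          then show ?thesis by (intro Henstock_Kurzweil_Integration.integral_nonneg) auto
        qed (simp add: not_integrable_integral)
        then show ?thesis unfolding Ju by (simp add: e0)
      qed
    qed
    finally show "(LINT t|half_line. (norm (G t - g t))\<^sup>2) \<le> 2 * (LINT t|half_line. indicator {x m..} t * (norm (g t))\<^sup>2)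
      + 2 * ((1224 + 18 * D\<^sup>2) / S\<^sup>2 * (LINT t|half_line. (norm (u t))\<^sup>2 + (norm (g t))\<^sup>2))"
      by simp
  qed
qed

text \<open>The order of choice matters: first \<open>m\<close>, making both tails small, then
  \<open>n\<close>, depending on \<open>m\<close>, making the block sum large.\<close>

lemma interface_solution_in_closure:
  fixes \<Lambda> :: "nat \<Rightarrow> complex ^ 'p ^ 'p"
  assumes U: "interface_solution x \<Lambda> U U' g" and uL: "u \<in> L2 half_line" and gL: "g \<in> L2 half_line"
    and uU: "\<And>k t. k \<ge> 1 \<Longrightarrow> x (k - 1) < t \<Longrightarrow> t < x k \<Longrightarrow> u t = U k t"
    and D: "\<And>k. k \<ge> 1 \<Longrightarrow> gap x k \<le> D"
    and top: "filterlim (\<lambda>n. \<Sum>k=1..n. (gap x k)\<^sup>2) at_top sequentially" and "\<epsilon> > 0"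
  obtains F G where "(F, G) \<in> H_pre x \<Lambda>"
    "(LINT t|half_line. (norm (F t - u t))\<^sup>2) < \<epsilon>" "(LINT t|half_line. (norm (G t - g t))\<^sup>2) < \<epsilon>"
proof -
  define T where "T f m = (LINT t|half_line. indicator {x m..} t * (norm (f t))\<^sup>2)" for f :: "real \<Rightarrow> complex ^ 'p" and m
  have "\<forall>\<^sub>F m in sequentially. T u m < \<epsilon>" "\<forall>\<^sub>F m in sequentially. T g m < \<epsilon> / 4"
    using order_tendstoD(2)[OF tail_tendsto_0[OF uL], of \<epsilon>] order_tendstoD(2)[OF tail_tendsto_0[OF gL], of "\<epsilon> / 4"] \<open>\<epsilon> > 0\<close>
    by (auto simp: T_def)
  then have "\<forall>\<^sub>F m in sequentially. T u m < \<epsilon> \<and> T g m < \<epsilon> / 4" by (rule eventually_conj)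
  then obtain m where m: "T u m < \<epsilon>" "T g m < \<epsilon> / 4"
    unfolding eventually_sequentially by blast
  define B where "B = (1224 + 18 * D\<^sup>2) * (LINT t|half_line. (norm (u t))\<^sup>2 + (norm (g t))\<^sup>2)"
  have "B \<ge> 0" unfolding B_def by (intro mult_nonneg_nonneg Bochner_Integration.integral_nonneg) auto
  \<comment> \<open>From \<open>S \<ge> Z\<close> follow \<open>S \<ge> 1\<close>, so 1/S^2 is at
    most 1/S, and \<open>B / S < \<epsilon> / 4\<close>. After doubling, the tail and the
    perturbation each cost less than half of \<open>\<epsilon>\<close>.\<close>
  define Z where "Z = 1 + 4 * B / \<epsilon>"
  have "Z \<ge> 1" using \<open>B \<ge> 0\<close> \<open>\<epsilon> > 0\<close> by (simp add: Z_def)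
  have "\<forall>\<^sub>F n in sequentially. (\<Sum>k=1..m. (gap x k)\<^sup>2) + Z \<le> (\<Sum>k=1..n. (gap x k)\<^sup>2)"
    using top unfolding filterlim_at_top by blast
  then obtain n where n: "(\<Sum>k=1..m. (gap x k)\<^sup>2) + Z \<le> (\<Sum>k=1..n. (gap x k)\<^sup>2)"
    unfolding eventually_sequentially by blast
  define S where "S = (\<Sum>k=Suc m..n. (gap x k)\<^sup>2)"
  have "m \<le> n"
  proof (rule ccontr)
    assume "\<not> m \<le> n"
    then have "(\<Sum>k=1..n. (gap x k)\<^sup>2) \<le> (\<Sum>k=1..m. (gap x k)\<^sup>2)" by (intro sum_mono2) auto
    then show False using n \<open>Z \<ge> 1\<close> by simp
  qed
  then have "(\<Sum>k=1..n. (gap x k)\<^sup>2) = (\<Sum>k=1..m. (gap x k)\<^sup>2) + S"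
    unfolding S_def by (subst sum.union_disjoint[symmetric]) (auto intro: sum.cong)
  then have S: "S \<ge> Z" using n by simp
  then have "S \<ge> 1" using \<open>Z \<ge> 1\<close> by simp
  obtain F G where FG: "(F, G) \<in> H_pre x \<Lambda>" "(LINT t|half_line. (norm (F t - u t))\<^sup>2) \<le> T u m"
    "(LINT t|half_line. (norm (G t - g t))\<^sup>2) \<le> 2 * T g m
      + 2 * ((1224 + 18 * D\<^sup>2) / S\<^sup>2 * (LINT t|half_line. (norm (u t))\<^sup>2 + (norm (g t))\<^sup>2))"
    unfolding T_def using cutoff_in_H_pre[OF U uL gL uU D S_def] \<open>S \<ge> 1\<close> by auto
  have "B / S\<^sup>2 \<le> B / S"
    using \<open>S \<ge> 1\<close> \<open>B \<ge> 0\<close> self_le_power[of S 2] by (intro divide_left_mono) auto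
  also have "\<dots> < \<epsilon> / 4"
  proof -
    have "4 * B < Z * \<epsilon>" using \<open>\<epsilon> > 0\<close> by (simp add: Z_def field_simps)
    also have "\<dots> \<le> S * \<epsilon>" using S \<open>\<epsilon> > 0\<close> by simp
    finally show ?thesis using \<open>S \<ge> 1\<close> by (simp add: field_simps)
  qed
  finally have "B / S\<^sup>2 < \<epsilon> / 4" .
  then have "(LINT t|half_line. (norm (G t - g t))\<^sup>2) < \<epsilon>"
    using FG(3) m(2) by (simp add: B_def)
  then show ?thesis using that FG m by force
qed

end

section \<open>Regularity of the adjoint domain\<close>

text \<open>The cubic Hermite basis supplies test pieces with prescribed value and slope at one node
  and zero data at the other. Asking only for \<open>p \<noteq> q\<close> lets the data sit at
  either end of a cell.\<close>

lemma hermite_interpolation: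
  fixes c l :: "'a::euclidean_space" and p q :: real
  assumes "p \<noteq> q"
  obtains \<phi> \<phi>' h where "\<And>a b. ac a b \<phi> \<phi>'" "\<And>a b. ac a b \<phi>' h" "continuous_on UNIV h"
    "\<phi> p = c" "\<phi>' p = l" "\<phi> q = 0" "\<phi>' q = 0"
proof -
  define d where "d = q - p"
  have d: "d \<noteq> 0" using assms by (simp add: d_def)
  define s where "s t = (t - p) / d" for t
  have s: "(s has_real_derivative 1 / d) (at t within A)" for t A
    unfolding s_def[abs_def] using d by (auto intro!: derivative_eq_intros)
  define \<phi> where "\<phi> t = (1 - 3 * (s t)\<^sup>2 + 2 * (s t)^3) *\<^sub>R c + (d * (s t - 2 * (s t)\<^sup>2 + (s t)^3)) *\<^sub>R l" for t
  define \<phi>' where "\<phi>' t = ((6 * (s t)\<^sup>2 - 6 * s t) / d) *\<^sub>R c + (1 - 4 * s t + 3 * (s t)\<^sup>2) *\<^sub>R l" for t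
  define h where "h t = ((12 * s t - 6) / d\<^sup>2) *\<^sub>R c + ((6 * s t - 4) / d) *\<^sub>R l" for t
  have s_cont: "continuous_on A s" for A
    unfolding s_def by (intro continuous_intros) (use d in auto)
  have r1: "((\<lambda>t. 1 - 3 * (s t)\<^sup>2 + 2 * (s t)^3) has_real_derivative (6 * (s t)\<^sup>2 - 6 * s t) / d) (at t within A)" for t A
    using d by (auto intro!: derivative_eq_intros s simp: field_simps)
  have r2: "((\<lambda>t. d * (s t - 2 * (s t)\<^sup>2 + (s t)^3)) has_real_derivative (1 - 4 * s t + 3 * (s t)\<^sup>2)) (at t within A)" for t A
    using d by (auto intro!: derivative_eq_intros s simp: field_simps)
  have r3: "((\<lambda>t. (6 * (s t)\<^sup>2 - 6 * s t) / d) has_real_derivative (12 * s t - 6) / d\<^sup>2) (at t within A)" for t A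
    using d by (auto intro!: derivative_eq_intros s simp: field_simps power2_eq_square)
  have r4: "((\<lambda>t. 1 - 4 * s t + 3 * (s t)\<^sup>2) has_real_derivative (6 * s t - 4) / d) (at t within A)" for t A
    using d by (auto intro!: derivative_eq_intros s simp: field_simps)
  have vd: "((\<lambda>t. r t *\<^sub>R y) has_vector_derivative r' *\<^sub>R y) (at t within A)"
    if "(r has_real_derivative r') (at t within A)" for r r' t A and y :: 'a
    using has_vector_derivative_scaleR[OF that has_vector_derivative_const[of y]] by simp
  show ?thesis
  proof
    show "ac a b \<phi> \<phi>'" for a b
    proof (rule ac_C1)
      show "(\<phi> has_vector_derivative \<phi>' t) (at t within {a..b})" for t
        unfolding \<phi>_def[abs_def] \<phi>'_def by (intro has_vector_derivative_add vd r1 r2)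
      show "continuous_on {a..b} \<phi>'"
        unfolding \<phi>'_def by (intro continuous_intros s_cont) (use d in auto)
    qed
    show "ac a b \<phi>' h" for a b
    proof (rule ac_C1)
      show "(\<phi>' has_vector_derivative h t) (at t within {a..b})" for t
        unfolding \<phi>'_def[abs_def] h_def by (intro has_vector_derivative_add vd r3 r4)
      show "continuous_on {a..b} h"
        unfolding h_def by (intro continuous_intros s_cont) (use d in auto)
    qed
    show "continuous_on UNIV h"
      unfolding h_def by (intro continuous_intros s_cont) (use d in auto)
    have "s p = 0" "s q = 1" using d by (auto simp: s_def d_def)
    then show "\<phi> p = c" "\<phi>' p = l" "\<phi> q = 0" "\<phi>' q = 0"
      by (simp_all add: \<phi>_def \<phi>'_def)
  qed
qed

lemma integrable_lebesgue_on_Ioo_iff: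
  fixes f :: "real \<Rightarrow> 'a::euclidean_space"
  shows "integrable (lebesgue_on {a<..<b}) f \<longleftrightarrow> f absolutely_integrable_on {a..b}"
  unfolding absolutely_integrable_on_Icc_iff_Ioo
  by (simp add: integrable_restrict_space set_integrable_def)

lemma L2_bilinear_integrable_on:
  fixes h :: "complex ^ 'p \<Rightarrow> complex ^ 'p \<Rightarrow> 'b::euclidean_space"
  assumes "bounded_bilinear h" "f \<in> L2 (lebesgue_on {a<..<b})" "g \<in> L2 (lebesgue_on {a<..<b})"
  shows "(\<lambda>t. h (f t) (g t)) absolutely_integrable_on {a..b}"
  using L2_bilinear_integrable[OF assms] by (simp add: integrable_lebesgue_on_Ioo_iff)

text \<open>After centering, 1 and \<open>t - m\<close> are orthogonal, and the second moment is the
  squared norm of \<open>t - m\<close>. This is the normalization for projecting onto affine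
  functions.\<close>

lemma centered_moments:
  fixes a b :: real
  assumes "a < b"
  defines "m \<equiv> (a + b) / 2"
  shows "((\<lambda>t. t - m) has_integral 0) {a..b}" "((\<lambda>t. (t - m)\<^sup>2) has_integral (b - a)^3 / 12) {a..b}"
proof -
  have "((\<lambda>t. t - m) has_integral ((b - m)\<^sup>2 / 2 - (a - m)\<^sup>2 / 2)) {a..b}"
    using assms(1)
    by (intro fundamental_theorem_of_calculus)
       (auto intro!: derivative_eq_intros simp: has_real_derivative_iff_has_vector_derivative[symmetric])
  moreover have "(b - m)\<^sup>2 / 2 - (a - m)\<^sup>2 / 2 = 0"
    by (simp add: m_def power2_eq_square field_simps)
  ultimately show "((\<lambda>t. t - m) has_integral 0) {a..b}" by simp
  have "((\<lambda>t. (t - m)\<^sup>2) has_integral ((b - m)^3 / 3 - (a - m)^3 / 3)) {a..b}"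
    using assms(1)
    by (intro fundamental_theorem_of_calculus)
       (auto intro!: derivative_eq_intros simp: has_real_derivative_iff_has_vector_derivative[symmetric])
  moreover have "(b - m)^3 / 3 - (a - m)^3 / 3 = (b - a)^3 / 12"
    by (simp add: m_def power3_eq_cube field_simps)
  ultimately show "((\<lambda>t. (t - m)\<^sup>2) has_integral (b - a)^3 / 12) {a..b}" by simp
qed

text \<open>Since second derivatives of functions with vanishing boundary data are exactly the functions
  orthogonal to the affine ones, one may test with the affine-free part of \<open>u - w\<close> itself,
  where \<open>w'' = - v\<close>.\<close>

lemma second_derivative_regularity:
  fixes u v :: "real \<Rightarrow> complex ^ 'p"
  assumes ab: "a < b" and u: "u \<in> L2 (lebesgue_on {a<..<b})" and v: "v \<in> L2 (lebesgue_on {a<..<b})"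
    and test: "\<And>\<phi> \<phi>' h. ac a b \<phi> \<phi>' \<Longrightarrow> ac a b \<phi>' h \<Longrightarrow> h \<in> L2 (lebesgue_on {a<..<b}) \<Longrightarrow>
       \<phi> a = 0 \<Longrightarrow> \<phi>' a = 0 \<Longrightarrow> \<phi> b = 0 \<Longrightarrow> \<phi>' b = 0 \<Longrightarrow>
       integral {a..b} (\<lambda>t. hip (- h t) (u t) - hip (\<phi> t) (v t)) = 0"
  obtains U U' N where "ac a b U U'" "ac a b U' (\<lambda>t. - v t)" "negligible N"
    "\<And>t. a < t \<Longrightarrow> t < b \<Longrightarrow> t \<notin> N \<Longrightarrow> u t = U t"
proof -
  interpret hip: bounded_bilinear "hip :: complex ^ 'p \<Rightarrow> complex ^ 'p \<Rightarrow> complex"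
    by (rule hip_bilinear)
  define m where "m = (a + b) / 2"
  \<comment> \<open>A particular solution of \<open>w'' = - v\<close>; the remainder
    \<open>z = u - w\<close> has to be shown affine almost everywhere.\<close>
  define w' where "w' t = 0 + integral {a..t} (\<lambda>t. - v t)" for t
  have w': "ac a b w' (\<lambda>t. - v t)"
    unfolding w'_def by (rule ac_integral[OF L2_absolutely_integrable[OF L2_uminus[OF v]]])
  define w where "w t = 0 + integral {a..t} w'" for t
  have w: "ac a b w w'"
    unfolding w_def by (rule ac_integral[OF absolutely_integrable_continuous_real[OF ac_continuous_on[OF w']]])
  have wL: "w \<in> L2 (lebesgue_on {a<..<b})" by (rule L2_continuous[OF ac_continuous_on[OF w]])
  define z where "z t = u t - w t" for t
  have zL: "z \<in> L2 (lebesgue_on {a<..<b})"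
    unfolding z_def[abs_def] by (rule L2_diff[OF u wL])
  note zI = L2_absolutely_integrable[OF zL]
  have mz: "(\<lambda>t. (t - m) *\<^sub>R z t) absolutely_integrable_on {a..b}"
    by (intro absolutely_integrable_continuous_bilinear[OF bounded_bilinear_scaleR _ zI] continuous_intros)
  \<comment> \<open>With \<open>\<beta>\<close>, the coefficients of the orthogonal projection of
    \<open>z\<close> onto affine functions, so \<open>h\<close> has vanishing zeroth and first
    moments.\<close>
  define \<alpha> where "\<alpha> = (1 / (b - a)) *\<^sub>R integral {a..b} z"
  define \<beta> where "\<beta> = (12 / (b - a)^3) *\<^sub>R integral {a..b} (\<lambda>t. (t - m) *\<^sub>R z t)"
  define aff where "aff t = \<alpha> + (t - m) *\<^sub>R \<beta>" for t
  define h where "h t = z t - aff t" for t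
  have aff_cont: "continuous_on A aff" for A unfolding aff_def by (intro continuous_intros)
  have affL: "aff \<in> L2 (lebesgue_on {a<..<b})" by (rule L2_continuous[OF aff_cont])
  have hL: "h \<in> L2 (lebesgue_on {a<..<b})"
    unfolding h_def[abs_def] by (rule L2_diff[OF zL affL])
  note hI = L2_absolutely_integrable[OF hL]
  have mh: "(\<lambda>t. (t - m) *\<^sub>R h t) absolutely_integrable_on {a..b}"
    by (intro absolutely_integrable_continuous_bilinear[OF bounded_bilinear_scaleR _ hI] continuous_intros)
  have mom1: "((\<lambda>t. (t - m) *\<^sub>R y) has_integral 0) {a..b}" for y :: "complex ^ 'p"
  proof -
    from has_integral_scaleR_left[OF centered_moments(1)[OF ab, folded m_def], of y] show ?thesis by simp
  qed
  have mom2: "((\<lambda>t. (t - m) *\<^sub>R ((t - m) *\<^sub>R y)) has_integral ((b - a)^3 / 12) *\<^sub>R y) {a..b}" for y :: "complex ^ 'p"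
  proof -
    from has_integral_scaleR_left[OF centered_moments(2)[OF ab, folded m_def], of y] show ?thesis by (simp add: power2_eq_square)
  qed
  have h0: "(h has_integral 0) {a..b}"
  proof -
    have "((\<lambda>t. z t - (\<alpha> + (t - m) *\<^sub>R \<beta>)) has_integral (integral {a..b} z - ((b - a) *\<^sub>R \<alpha> + 0))) {a..b}"
      using ab has_integral_const_real[of \<alpha> a b]
      by (intro has_integral_diff has_integral_add mom1 integrable_integral set_lebesgue_integral_eq_integral(1)[OF zI]) simp
    then show ?thesis using ab by (simp add: h_def[abs_def] aff_def \<alpha>_def)
  qed
  have h1: "((\<lambda>t. (t - m) *\<^sub>R h t) has_integral 0) {a..b}"
  proof -
    have "((\<lambda>t. (t - m) *\<^sub>R z t - ((t - m) *\<^sub>R \<alpha> + (t - m) *\<^sub>R ((t - m) *\<^sub>R \<beta>))) has_integral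
        (integral {a..b} (\<lambda>t. (t - m) *\<^sub>R z t) - (0 + ((b - a)^3 / 12) *\<^sub>R \<beta>))) {a..b}"
      by (intro has_integral_diff has_integral_add mom1 mom2 integrable_integral set_lebesgue_integral_eq_integral(1)[OF mz])
    moreover have "((b - a)^3 / 12) *\<^sub>R \<beta> = integral {a..b} (\<lambda>t. (t - m) *\<^sub>R z t)"
      using ab by (simp add: \<beta>_def)
    ultimately show ?thesis
      by (simp add: h_def[abs_def] aff_def scaleR_diff_right scaleR_add_right)
  qed
  \<comment> \<open>Both data vanish at \<open>a\<close> by construction. At \<open>b\<close>, the
    zeroth moment of \<open>h\<close> kills the slope and, after an integration by parts against
    \<open>t - m\<close>, the first moment kills the value.\<close>
  define \<phi>' where "\<phi>' t = 0 + integral {a..t} h" for t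
  have phi': "ac a b \<phi>' h" unfolding \<phi>'_def by (rule ac_integral[OF hI])
  define \<phi> where "\<phi> t = 0 + integral {a..t} \<phi>'" for t
  have phi: "ac a b \<phi> \<phi>'"
    unfolding \<phi>_def by (rule ac_integral[OF absolutely_integrable_continuous_real[OF ac_continuous_on[OF phi']]])
  have phi0: "\<phi> a = 0" "\<phi>' a = 0" "\<phi>' b = 0"
    using h0 by (simp_all add: \<phi>_def \<phi>'_def integral_unique)
  have "ac a b (\<lambda>t. t - m) (\<lambda>t. 1)"
    by (rule ac_C1) (auto intro!: derivative_eq_intros simp: has_real_derivative_iff_has_vector_derivative[symmetric])
  then have "ac a b (\<lambda>t. (t - m) *\<^sub>R \<phi>' t) (\<lambda>t. (t - m) *\<^sub>R h t + 1 *\<^sub>R \<phi>' t)"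
    by (rule ac_prod[OF bounded_bilinear_scaleR _ phi'])
  from ac_diff[OF this, of a b] have "integral {a..b} (\<lambda>t. (t - m) *\<^sub>R h t + \<phi>' t) = 0"
    using ab phi0 by simp
  moreover have "integral {a..b} (\<lambda>t. (t - m) *\<^sub>R h t + \<phi>' t) = integral {a..b} (\<lambda>t. (t - m) *\<^sub>R h t) + integral {a..b} \<phi>'"
    using h1 ac_integrable_on_sub[OF phi, of a b] by (intro Henstock_Kurzweil_Integration.integral_add) auto
  ultimately have phib: "\<phi> b = 0"
    using h1 by (simp add: \<phi>_def integral_unique)
  have "integral {a..b} (\<lambda>t. hip (- h t) (u t) - hip (\<phi> t) (v t)) = 0"
    by (rule test[OF phi phi' hL phi0(1,2) phib phi0(3)])
  moreover have "integral {a..b} (\<lambda>t. hip (- h t) (w t) - hip (\<phi> t) (v t)) = 0"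
    using green_interval[of a b \<phi> \<phi>' "\<lambda>t. - h t" w w' v] phi phi' w w' ab phi0 phib
    by (simp add: hip.zero_left)
  ultimately have "integral {a..b} (\<lambda>t. (hip (- h t) (w t) - hip (\<phi> t) (v t)) - (hip (- h t) (u t) - hip (\<phi> t) (v t))) = 0"
  proof -
    have phiL: "\<phi> \<in> L2 (lebesgue_on {a<..<b})" by (rule L2_continuous[OF ac_continuous_on[OF phi]])
    have "(\<lambda>t. hip (- h t) (u t) - hip (\<phi> t) (v t)) integrable_on {a..b}"
       "(\<lambda>t. hip (- h t) (w t) - hip (\<phi> t) (v t)) integrable_on {a..b}"
      by (intro integrable_diff set_lebesgue_integral_eq_integral(1) L2_bilinear_integrable_on[OF hip_bilinear]
         L2_uminus hL u v wL phiL)+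
    then show ?thesis
      using \<open>integral {a..b} (\<lambda>t. hip (- h t) (u t) - hip (\<phi> t) (v t)) = 0\<close>
        \<open>integral {a..b} (\<lambda>t. hip (- h t) (w t) - hip (\<phi> t) (v t)) = 0\<close>
      by (subst Henstock_Kurzweil_Integration.integral_diff) auto
  qed
  \<comment> \<open>Subtracting Green's formula for \<open>w\<close> from the test identity for
    \<open>u\<close> cancels \<open>v\<close>. As \<open>h\<close> is also orthogonal to
    \<open>aff\<close>, it is orthogonal to \<open>z - aff\<close>, that is, to itself.\<close>
  then have hz: "integral {a..b} (\<lambda>t. hip (h t) (z t)) = 0"
    by (simp add: z_def hip.diff_right hip.minus_left)
  have h_aff: "((\<lambda>t. hip (h t) (aff t)) has_integral 0) {a..b}"
  proof -
    have "((\<lambda>t. hip (h t) \<alpha> + hip ((t - m) *\<^sub>R h t) \<beta>) has_integral (hip 0 \<alpha> + hip 0 \<beta>)) {a..b}"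
      using has_integral_linear[OF h0 hip.bounded_linear_left] has_integral_linear[OF h1 hip.bounded_linear_left]
      by (intro has_integral_add) (simp_all add: o_def)
    then show ?thesis
      by (simp add: aff_def hip.zero_left hip.add_right hip.scaleR_left hip.scaleR_right)
  qed
  have "integral {a..b} (\<lambda>t. hip (h t) (z t) - hip (h t) (aff t)) = 0"
    using hz h_aff set_lebesgue_integral_eq_integral(1)[OF L2_bilinear_integrable_on[OF hip_bilinear hL zL]]
    by (subst Henstock_Kurzweil_Integration.integral_diff) (auto simp: integral_unique)
  then have "integral {a..b} (\<lambda>t. hip (h t) (h t)) = 0"
    by (simp add: h_def hip.diff_right)
  then have "(LINT t|lebesgue_on {a<..<b}. hip (h t) (h t)) = 0"
    by (simp add: lint_Ioo_eq_integral[OF L2_bilinear_integrable_on[OF hip_bilinear hL hL]])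
  then have "(LINT t|lebesgue_on {a<..<b}. (norm (h t))\<^sup>2) = 0"
    by (simp add: hip_self del: of_real_power)
  then have "AE t in lebesgue_on {a<..<b}. (norm (h t))\<^sup>2 = 0"
    using integral_nonneg_eq_0_iff_AE[OF L2_square_integrable[OF hL]] by simp
  then have "AE t in lebesgue. t \<in> {a<..<b} \<longrightarrow> h t = 0"
    by (simp add: AE_restrict_space_iff)
  then obtain N where N: "N \<in> null_sets lebesgue" "\<And>t. t \<notin> N \<Longrightarrow> t \<in> {a<..<b} \<longrightarrow> h t = 0"
    unfolding completion.AE_iff_null_sets by auto
  show ?thesis
  proof
    have aff_ac: "ac a b aff (\<lambda>t. \<beta>)"
      unfolding aff_def[abs_def]
      by (rule ac_C1) (auto intro!: derivative_eq_intros)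
    show "ac a b (\<lambda>t. w t + aff t) (\<lambda>t. w' t + \<beta>)"
      by (rule ac_add[OF w aff_ac])
    show "ac a b (\<lambda>t. w' t + \<beta>) (\<lambda>t. - v t)"
      using ac_add[OF w' ac_const[of a b \<beta>]] by simp
    show "negligible N" using N by (simp add: negligible_iff_null_sets)
    show "u t = w t + aff t" if "a < t" "t < b" "t \<notin> N" for t
      using N(2)[of t] that by (simp add: h_def z_def algebra_simps)
  qed
qed

section \<open>Interface conditions for the adjoint domain\<close>

context partition
begin

lemma lint_eq_cell_sum:
  fixes q :: "real \<Rightarrow> 'a::euclidean_space"
  assumes "integrable half_line q" "\<And>k. k > n \<Longrightarrow> integral {x (k - 1)..x k} q = 0"
  shows "(LINT t|half_line. q t) = (\<Sum>k=1..n. integral {x (k - 1)..x k} q)"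
proof -
  have "(\<Sum>k=1..N. integral {x (k - 1)..x k} q) = (\<Sum>k=1..n. integral {x (k - 1)..x k} q)" if "N \<ge> n" for N
    using that assms(2) by (intro sum.mono_neutral_right) auto
  then have "(\<lambda>N. \<Sum>k=1..N. integral {x (k - 1)..x k} q) \<longlonglongrightarrow> (\<Sum>k=1..n. integral {x (k - 1)..x k} q)"
    by (intro tendsto_eventually eventually_sequentiallyI)
  then show ?thesis
    by (rule LIMSEQ_unique[OF sum_cell_integrals_tendsto[OF assms(1)]])
qed

text \<open>The adjoint relation in the form in which it is applied: the test element is given by
  its pieces, finitely many of them nonzero, and the identity is a finite sum over cells.\<close>

lemma adjoint_cell_test:
  fixes \<Lambda> :: "nat \<Rightarrow> complex ^ 'p ^ 'p"
  assumes uv: "(u, v) \<in> graph_adjoint half_line (H_pre x \<Lambda>)"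
    and F: "\<And>k. k \<ge> 1 \<Longrightarrow> ac (x (k - 1)) (x k) (F k) (F' k)" "\<And>k. k \<ge> 1 \<Longrightarrow> ac (x (k - 1)) (x k) (F' k) (\<lambda>t. - G k t)"
    and GL: "\<And>k. k \<ge> 1 \<Longrightarrow> G k \<in> L2 (lebesgue_on {x (k - 1)<..<x k})"
    and start: "F' 1 (x 0) = 0"
    and jump: "\<And>k. k \<ge> 1 \<Longrightarrow> F (Suc k) (x k) = F k (x k)"
      "\<And>k. k \<ge> 1 \<Longrightarrow> F' (Suc k) (x k) - F' k (x k) = \<Lambda> k *v F k (x k)"
    and zero: "\<And>k t. k > n \<Longrightarrow> F k t = 0" "\<And>k t. k > n \<Longrightarrow> G k t = 0"
  shows "(\<Sum>k=1..n. integral {x (k - 1)..x k} (\<lambda>t. hip (G k t) (u t) - hip (F k t) (v t))) = 0"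
proof -
  have L2: "u \<in> L2 half_line" "v \<in> L2 half_line"
    and adj: "\<And>f g. (f, g) \<in> H_pre x \<Lambda> \<Longrightarrow> L2_inner half_line g u = L2_inner half_line f v"
    using uv by (auto simp: graph_adjoint_def)
  define f where "f = glue x F"
  define g where "g = glue x G"
  have fL: "f \<in> L2 half_line"
    unfolding f_def by (rule L2_glue[where n=n]) (use F ac_continuous_on L2_continuous zero in blast)+
  have gL: "g \<in> L2 half_line"
    unfolding g_def by (rule L2_glue[where n=n]) (use GL zero in auto)
  have f_eq: "f t = F k t" and g_eq: "g t = G k t" if "k \<ge> 1" "x (k - 1) < t" "t < x k" for k t
    unfolding f_def g_def using glue_eq[OF that(1) less_imp_le[OF that(2)] that(3)] by blast+
  have "(f, g) \<in> H_pre x \<Lambda>"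
  proof (rule H_preI[OF _ fL gL])
    show "interface_solution x \<Lambda> F F' g"
      unfolding interface_solution_def
    proof (intro conjI allI impI F start jump)
      fix k :: nat assume k: "1 \<le> k"
      show "ac (x (k - 1)) (x k) (F' k) (\<lambda>t. - g t)"
        by (rule ac_cong[OF F(2)[OF k]]) (use g_eq[OF k] in auto)
    qed
    show "f t = 0" if t: "t > x n" for t
    proof -
      obtain k where k: "k \<ge> 1" "x (k - 1) \<le> t" "t < x k"
        using exists_cell[of t] t x_nonneg[of n] by auto
      have "x n < x k" using t k by simp
      then have "n < k" using mono_x strict_mono_less by blast
      then show ?thesis unfolding f_def glue_eq[OF k] using zero by simp
    qed
  qed (use f_eq in auto)
  then have "L2_inner half_line g u = L2_inner half_line f v" by (rule adj)
  then have "(LINT t|half_line. hip (g t) (u t) - hip (f t) (v t)) = 0"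
    using hip_L2_integrable[OF gL L2(1)] hip_L2_integrable[OF fL L2(2)] by (simp add: L2_inner_eq_hip)
  moreover have cell: "integral {x (k - 1)..x k} (\<lambda>t. hip (g t) (u t) - hip (f t) (v t)) =
      integral {x (k - 1)..x k} (\<lambda>t. hip (G k t) (u t) - hip (F k t) (v t))" if "k \<ge> 1" for k
    by (rule integral_spike[of "{x (k - 1), x k}"]) (use f_eq[OF that] g_eq[OF that] in auto)
  moreover have "(LINT t|half_line. hip (g t) (u t) - hip (f t) (v t)) =
     (\<Sum>k=1..n. integral {x (k - 1)..x k} (\<lambda>t. hip (g t) (u t) - hip (f t) (v t)))"
  proof (rule lint_eq_cell_sum)
    show "integrable half_line (\<lambda>t. hip (g t) (u t) - hip (f t) (v t))"
      by (intro Bochner_Integration.integrable_diff hip_L2_integrable fL gL L2)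
    show "integral {x (k - 1)..x k} (\<lambda>t. hip (g t) (u t) - hip (f t) (v t)) = 0" if "k > n" for k
      using that cell[of k] zero[OF that] by (simp add: bounded_bilinear.zero_left[OF hip_bilinear])
  qed
  ultimately show ?thesis by simp
qed

text \<open>Tests living in one cell with zero data at its ends give regularity there. Green's
  formula then reduces every further test to boundary forms, and tests with arbitrary value
  \<open>c\<close> and slope \<open>l\<close> at a node isolate the conditions on \<open>U\<close>
  there.\<close>

lemma adjoint_regularity:
  fixes \<Lambda> :: "nat \<Rightarrow> complex ^ 'p ^ 'p"
  assumes uv: "(u, v) \<in> graph_adjoint half_line (H_pre x \<Lambda>)"
    and herm: "\<And>k. k \<ge> 1 \<Longrightarrow> conj_transpose (\<Lambda> k) = \<Lambda> k"
  obtains U U' N where "interface_solution x \<Lambda> U U' v" "negligible N"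
    "\<And>k t. k \<ge> 1 \<Longrightarrow> x (k - 1) < t \<Longrightarrow> t < x k \<Longrightarrow> t \<notin> N \<Longrightarrow> u t = U k t"
proof -
  interpret hip: bounded_bilinear "hip :: complex ^ 'p \<Rightarrow> complex ^ 'p \<Rightarrow> complex"
    by (rule hip_bilinear)
  have L2: "u \<in> L2 half_line" "v \<in> L2 half_line"
    using uv by (auto simp: graph_adjoint_def)
  have "\<forall>k. \<exists>U U' N. k \<ge> 1 \<longrightarrow> ac (x (k - 1)) (x k) U U' \<and> ac (x (k - 1)) (x k) U' (\<lambda>t. - v t) \<and> negligible N \<and>
      (\<forall>t. x (k - 1) < t \<longrightarrow> t < x k \<longrightarrow> t \<notin> N \<longrightarrow> u t = U t)"
  proof (rule allI, cases)
    fix k :: nat assume k: "k \<ge> 1"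
    have test: "integral {x (k - 1)..x k} (\<lambda>t. hip (- h t) (u t) - hip (\<phi> t) (v t)) = 0"
      if phi: "ac (x (k - 1)) (x k) \<phi> \<phi>'" "ac (x (k - 1)) (x k) \<phi>' h" "h \<in> L2 (lebesgue_on {x (k - 1)<..<x k})"
       "\<phi> (x (k - 1)) = 0" "\<phi>' (x (k - 1)) = 0" "\<phi> (x k) = 0" "\<phi>' (x k) = 0" for \<phi> \<phi>' h
    proof -
      define F where "F j = (if j = k then \<phi> else (\<lambda>_. 0))" for j
      define F' where "F' j = (if j = k then \<phi>' else (\<lambda>_. 0))" for j
      define G where "G j = (if j = k then (\<lambda>t. - h t) else (\<lambda>_. 0))" for j
      have "(\<Sum>j=1..k. integral {x (j - 1)..x j} (\<lambda>t. hip (G j t) (u t) - hip (F j t) (v t))) = 0"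
      proof (rule adjoint_cell_test[OF uv, where F'=F'])
        show "ac (x (j - 1)) (x j) (F j) (F' j)" for j
          using phi(1) by (auto simp: F_def F'_def ac_const)
        show "ac (x (j - 1)) (x j) (F' j) (\<lambda>t. - G j t)" for j
          using phi(2) by (auto simp: G_def F'_def ac_const)
        show "G j \<in> L2 (lebesgue_on {x (j - 1)<..<x j})" for j
          using L2_uminus[OF phi(3)] by (auto simp: G_def L2_zero)
        show "F' 1 (x 0) = 0" using phi(5) by (auto simp: F'_def)
        have phi': "\<phi> (x j) = 0" "\<phi>' (x j) = 0" if "Suc j = k \<or> j = k" for j
          using phi(4-7) that by auto
        show "F (Suc j) (x j) = F j (x j)" for j
          using phi'[of j] by (auto simp: F_def)
        show "F' (Suc j) (x j) - F' j (x j) = \<Lambda> j *v F j (x j)" for j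
          using phi'[of j] by (auto simp: F_def F'_def)
      qed (auto simp: F_def G_def)
      moreover have "(\<Sum>j=1..k. integral {x (j - 1)..x j} (\<lambda>t. hip (G j t) (u t) - hip (F j t) (v t))) =
         (\<Sum>j=1..k. if j = k then integral {x (k - 1)..x k} (\<lambda>t. hip (- h t) (u t) - hip (\<phi> t) (v t)) else 0)"
        by (intro sum.cong refl) (auto simp: F_def G_def hip.zero_left)
      ultimately show ?thesis using k by simp
    qed
    show "\<exists>U U' N. k \<ge> 1 \<longrightarrow> ac (x (k - 1)) (x k) U U' \<and> ac (x (k - 1)) (x k) U' (\<lambda>t. - v t) \<and> negligible N \<and>
      (\<forall>t. x (k - 1) < t \<longrightarrow> t < x k \<longrightarrow> t \<notin> N \<longrightarrow> u t = U t)"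
    proof (rule second_derivative_regularity[OF x_less[OF k] L2_cell[OF L2(1)] L2_cell[OF L2(2)]])
      fix U U' N
      assume "ac (x (k - 1)) (x k) U U'" "ac (x (k - 1)) (x k) U' (\<lambda>t. - v t)" "negligible N"
        "\<And>t. x (k - 1) < t \<Longrightarrow> t < x k \<Longrightarrow> t \<notin> N \<Longrightarrow> u t = U t"
      then show ?thesis by blast
    qed (rule test)
  qed simp
  from this[unfolded choice_iff] obtain U U' N
    where sol: "\<forall>k\<ge>1. ac (x (k - 1)) (x k) (U k) (U' k) \<and> ac (x (k - 1)) (x k) (U' k) (\<lambda>t. - v t) \<and> negligible (N k) \<and>
      (\<forall>t. x (k - 1) < t \<longrightarrow> t < x k \<longrightarrow> t \<notin> N k \<longrightarrow> u t = U k t)"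
    by (elim exE)
  then have U: "\<And>k. k \<ge> 1 \<Longrightarrow> ac (x (k - 1)) (x k) (U k) (U' k)"
     "\<And>k. k \<ge> 1 \<Longrightarrow> ac (x (k - 1)) (x k) (U' k) (\<lambda>t. - v t)"
    and N: "\<And>k. k \<ge> 1 \<Longrightarrow> negligible (N k)"
    and uU: "\<And>k t. k \<ge> 1 \<Longrightarrow> x (k - 1) < t \<Longrightarrow> t < x k \<Longrightarrow> t \<notin> N k \<Longrightarrow> u t = U k t"
    by blast+
  define W where "W F F' k t = hip (F k t) (U' k t) - hip (F' k t) (U k t)" for F F' :: "nat \<Rightarrow> real \<Rightarrow> complex ^ 'p" and k t
  have boundary: "(\<Sum>k=1..n. W F F' k (x k) - W F F' k (x (k - 1))) = 0"
    if F: "\<And>k. k \<ge> 1 \<Longrightarrow> ac (x (k - 1)) (x k) (F k) (F' k)" "\<And>k. k \<ge> 1 \<Longrightarrow> ac (x (k - 1)) (x k) (F' k) (\<lambda>t. - G k t)"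
    and GL: "\<And>k. k \<ge> 1 \<Longrightarrow> G k \<in> L2 (lebesgue_on {x (k - 1)<..<x k})"
    and start: "F' 1 (x 0) = 0"
    and jump: "\<And>k. k \<ge> 1 \<Longrightarrow> F (Suc k) (x k) = F k (x k)"
      "\<And>k. k \<ge> 1 \<Longrightarrow> F' (Suc k) (x k) - F' k (x k) = \<Lambda> k *v F k (x k)"
    and zero: "\<And>k t. k > n \<Longrightarrow> F k t = 0" "\<And>k t. k > n \<Longrightarrow> G k t = 0" for F F' G n
  proof -
    have "integral {x (k - 1)..x k} (\<lambda>t. hip (G k t) (u t) - hip (F k t) (v t)) = W F F' k (x k) - W F F' k (x (k - 1))"
      if k: "k \<ge> 1" for k
    proof -
      have "integral {x (k - 1)..x k} (\<lambda>t. hip (G k t) (u t) - hip (F k t) (v t)) =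
         integral {x (k - 1)..x k} (\<lambda>t. hip (G k t) (U k t) - hip (F k t) (v t))"
        by (rule integral_spike[of "N k \<union> {x (k - 1), x k}"]) (use uU[OF k] N[OF k] in auto)
      also have "\<dots> = W F F' k (x k) - W F F' k (x (k - 1))"
        unfolding W_def by (rule green_interval[OF F(1)[OF k] F(2)[OF k] U(1)[OF k] U(2)[OF k] less_imp_le[OF x_less[OF k]]])
      finally show ?thesis .
    qed
    then show ?thesis
      using adjoint_cell_test[OF uv F GL start jump zero] by simp
  qed
  have interface: "hip c (U' k (x k)) - hip l (U k (x k)) =
      hip c (U' (Suc k) (x k)) - hip (l + \<Lambda> k *v c) (U (Suc k) (x k))" if k: "k \<ge> 1" for k c l
  proof -
    \<comment> \<open>A test element carried by the two cells around \<open>x k\<close>. The slopes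
      on the two sides differ by \<open>\<Lambda> k *v c\<close>, so it satisfies the interface
      condition for any \<open>c\<close> and \<open>l\<close>.\<close>
    obtain \<phi> \<phi>' h where phi: "\<And>a b. ac a b \<phi> \<phi>'" "\<And>a b. ac a b \<phi>' h" "continuous_on UNIV h"
      "\<phi> (x k) = c" "\<phi>' (x k) = l" "\<phi> (x (k - 1)) = 0" "\<phi>' (x (k - 1)) = 0"
      using hermite_interpolation[of "x k" "x (k - 1)" c l] x_less[OF k] by auto
    obtain \<psi> \<psi>' h2 where psi: "\<And>a b. ac a b \<psi> \<psi>'" "\<And>a b. ac a b \<psi>' h2" "continuous_on UNIV h2"
      "\<psi> (x k) = c" "\<psi>' (x k) = l + \<Lambda> k *v c" "\<psi> (x (Suc k)) = 0" "\<psi>' (x (Suc k)) = 0"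
      using hermite_interpolation[of "x k" "x (Suc k)" c "l + \<Lambda> k *v c"] x_less[of "Suc k"] by auto
    define F where "F j = (if j = k then \<phi> else if j = Suc k then \<psi> else (\<lambda>_. 0))" for j
    define F' where "F' j = (if j = k then \<phi>' else if j = Suc k then \<psi>' else (\<lambda>_. 0))" for j
    define G where "G j = (if j = k then (\<lambda>t. - h t) else if j = Suc k then (\<lambda>t. - h2 t) else (\<lambda>_. 0))" for j
    have "(\<Sum>j=1..Suc k. W F F' j (x j) - W F F' j (x (j - 1))) = 0"
    proof (rule boundary[where G=G])
      show "ac (x (j - 1)) (x j) (F j) (F' j)" for j
        using phi(1) psi(1) by (auto simp: F_def F'_def ac_const)
      show "ac (x (j - 1)) (x j) (F' j) (\<lambda>t. - G j t)" for j
        using phi(2) psi(2) by (auto simp: G_def F'_def ac_const)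
      show "G j \<in> L2 (lebesgue_on {x (j - 1)<..<x j})" for j
        by (rule L2_continuous)
           (use phi(3) psi(3) in \<open>auto simp: G_def intro!: continuous_intros intro: continuous_on_subset\<close>)
      show "F' 1 (x 0) = 0" using phi(7) k by (auto simp: F'_def)
      show "F (Suc j) (x j) = F j (x j)" if "j \<ge> 1" for j
        using phi psi by (auto simp: F_def)
      show "F' (Suc j) (x j) - F' j (x j) = \<Lambda> j *v F j (x j)" if "j \<ge> 1" for j
        using phi psi by (auto simp: F_def F'_def)
    qed (auto simp: F_def G_def)
    moreover have "(\<Sum>j=1..Suc k. W F F' j (x j) - W F F' j (x (j - 1))) =
       (\<Sum>j\<in>{k, Suc k}. W F F' j (x j) - W F F' j (x (j - 1)))"
      using k by (intro sum.mono_neutral_right) (auto simp: W_def F_def F'_def hip.zero_left)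
    moreover have "W F F' k (x (k - 1)) = 0" "W F F' (Suc k) (x (Suc k)) = 0"
      using phi psi by (auto simp: W_def F_def F'_def hip.zero_left)
    ultimately have "W F F' k (x k) = W F F' (Suc k) (x k)" by simp
    then show ?thesis
      using phi psi by (simp add: W_def F_def F'_def)
  qed
  have cont: "U (Suc k) (x k) = U k (x k)" if k: "k \<ge> 1" for k
  proof -
    \<comment> \<open>Value 0 and free slope isolate continuity; below, slope 0 and free value
      isolate the jump, once the Hermitian matrix is moved across \<open>hip\<close>.\<close>
    have "hip l (U (Suc k) (x k) - U k (x k)) = 0" for l
      using interface[OF k, of 0 l] by (simp add: hip.zero_left hip.diff_right)
    then have "U (Suc k) (x k) - U k (x k) = 0" by (rule hip_eq_0_all)
    then show ?thesis by simp
  qed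
  have jump: "U' (Suc k) (x k) - U' k (x k) = \<Lambda> k *v U k (x k)" if k: "k \<ge> 1" for k
  proof -
    have "hip c (U' (Suc k) (x k) - U' k (x k) - \<Lambda> k *v U k (x k)) = 0" for c
      using interface[OF k, of c 0] hip_selfadjoint_matrix[OF herm[OF k], of c "U k (x k)"]
      by (simp add: hip.zero_left hip.diff_right cont[OF k])
    then have "U' (Suc k) (x k) - U' k (x k) - \<Lambda> k *v U k (x k) = 0" by (rule hip_eq_0_all)
    then show ?thesis by simp
  qed
  have start: "U' 1 (x 0) = 0"
  proof (rule hip_eq_0_all)
    fix c :: "complex ^ 'p"
    obtain \<phi> \<phi>' h where phi: "\<And>a b. ac a b \<phi> \<phi>'" "\<And>a b. ac a b \<phi>' h" "continuous_on UNIV h"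
      "\<phi> (x 0) = c" "\<phi>' (x 0) = 0" "\<phi> (x 1) = 0" "\<phi>' (x 1) = 0"
      using hermite_interpolation[of "x 0" "x 1" c 0] x_less[of 1] by auto
    define F where "F j = (if j = 1 then \<phi> else (\<lambda>_. 0))" for j :: nat
    define F' where "F' j = (if j = 1 then \<phi>' else (\<lambda>_. 0))" for j :: nat
    define G where "G j = (if j = 1 then (\<lambda>t. - h t) else (\<lambda>_. 0))" for j :: nat
    have "(\<Sum>j=1..1. W F F' j (x j) - W F F' j (x (j - 1))) = 0"
    proof (rule boundary[where G=G])
      show "ac (x (j - 1)) (x j) (F j) (F' j)" for j
        using phi(1) by (auto simp: F_def F'_def ac_const)
      show "ac (x (j - 1)) (x j) (F' j) (\<lambda>t. - G j t)" for j
        using phi(2) by (auto simp: G_def F'_def ac_const)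
      show "G j \<in> L2 (lebesgue_on {x (j - 1)<..<x j})" for j
        by (rule L2_continuous)
           (use phi(3) in \<open>auto simp: G_def intro!: continuous_intros intro: continuous_on_subset\<close>)
    qed (use phi in \<open>auto simp: F_def F'_def G_def\<close>)
    then show "hip c (U' 1 (x 0)) = 0"
      using phi by (simp add: W_def F_def F'_def hip.zero_left)
  qed
  show ?thesis
  proof
    show "interface_solution x \<Lambda> U U' v"
      using U start cont jump by (simp add: interface_solution_def)
    show "negligible (\<Union>k\<in>{1..}. N k)"
      using N by (intro negligible_countable_Union) auto
    show "u t = U k t" if "k \<ge> 1" "x (k - 1) < t" "t < x k" "t \<notin> (\<Union>k\<in>{1..}. N k)" for k t
      using uU[OF that(1-3)] that by auto
  qed
qed

end

section \<open>Closures and adjoints of graphs\<close>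

lemma L2_norm_less_iff:
  assumes "e > 0"
  shows "L2_norm M f < e \<longleftrightarrow> (LINT t|M. (norm (f t))\<^sup>2) < e\<^sup>2"
  unfolding L2_norm_def using assms by (metis abs_of_pos real_sqrt_abs real_sqrt_less_iff)

lemma graph_closureI:
  assumes "f \<in> L2 M" "g \<in> L2 M"
    and "\<And>\<epsilon>. \<epsilon> > 0 \<Longrightarrow> \<exists>F G. (F, G) \<in> A \<and> (LINT t|M. (norm (F t - f t))\<^sup>2) < \<epsilon> \<and> (LINT t|M. (norm (G t - g t))\<^sup>2) < \<epsilon>"
  shows "(f, g) \<in> graph_closure M A"
proof -
  have "\<forall>n. \<exists>F G. (F, G) \<in> A \<and> (LINT t|M. (norm (F t - f t))\<^sup>2) < inverse (real (Suc n)) \<and>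
      (LINT t|M. (norm (G t - g t))\<^sup>2) < inverse (real (Suc n))"
    by (intro allI assms(3)) simp
  from this[unfolded choice_iff] obtain F G where FG: "\<And>n. (F n, G n) \<in> A"
    "\<And>n. (LINT t|M. (norm (F n t - f t))\<^sup>2) < inverse (real (Suc n))"
    "\<And>n. (LINT t|M. (norm (G n t - g t))\<^sup>2) < inverse (real (Suc n))"
    by blast
  have lim: "(\<lambda>n. L2_norm M (\<lambda>t. K n t - k t)) \<longlonglongrightarrow> 0"
    if "\<And>n. (LINT t|M. (norm (K n t - k t))\<^sup>2) < inverse (real (Suc n))" for K k
  proof -
    have "(\<lambda>n. LINT t|M. (norm (K n t - k t))\<^sup>2) \<longlonglongrightarrow> 0"
    proof (rule real_tendsto_sandwich[OF _ _ tendsto_const LIMSEQ_inverse_real_of_nat])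
      show "\<forall>\<^sub>F n in sequentially. 0 \<le> (LINT t|M. (norm (K n t - k t))\<^sup>2)"
        by (intro always_eventually allI Bochner_Integration.integral_nonneg) simp
      show "\<forall>\<^sub>F n in sequentially. (LINT t|M. (norm (K n t - k t))\<^sup>2) \<le> inverse (real (Suc n))"
        using that by (intro always_eventually allI less_imp_le)
    qed
    from tendsto_real_sqrt[OF this] show ?thesis by (simp add: L2_norm_def)
  qed
  show ?thesis
    unfolding graph_closure_def using assms(1,2) FG(1) lim[OF FG(2)] lim[OF FG(3)] by blast
qed

lemma graph_closure_superset: "A \<subseteq> L2 M \<times> L2 M \<Longrightarrow> A \<subseteq> graph_closure M A"
proof
  fix p assume A: "A \<subseteq> L2 M \<times> L2 M" and "p \<in> A"
  obtain f g where p: "p = (f, g)" by (cases p)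
  have "(f, g) \<in> graph_closure M A"
  proof (rule graph_closureI)
    fix \<epsilon> :: real assume "\<epsilon> > 0"
    then show "\<exists>F G. (F, G) \<in> A \<and> (LINT t|M. (norm (F t - f t))\<^sup>2) < \<epsilon> \<and> (LINT t|M. (norm (G t - g t))\<^sup>2) < \<epsilon>"
      using \<open>p \<in> A\<close> p by (intro exI[of _ f] exI[of _ g]) simp
  qed (use A \<open>p \<in> A\<close> p in auto)
  then show "p \<in> graph_closure M A" using p by simp
qed

lemma graph_adjoint_antimono: "A \<subseteq> B \<Longrightarrow> graph_adjoint M B \<subseteq> graph_adjoint M A"
  unfolding graph_adjoint_def by blast

lemma L2_inner_cnj: "L2_inner M g f = cnj (L2_inner M f g)"
  by (simp add: L2_inner_eq_hip hip_commute[of "g _" "f _"])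

lemma norm_hip_le: "norm (hip u v) \<le> norm u * norm v"
proof -
  have "norm (hip u v) \<le> (\<Sum>i\<in>UNIV. cmod (u $ i) * cmod (v $ i))"
    unfolding hip_def by (rule order_trans[OF norm_sum]) (simp add: norm_mult)
  also have "\<dots> \<le> norm u * norm v"
    using L2_set_mult_ineq[of "\<lambda>i. cmod (u $ i)" "\<lambda>i. cmod (v $ i)" UNIV] by (simp add: norm_vec_def)
  finally show ?thesis .
qed

text \<open>The elementary bound \<open>|(f, g)| \<le> c |f|\<^sup>2 + |g|\<^sup>2 / c\<close>, in place of Cauchy--Schwarz in \<open>L2\<close>.\<close>

lemma L2_inner_bound:
  assumes f: "f \<in> L2 M" and g: "g \<in> L2 M" and "c > 0"
  shows "norm (L2_inner M f g) \<le> c * (L2_norm M f)\<^sup>2 + (L2_norm M g)\<^sup>2 / c"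
proof -
  have "norm (L2_inner M f g) \<le> (LINT t|M. norm (hip (f t) (g t)))"
    unfolding L2_inner_eq_hip by (rule integral_norm_bound)
  also have "\<dots> \<le> (LINT t|M. c * (norm (f t))\<^sup>2 + (norm (g t))\<^sup>2 / c)"
  proof (rule integral_mono)
    show "integrable M (\<lambda>t. norm (hip (f t) (g t)))"
      using hip_L2_integrable[OF f g] by simp
    show "integrable M (\<lambda>t. c * (norm (f t))\<^sup>2 + (norm (g t))\<^sup>2 / c)"
      using L2_square_integrable[OF f] L2_square_integrable[OF g] by simp
    fix t
    have "2 * (sqrt c * norm (f t)) * (norm (g t) / sqrt c) \<le> (sqrt c * norm (f t))\<^sup>2 + (norm (g t) / sqrt c)\<^sup>2"
      by (rule sum_squares_bound)
    then have "2 * (norm (f t) * norm (g t)) \<le> c * (norm (f t))\<^sup>2 + (norm (g t))\<^sup>2 / c"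
      using \<open>c > 0\<close> by (simp add: power_mult_distrib power_divide)
    moreover have "0 \<le> norm (f t) * norm (g t)" by simp
    ultimately show "norm (hip (f t) (g t)) \<le> c * (norm (f t))\<^sup>2 + (norm (g t))\<^sup>2 / c"
      using norm_hip_le[of "f t" "g t"] by linarith
  qed
  also have "\<dots> = c * (L2_norm M f)\<^sup>2 + (L2_norm M g)\<^sup>2 / c"
    using L2_square_integrable[OF f] L2_square_integrable[OF g] by (simp add: L2_norm_def)
  finally show ?thesis .
qed

lemma L2_inner_tendsto:
  assumes F: "\<And>n. F n \<in> L2 M" and f: "f \<in> L2 M" and g: "g \<in> L2 M"
    and lim: "(\<lambda>n. L2_norm M (\<lambda>t. F n t - f t)) \<longlonglongrightarrow> 0"
  shows "(\<lambda>n. L2_inner M (F n) g) \<longlonglongrightarrow> L2_inner M f g"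
proof -
  define B where "B = (L2_norm M g)\<^sup>2 + 1"
  have "B > 0" unfolding B_def by (simp add: add_nonneg_pos)
  have "(\<lambda>n. L2_inner M (F n) g - L2_inner M f g) \<longlonglongrightarrow> 0"
  proof (rule LIMSEQ_I)
    fix e :: real assume "e > 0"
    \<comment> \<open>This makes the fixed term \<open>(L2_norm M g)\<^sup>2 / c\<close> at most
      \<open>e / 2\<close>; the summand 1 in \<open>B\<close> keeps \<open>c\<close> positive even
      if \<open>g\<close> has norm 0.\<close>
    define c where "c = 2 * B / e"
    have "c > 0" using \<open>B > 0\<close> \<open>e > 0\<close> by (simp add: c_def)
    have "(\<lambda>n. c * (L2_norm M (\<lambda>t. F n t - f t))\<^sup>2) \<longlonglongrightarrow> c * 0\<^sup>2"
      by (intro tendsto_intros lim)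
    from order_tendstoD(2)[OF this, of "e / 2"]
    have "\<forall>\<^sub>F n in sequentially. c * (L2_norm M (\<lambda>t. F n t - f t))\<^sup>2 < e / 2"
      using \<open>e > 0\<close> by simp
    then obtain N where N: "\<And>n. n \<ge> N \<Longrightarrow> c * (L2_norm M (\<lambda>t. F n t - f t))\<^sup>2 < e / 2"
      unfolding eventually_sequentially by blast
    show "\<exists>no. \<forall>n\<ge>no. norm (L2_inner M (F n) g - L2_inner M f g - 0) < e"
    proof (intro exI allI impI)
      fix n assume n: "n \<ge> N"
      have "L2_inner M (F n) g - L2_inner M f g = L2_inner M (\<lambda>t. F n t - f t) g"
        using hip_L2_integrable[OF F[of n] g] hip_L2_integrable[OF f g]
        by (simp add: L2_inner_eq_hip bounded_bilinear.diff_left[OF hip_bilinear])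
      then have "norm (L2_inner M (F n) g - L2_inner M f g - 0) \<le> c * (L2_norm M (\<lambda>t. F n t - f t))\<^sup>2 + (L2_norm M g)\<^sup>2 / c"
        using L2_inner_bound[OF L2_diff[OF F[of n] f] g \<open>c > 0\<close>] by simp
      moreover have "(L2_norm M g)\<^sup>2 / c \<le> e / 2"
        using \<open>e > 0\<close> \<open>B > 0\<close> by (simp add: c_def B_def field_simps)
      ultimately show "norm (L2_inner M (F n) g - L2_inner M f g - 0) < e"
        using N[OF n] by linarith
    qed
  qed
  then show ?thesis by (simp add: LIM_zero_iff)
qed

text \<open>Pass to the limit in one argument at a time: \<open>step\<close> extends an identity in
  its first argument from \<open>A\<close> to the closure, \<open>half\<close> uses it on the other
  argument by conjugation, and a second use of \<open>step\<close> finishes.\<close>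

lemma graph_closure_symmetric:
  assumes A: "A \<subseteq> L2 M \<times> L2 M"
    and sym: "\<And>f g u v. (f, g) \<in> A \<Longrightarrow> (u, v) \<in> A \<Longrightarrow> L2_inner M g u = L2_inner M f v"
  shows "graph_closure M A \<subseteq> graph_adjoint M (graph_closure M A)"
proof -
  have step: "L2_inner M g u = L2_inner M f v"
    if fg: "(f, g) \<in> graph_closure M A" and uv: "u \<in> L2 M" "v \<in> L2 M"
      and test: "\<And>F G. (F, G) \<in> A \<Longrightarrow> L2_inner M G u = L2_inner M F v" for f g u v
  proof -
    obtain F G where FG: "\<And>n. (F n, G n) \<in> A" "(\<lambda>n. L2_norm M (\<lambda>t. F n t - f t)) \<longlonglongrightarrow> 0"
        "(\<lambda>n. L2_norm M (\<lambda>t. G n t - g t)) \<longlonglongrightarrow> 0" and L2: "f \<in> L2 M" "g \<in> L2 M"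
      using fg unfolding graph_closure_def by blast
    have FL: "F n \<in> L2 M" "G n \<in> L2 M" for n using A FG(1)[of n] by auto
    have "(\<lambda>n. L2_inner M (G n) u) \<longlonglongrightarrow> L2_inner M g u"
      by (rule L2_inner_tendsto[OF FL(2) L2(2) uv(1) FG(3)])
    moreover have "(\<lambda>n. L2_inner M (F n) v) \<longlonglongrightarrow> L2_inner M f v"
      by (rule L2_inner_tendsto[OF FL(1) L2(1) uv(2) FG(2)])
    ultimately show ?thesis
      using test[OF FG(1)] by (metis (no_types, lifting) LIMSEQ_unique ext)
  qed
  have cl: "f \<in> L2 M \<and> g \<in> L2 M" if "(f, g) \<in> graph_closure M A" for f g
    using that by (simp add: graph_closure_def)
  have half: "L2_inner M g u = L2_inner M f v"
    if fg: "(f, g) \<in> A" and uv: "(u, v) \<in> graph_closure M A" for f g u v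
  proof -
    have "L2_inner M v f = L2_inner M u g"
      using step[OF uv, of f g] A fg sym[OF _ fg] by auto
    then show ?thesis using L2_inner_cnj[of M g u] L2_inner_cnj[of M f v] by simp
  qed
  show ?thesis
  proof
    fix p assume "p \<in> graph_closure M A"
    then obtain u v where p: "p = (u, v)" and uv: "(u, v) \<in> graph_closure M A" by (cases p) auto
    have "L2_inner M g u = L2_inner M f v" if "(f, g) \<in> graph_closure M A" for f g
      using step[OF that] cl[OF uv] half[OF _ uv] by blast
    then show "p \<in> graph_adjoint M (graph_closure M A)"
      using cl[OF uv] p by (auto simp: graph_adjoint_def)
  qed
qed

context partition
begin

lemma H_pre_subset_L2: "H_pre x \<Lambda> \<subseteq> L2 half_line \<times> L2 half_line"
  by (auto simp: H_pre_def)

lemma adjoint_subset_closure: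
  fixes \<Lambda> :: "nat \<Rightarrow> complex ^ 'p ^ 'p"
  assumes herm: "\<And>k. k \<ge> 1 \<Longrightarrow> conj_transpose (\<Lambda> k) = \<Lambda> k"
    and D: "\<And>k. k \<ge> 1 \<Longrightarrow> gap x k \<le> D"
    and top: "filterlim (\<lambda>n. \<Sum>k=1..n. (gap x k)\<^sup>2) at_top sequentially"
  shows "graph_adjoint half_line (H_pre x \<Lambda>) \<subseteq> graph_closure half_line (H_pre x \<Lambda>)"
proof
  fix p assume "p \<in> graph_adjoint half_line (H_pre x \<Lambda>)"
  then obtain u v where p: "p = (u, v)" and uv: "(u, v) \<in> graph_adjoint half_line (H_pre x \<Lambda>)"
    by (cases p) auto
  have L2: "u \<in> L2 half_line" "v \<in> L2 half_line"
    using uv by (auto simp: graph_adjoint_def)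
  obtain U U' N where U: "interface_solution x \<Lambda> U U' v" and N: "negligible N"
    and uU: "\<And>k t. k \<ge> 1 \<Longrightarrow> x (k - 1) < t \<Longrightarrow> t < x k \<Longrightarrow> t \<notin> N \<Longrightarrow> u t = U k t"
    using adjoint_regularity[OF uv herm] by blast
  \<comment> \<open>An adjoint element matches its regular pieces only almost everywhere, while
    truncation needs a match throughout the open cells; so the representative \<open>w\<close> is
    truncated in place of \<open>u\<close>.\<close>
  define w where "w = glue x U"
  define N' where "N' = N \<union> range x"
  have N': "negligible N'"
    unfolding N'_def using N
    by (intro negligible_Un) (simp_all add: negligible_iff_null_sets null_sets_completionI countable_imp_null_set_lborel)
  have wu: "w t = u t" if t: "t \<in> {0<..} - N'" for t
  proof -
    obtain k where k: "k \<ge> 1" "x (k - 1) \<le> t" "t < x k" using exists_cell[of t] t by auto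
    have "x (k - 1) < t" using k t by (auto simp: N'_def less_le)
    then show ?thesis unfolding w_def glue_eq[OF k] using uU[OF k(1) _ k(3)] t by (simp add: N'_def)
  qed
  have wL: "w \<in> L2 half_line"
    by (rule L2_spike[OF L2(1) N']) (use wu in auto)
  have ae: "AE t in half_line. w t = u t"
  proof (rule AE_I')
    show "{t \<in> space half_line. w t \<noteq> u t} \<subseteq> N' \<inter> {0<..}" using wu by auto
    have "N' \<inter> {0<..} \<in> null_sets lebesgue"
      using N' negligible_subset[of N' "N' \<inter> {0<..}"] by (simp add: negligible_iff_null_sets)
    then show "N' \<inter> {0<..} \<in> null_sets half_line"
      by (simp add: null_sets_restrict_space)
  qed
  have "(u, v) \<in> graph_closure half_line (H_pre x \<Lambda>)"
  proof (rule graph_closureI[OF L2])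
    fix \<epsilon> :: real assume "\<epsilon> > 0"
    have wU: "w t = U k t" if "k \<ge> 1" "x (k - 1) < t" "t < x k" for k t
      unfolding w_def glue_eq[OF that(1) less_imp_le[OF that(2)] that(3)] ..
    obtain F G where FG: "(F, G) \<in> H_pre x \<Lambda>"
      "(LINT t|half_line. (norm (F t - w t))\<^sup>2) < \<epsilon>" "(LINT t|half_line. (norm (G t - v t))\<^sup>2) < \<epsilon>"
      using interface_solution_in_closure[OF U wL L2(2) wU D top \<open>\<epsilon> > 0\<close>] by blast
    have FL: "F \<in> L2 half_line" using FG(1) H_pre_subset_L2 by blast
    have "(LINT t|half_line. (norm (F t - w t))\<^sup>2) = (LINT t|half_line. (norm (F t - u t))\<^sup>2)"
    proof (rule integral_cong_AE)
      show "(\<lambda>t. (norm (F t - w t))\<^sup>2) \<in> borel_measurable half_line" "(\<lambda>t. (norm (F t - u t))\<^sup>2) \<in> borel_measurable half_line"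
        by (rule borel_measurable_integrable[OF L2_square_integrable] L2_diff FL wL L2(1))+
      show "AE t in half_line. (norm (F t - w t))\<^sup>2 = (norm (F t - u t))\<^sup>2"
        using ae by eventually_elim simp
    qed
    then show "\<exists>F G. (F, G) \<in> H_pre x \<Lambda> \<and> (LINT t|half_line. (norm (F t - u t))\<^sup>2) < \<epsilon> \<and>
        (LINT t|half_line. (norm (G t - v t))\<^sup>2) < \<epsilon>"
      using FG by auto
  qed
  then show "p \<in> graph_closure half_line (H_pre x \<Lambda>)" using p by simp
qed

end

section \<open>Density of the domain and the theorem\<close>

text \<open>As \<open>n\<close> grows, \<open>\<eta>\<close> tends to 1 inside the interval, while \<open>\<eta>\<close> and its derivative vanish at both
  ends. It is a polynomial, so that its derivatives need not be computed.\<close>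

lemma polynomial_cell_bump:
  fixes p :: "real \<Rightarrow> complex ^ 'p" and a b :: real and n :: nat
  assumes p: "polynomial_function p" and "a < b"
  defines "\<eta> \<equiv> \<lambda>t. 1 - (1 - ((t - a) * (b - t) / (b - a)\<^sup>2)\<^sup>2) ^ n"
  obtains F' F'' where "ac a b (\<lambda>t. \<eta> t *\<^sub>R p t) F'" "ac a b F' F''" "continuous_on UNIV F''"
    "F' a = 0" "F' b = 0"
proof -
  have id: "real_polynomial_function (\<lambda>t::real. t)"
    by (simp add: real_polynomial_function_eq)
  have "real_polynomial_function \<eta>"
    unfolding \<eta>_def power2_eq_square
    by (intro real_polynomial_function_diff real_polynomial_function_power real_polynomial_function.intros(4)
         real_polynomial_function_divide real_polynomial_function.intros(2) id)
  then have F: "polynomial_function (\<lambda>t. \<eta> t *\<^sub>R p t)"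
    using p by (intro polynomial_function_mult) (simp_all add: real_polynomial_function_eq)
  obtain F' where F': "polynomial_function F'" "\<And>t. ((\<lambda>t. \<eta> t *\<^sub>R p t) has_vector_derivative F' t) (at t)"
    using has_vector_derivative_polynomial_function[OF F] by blast
  obtain F'' where F'': "polynomial_function F''" "\<And>t. (F' has_vector_derivative F'' t) (at t)"
    using has_vector_derivative_polynomial_function[OF F'(1)] by blast
  obtain p' where p': "\<And>t. (p has_vector_derivative p' t) (at t)"
    using has_vector_derivative_polynomial_function[OF p] by blast
  \<comment> \<open>The quadratic enters \<open>\<eta>\<close> only through its square, so at its
    zeros both \<open>\<eta>\<close> and the derivative of \<open>\<eta>\<close> vanish, whatever
    the polynomial \<open>p\<close> is.\<close>
  have end0: "F' e = 0" if e: "(e - a) * (b - e) = 0" for e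
  proof -
    have "(\<eta> has_real_derivative 0) (at e)"
      unfolding \<eta>_def using e \<open>a < b\<close> by (auto intro!: derivative_eq_intros)
    from has_vector_derivative_scaleR[OF this p'[of e]]
    have "((\<lambda>t. \<eta> t *\<^sub>R p t) has_vector_derivative 0) (at e)"
      using e by (simp add: \<eta>_def)
    then show ?thesis using vector_derivative_unique_at[OF F'(2)] by blast
  qed
  show ?thesis
  proof
    show "ac a b (\<lambda>t. \<eta> t *\<^sub>R p t) F'"
      by (rule ac_C1[OF has_vector_derivative_at_within[OF F'(2)] continuous_on_polymonial_function[OF F'(1)]])
    show "ac a b F' F''"
      by (rule ac_C1[OF has_vector_derivative_at_within[OF F''(2)] continuous_on_polymonial_function[OF F''(1)]])
    show "continuous_on UNIV F''"
      by (rule continuous_on_polymonial_function[OF F''(1)])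
    show "F' a = 0" "F' b = 0" by (rule end0; simp)+
  qed
qed

text \<open>Clamping bounds the approximants uniformly without moving the limit, as dominated
  convergence requires.\<close>

lemma clamp_norm_tendsto:
  fixes g :: "nat \<Rightarrow> 'a::real_normed_vector"
  assumes "g \<longlonglongrightarrow> l" "norm l \<le> M" "M > 0"
  shows "(\<lambda>n. (M / max M (norm (g n))) *\<^sub>R g n) \<longlonglongrightarrow> l"
proof -
  have "(\<lambda>n. (M / max M (norm (g n))) *\<^sub>R g n) \<longlonglongrightarrow> (M / max M (norm l)) *\<^sub>R l"
    using assms by (intro tendsto_intros assms) auto
  then show ?thesis using assms by (simp add: max_absorb1)
qed

context partition
begin

text \<open>Functions whose value and slope vanish at every node satisfy the interface conditions
  for any \<open>\<Lambda>\<close>; this is why the domain is dense however large the matrices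
  are.\<close>

lemma polynomial_bump_in_domain:
  fixes p :: "real \<Rightarrow> complex ^ 'p" and \<Lambda> :: "nat \<Rightarrow> complex ^ 'p ^ 'p" and m n :: nat
  assumes p: "polynomial_function p"
  defines "f \<equiv> glue x (\<lambda>k t. if k \<le> m then
      (1 - (1 - ((t - x (k - 1)) * (x k - t) / (x k - x (k - 1))\<^sup>2)\<^sup>2) ^ n) *\<^sub>R p t else 0)"
  shows "f \<in> Domain (H_pre x \<Lambda>)"
proof -
  define F where "F k t = (if k \<le> m then
      (1 - (1 - ((t - x (k - 1)) * (x k - t) / (x k - x (k - 1))\<^sup>2)\<^sup>2) ^ n) *\<^sub>R p t else 0)" for k t
  have "\<forall>k. \<exists>F' F''. k \<ge> 1 \<longrightarrow> ac (x (k - 1)) (x k) (F k) F' \<and> ac (x (k - 1)) (x k) F' F'' \<and> continuous_on UNIV F'' \<and>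
     F' (x (k - 1)) = 0 \<and> F' (x k) = 0 \<and> (k > m \<longrightarrow> F'' = (\<lambda>_. 0))"
  proof
    fix k
    show "\<exists>F' F''. k \<ge> 1 \<longrightarrow> ac (x (k - 1)) (x k) (F k) F' \<and> ac (x (k - 1)) (x k) F' F'' \<and> continuous_on UNIV F'' \<and>
     F' (x (k - 1)) = 0 \<and> F' (x k) = 0 \<and> (k > m \<longrightarrow> F'' = (\<lambda>_. 0))"
    proof (cases "k \<ge> 1 \<and> k \<le> m")
      case True
      then have "x (k - 1) < x k" using x_less by simp
      from polynomial_cell_bump[OF p this, of n] obtain F' F''
        where "ac (x (k - 1)) (x k) (\<lambda>t. (1 - (1 - ((t - x (k - 1)) * (x k - t) / (x k - x (k - 1))\<^sup>2)\<^sup>2) ^ n) *\<^sub>R p t) F'"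
         "ac (x (k - 1)) (x k) F' F''" "continuous_on UNIV F''" "F' (x (k - 1)) = 0" "F' (x k) = 0"
        by blast
      then show ?thesis
        using True by (intro exI[of _ F'] exI[of _ F'']) (simp add: F_def[abs_def])
    next
      case False
      then show ?thesis
        by (intro exI[of _ "\<lambda>_. 0"]) (auto simp: F_def[abs_def] ac_const)
    qed
  qed
  from this[unfolded choice_iff] obtain F' F'' where F: "\<And>k. k \<ge> 1 \<Longrightarrow> ac (x (k - 1)) (x k) (F k) (F' k)"
    "\<And>k. k \<ge> 1 \<Longrightarrow> ac (x (k - 1)) (x k) (F' k) (F'' k)" "\<And>k. k \<ge> 1 \<Longrightarrow> continuous_on UNIV (F'' k)"
    "\<And>k. k \<ge> 1 \<Longrightarrow> F' k (x (k - 1)) = 0" "\<And>k. k \<ge> 1 \<Longrightarrow> F' k (x k) = 0" "\<And>k. k \<ge> 1 \<Longrightarrow> k > m \<Longrightarrow> F'' k = (\<lambda>_. 0)"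
    by blast
  have F_end: "F k (x k) = 0" "F k (x (k - 1)) = 0" for k
    by (simp_all add: F_def)
  have f: "f = glue x F" by (simp add: f_def F_def[abs_def])
  define g where "g = glue x (\<lambda>k t. - F'' k t)"
  have fL: "f \<in> L2 half_line"
    unfolding f
  proof (rule L2_glue[where n=m])
    show "F k \<in> L2 (lebesgue_on {x (k - 1)<..<x k})" if "k \<ge> 1" for k
      by (rule L2_continuous[OF ac_continuous_on[OF F(1)[OF that]]])
  qed (simp add: F_def)
  have gL: "g \<in> L2 half_line"
    unfolding g_def
  proof (rule L2_glue[where n=m])
    show "(\<lambda>t. - F'' k t) \<in> L2 (lebesgue_on {x (k - 1)<..<x k})" if "k \<ge> 1" for k
      by (rule L2_continuous[OF continuous_on_minus[OF continuous_on_subset[OF F(3)[OF that]]]]) simp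
  qed (use F(6) in auto)
  have "(f, g) \<in> H_pre x \<Lambda>"
  proof (rule H_preI[OF _ fL gL])
    show "interface_solution x \<Lambda> F F' g"
      unfolding interface_solution_def
    proof (intro conjI allI impI F(1))
      fix k :: nat assume k: "1 \<le> k"
      show "ac (x (k - 1)) (x k) (F' k) (\<lambda>t. - g t)"
      proof (rule ac_cong[OF F(2)[OF k]])
        fix t assume t: "x (k - 1) < t" "t < x k"
        show "- g t = F'' k t"
          unfolding g_def glue_eq[OF k less_imp_le[OF t(1)] t(2)] by simp
      qed simp
      show "F (Suc k) (x k) = F k (x k)" using F_end(1)[of k] F_end(2)[of "Suc k"] by simp
      show "F' (Suc k) (x k) - F' k (x k) = \<Lambda> k *v F k (x k)"
        using F_end(1)[of k] F(4)[of "Suc k"] F(5)[OF k] by simp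
    next
      show "F' 1 (x 0) = 0" using F(4)[of 1] by simp
    qed
    show "f t = 0" if t: "t > x m" for t
    proof -
      obtain k where k: "k \<ge> 1" "x (k - 1) \<le> t" "t < x k"
        using exists_cell[of t] t x_nonneg[of m] by auto
      have "x m < x k" using t k by simp
      then have "m < k" using mono_x strict_mono_less by blast
      then show ?thesis unfolding f glue_eq[OF k] by (simp add: F_def)
    qed
    show "f t = F k t" if "k \<ge> 1" "x (k - 1) < t" "t < x k" for k t
      unfolding f glue_eq[OF that(1) less_imp_le[OF that(2)] that(3)] ..
  qed
  then show ?thesis by blast
qed

text \<open>A measurable function is almost everywhere a limit of continuous ones. These are
  clamped, replaced by Weierstrass polynomials on \<open>{0..x m}\<close>, and flattened at the
  nodes by the bumps; all is bounded, so pointwise convergence suffices.\<close>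

lemma bounded_approximation:
  fixes u :: "real \<Rightarrow> complex ^ 'p" and \<Lambda> :: "nat \<Rightarrow> complex ^ 'p ^ 'p"
  assumes u: "u \<in> borel_measurable half_line" and M: "\<And>t. norm (u t) \<le> M" "M > 0"
    and supp: "\<And>t. t \<ge> x m \<Longrightarrow> u t = 0" and "\<epsilon> > 0"
  obtains f where "f \<in> Domain (H_pre x \<Lambda>)" "(LINT t|half_line. (norm (f t - u t))\<^sup>2) < \<epsilon>"
proof -
  have "u measurable_on {0<..}"
    using u by (simp add: measurable_on_iff_borel_measurable)
  then obtain N g where N: "negligible N" and g: "\<And>n. continuous_on UNIV (g n)"
    "\<And>t. t \<notin> N \<Longrightarrow> (\<lambda>n. g n t) \<longlonglongrightarrow> (if t \<in> {0<..} then u t else 0)"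
    unfolding measurable_on_def by blast
  define h where "h n t = (M / max M (norm (g n t))) *\<^sub>R g n t" for n t
  have h_cont: "continuous_on A (h n)" for A n
    unfolding h_def using M(2)
    by (intro continuous_intros continuous_on_subset[OF g(1)]) (auto simp: max_def)
  have h_le: "norm (h n t) \<le> M" for n t
    using M(2) by (simp add: h_def max_def field_simps abs_of_pos)
  have "\<exists>p. polynomial_function p \<and> (\<forall>t\<in>{0..x m}. norm (h n t - p t) < inverse (real (Suc n)))" for n
    using Stone_Weierstrass_polynomial_function[OF compact_Icc h_cont, of "inverse (real (Suc n))" 0 "x m" n] by simp
  then obtain p where p: "\<And>n. polynomial_function (p n)"
    "\<And>n t. t \<in> {0..x m} \<Longrightarrow> norm (h n t - p n t) < inverse (real (Suc n))"
    by metis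
  define \<eta> where "\<eta> k n t = 1 - (1 - ((t - x (k - 1)) * (x k - t) / (x k - x (k - 1))\<^sup>2)\<^sup>2) ^ n" for k n t
  define f where "f n = glue x (\<lambda>k t. if k \<le> m then \<eta> k n t *\<^sub>R p n t else 0)" for n
  have f_dom: "f n \<in> Domain (H_pre x \<Lambda>)" for n
    unfolding f_def \<eta>_def by (rule polynomial_bump_in_domain[OF p(1)])
  have fL: "f n \<in> L2 half_line" for n
    using f_dom[of n] H_pre_subset_L2 by blast
  have sigma: "0 \<le> \<sigma> \<and> \<sigma> \<le> 1 \<and> (x (k - 1) < t \<longrightarrow> \<sigma> > 0)"
    if k: "k \<ge> 1" "x (k - 1) \<le> t" "t < x k" and \<sigma>: "\<sigma> = ((t - x (k - 1)) * (x k - t) / (x k - x (k - 1))\<^sup>2)\<^sup>2" for k t \<sigma>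
  proof -
    define r where "r = (t - x (k - 1)) * (x k - t) / (x k - x (k - 1))\<^sup>2"
    have "(t - x (k - 1)) * (x k - t) \<le> (x k - x (k - 1)) * (x k - x (k - 1))"
      using k by (intro mult_mono) auto
    then have "r \<le> 1" using k by (simp add: r_def power2_eq_square divide_le_eq)
    moreover have "r \<ge> 0" using k by (simp add: r_def)
    moreover have "r > 0" if "x (k - 1) < t" using that k by (simp add: r_def)
    ultimately show ?thesis unfolding \<sigma> r_def[symmetric] by (auto simp: power_le_one)
  qed
  have f_zero: "f n t = 0" if t: "t \<ge> x m" for n t
  proof -
    obtain k where k: "k \<ge> 1" "x (k - 1) \<le> t" "t < x k"
      using exists_cell[of t] t x_nonneg[of m] by auto
    have "x m < x k" using t k by simp
    then have "m < k" using mono_x strict_mono_less by blast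
    then show ?thesis unfolding f_def glue_eq[OF k] by simp
  qed
  \<comment> \<open>The polynomial exceeds the clamped bound \<open>M\<close> by at most 1, the bump
    does not increase it, and \<open>u\<close> adds another \<open>M\<close>.\<close>
  have bound: "(norm (f n t - u t))\<^sup>2 \<le> indicator {0<..<x m} t * (2 * M + 1)\<^sup>2" if t: "t > 0" for n t
  proof (cases "t < x m")
    case True
    obtain k where k: "k \<ge> 1" "x (k - 1) \<le> t" "t < x k"
      using exists_cell[of t] t by auto
    define \<sigma> where "\<sigma> = ((t - x (k - 1)) * (x k - t) / (x k - x (k - 1))\<^sup>2)\<^sup>2"
    have "0 \<le> (1 - \<sigma>) ^ n" "(1 - \<sigma>) ^ n \<le> 1"
      using sigma[OF k \<sigma>_def] by (auto intro: power_le_one)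
    then have eta: "\<bar>\<eta> k n t\<bar> \<le> 1" by (simp add: \<eta>_def \<sigma>_def)
    have "inverse (real (Suc n)) \<le> 1" by (simp add: inverse_le_1_iff)
    then have "norm (p n t) \<le> M + 1"
      using p(2)[of t n] h_le[of n t] norm_triangle_ineq4[of "h n t" "h n t - p n t"] True t by force
    then have "norm (\<eta> k n t *\<^sub>R p n t) \<le> 1 * (M + 1)"
      unfolding norm_scaleR using eta by (intro mult_mono) auto
    then have "norm (f n t) \<le> M + 1"
      unfolding f_def glue_eq[OF k] using M(2) by simp
    then have "norm (f n t - u t) \<le> 2 * M + 1"
      using norm_triangle_ineq4[of "f n t" "u t"] M(1)[of t] by simp
    then have "(norm (f n t - u t))\<^sup>2 \<le> (2 * M + 1)\<^sup>2" by (intro power_mono) auto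
    then show ?thesis using True t by simp
  qed (use f_zero supp in simp)
  have lim: "(\<lambda>n. f n t) \<longlonglongrightarrow> u t" if t: "t > 0" "t \<notin> N" "t \<notin> range x" for t
  proof (cases "t < x m")
    case True
    obtain k where k: "k \<ge> 1" "x (k - 1) \<le> t" "t < x k"
      using exists_cell[of t] t by auto
    have "x (k - 1) < x m" using True k by simp
    then have km: "k \<le> m" using mono_x strict_mono_less[of x "k - 1" m] by auto
    have kt: "x (k - 1) < t" using k t by (auto simp: less_le)
    define \<sigma> where "\<sigma> = ((t - x (k - 1)) * (x k - t) / (x k - x (k - 1))\<^sup>2)\<^sup>2"
    have "\<bar>1 - \<sigma>\<bar> < 1" using sigma[OF k \<sigma>_def] kt by auto
    then have "(\<lambda>n. (1 - \<sigma>) ^ n) \<longlonglongrightarrow> 0"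
      unfolding real_norm_def[symmetric] by (rule LIMSEQ_power_zero)
    then have eta: "(\<lambda>n. \<eta> k n t) \<longlonglongrightarrow> 1 - 0"
      unfolding \<eta>_def \<sigma>_def[symmetric] by (rule tendsto_diff[OF tendsto_const])
    have "(\<lambda>n. g n t) \<longlonglongrightarrow> u t" using g(2)[OF t(2)] t(1) by simp
    then have hl: "(\<lambda>n. h n t) \<longlonglongrightarrow> u t" unfolding h_def by (rule clamp_norm_tendsto) (use M in auto)
    have "(\<lambda>n. h n t - p n t) \<longlonglongrightarrow> 0"
      using p(2)[of t] True t
      by (intro Lim_null_comparison[OF _ LIMSEQ_inverse_real_of_nat] always_eventually allI less_imp_le) auto
    from tendsto_diff[OF hl this] have "(\<lambda>n. p n t) \<longlonglongrightarrow> u t" by simp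
    from tendsto_scaleR[OF eta this] have "(\<lambda>n. \<eta> k n t *\<^sub>R p n t) \<longlonglongrightarrow> u t" by simp
    then show ?thesis unfolding f_def glue_eq[OF k] using km by simp
  qed (use f_zero supp in simp)
  define N' where "N' = N \<union> range x"
  have N': "negligible N'"
    unfolding N'_def using N
    by (intro negligible_Un) (simp_all add: negligible_iff_null_sets null_sets_completionI countable_imp_null_set_lborel)
  have uL: "(\<lambda>t. f n t - u t) \<in> borel_measurable half_line" for n
    by (intro borel_measurable_diff L2_measurable[OF fL] u)
  have "(\<lambda>n. LINT t|half_line. (norm (f n t - u t))\<^sup>2) \<longlonglongrightarrow> (LINT t|half_line. 0)"
  proof (rule integral_dominated_convergence[where w="\<lambda>t. indicator {0<..<x m} t * (2 * M + 1)\<^sup>2"])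
    show "(\<lambda>t. (norm (f n t - u t))\<^sup>2) \<in> borel_measurable half_line" for n
      by (rule borel_measurable_power[OF measurable_compose[OF uL borel_measurable_norm]])
    have "integrable lebesgue (\<lambda>t. indicator {0<..<x m} t *\<^sub>R (2 * M + 1)\<^sup>2)"
      using finite_measure.integrable_const[OF finite_measure_lebesgue_on, of "{0<..<x m}" "(2 * M + 1)\<^sup>2"]
      by (simp add: integrable_restrict_space)
    then have "integrable lebesgue (\<lambda>t. indicator {0<..} t *\<^sub>R (indicator {0<..<x m} t * (2 * M + 1)\<^sup>2))"
      by (rule Bochner_Integration.integrable_cong[THEN iffD1, rotated -1]) (auto simp: indicator_def)
    then show "integrable half_line (\<lambda>t. indicator {0<..<x m} t * (2 * M + 1)\<^sup>2)"
      by (rule integrable_restrict_space[THEN iffD2, rotated]) simp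
    show "AE t in half_line. norm ((norm (f n t - u t))\<^sup>2) \<le> indicator {0<..<x m} t * (2 * M + 1)\<^sup>2" for n
      using bound by (intro AE_I2) auto
    show "AE t in half_line. (\<lambda>n. (norm (f n t - u t))\<^sup>2) \<longlonglongrightarrow> 0"
    proof (rule AE_I')
      have "N' \<inter> {0<..} \<in> null_sets lebesgue"
        using N' negligible_subset[of N' "N' \<inter> {0<..}"] by (simp add: negligible_iff_null_sets)
      then show "N' \<inter> {0<..} \<in> null_sets half_line"
        by (simp add: null_sets_restrict_space)
      have "(\<lambda>n. (norm (f n t - u t))\<^sup>2) \<longlonglongrightarrow> 0" if "t > 0" "t \<notin> N'" for t
      proof -
        have "(\<lambda>n. (norm (f n t - u t))\<^sup>2) \<longlonglongrightarrow> (norm (u t - u t))\<^sup>2"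
          using that by (intro tendsto_intros lim) (auto simp: N'_def)
        then show ?thesis by simp
      qed
      then show "{t \<in> space half_line. \<not> (\<lambda>n. (norm (f n t - u t))\<^sup>2) \<longlonglongrightarrow> 0} \<subseteq> N' \<inter> {0<..}"
        by auto
    qed
  qed simp
  then have "(\<lambda>n. LINT t|half_line. (norm (f n t - u t))\<^sup>2) \<longlonglongrightarrow> 0" by simp
  from order_tendstoD(2)[OF this \<open>\<epsilon> > 0\<close>] obtain n where "(LINT t|half_line. (norm (f n t - u t))\<^sup>2) < \<epsilon>"
    unfolding eventually_sequentially by blast
  then show ?thesis using that f_dom by blast
qed

lemma H_pre_densely_defined:
  fixes \<Lambda> :: "nat \<Rightarrow> complex ^ 'p ^ 'p"
  shows "densely_defined half_line (H_pre x \<Lambda>)"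
  unfolding densely_defined_def
proof (intro ballI allI impI)
  fix u :: "real \<Rightarrow> complex ^ 'p" and e :: real
  assume uL: "u \<in> L2 half_line" and "e > 0"
  \<comment> \<open>Truncation both in space and in size; at each fixed point it is eventually
    inactive.\<close>
  define B where "B m = {t. t < x m \<and> norm (u t) \<le> real (Suc m)}" for m
  define w where "w m t = indicator (B m) t *\<^sub>R u t" for m t
  have um: "u \<in> borel_measurable half_line" by (rule L2_measurable[OF uL])
  have w_eq: "w m t = (if norm (u t) \<le> real (Suc m) then indicator {..<x m} t *\<^sub>R u t else 0)" for m t
    by (simp add: w_def B_def indicator_def)
  have wm: "w m \<in> borel_measurable half_line" for m
  proof -
    have [measurable]: "(\<lambda>t. indicator {..<x m} t *\<^sub>R u t) \<in> borel_measurable half_line"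
      by (intro borel_measurable_scaleR um measurable_restrict_space1 borel_measurable_indicator) auto
    note um[measurable]
    show ?thesis
      unfolding w_eq[abs_def] by measurable
  qed
  have "(\<lambda>m. LINT t|half_line. (norm (w m t - u t))\<^sup>2) \<longlonglongrightarrow> (LINT t|half_line. 0)"
  proof (rule integral_dominated_convergence[where w="\<lambda>t. (norm (u t))\<^sup>2"])
    show "(\<lambda>t. (norm (w m t - u t))\<^sup>2) \<in> borel_measurable half_line" for m
      by (rule borel_measurable_power[OF measurable_compose[OF borel_measurable_diff[OF wm um] borel_measurable_norm]])
    show "AE t in half_line. (\<lambda>m. (norm (w m t - u t))\<^sup>2) \<longlonglongrightarrow> 0"
    proof (intro AE_I2 tendsto_eventually)
      fix t
      obtain N1 where N1: "\<forall>n\<ge>N1. t < x n" using eventually_x_gt by blast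
      obtain N2 :: nat where N2: "norm (u t) \<le> real N2" using real_arch_simple by blast
      show "\<forall>\<^sub>F m in sequentially. (norm (w m t - u t))\<^sup>2 = 0"
        unfolding eventually_sequentially
      proof (intro exI[of _ "max N1 N2"] allI impI)
        fix m assume "max N1 N2 \<le> m"
        then have "t \<in> B m" using N1 N2 by (auto simp: B_def)
        then show "(norm (w m t - u t))\<^sup>2 = 0" by (simp add: w_def)
      qed
    qed
    show "AE t in half_line. norm ((norm (w m t - u t))\<^sup>2) \<le> (norm (u t))\<^sup>2" for m
      by (intro AE_I2) (simp add: w_def indicator_def)
  qed (use L2_square_integrable[OF uL] in auto)
  then have "(\<lambda>m. LINT t|half_line. (norm (w m t - u t))\<^sup>2) \<longlonglongrightarrow> 0" by simp
  moreover have "e\<^sup>2 / 4 > 0" using \<open>e > 0\<close> by simp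
  ultimately have "\<forall>\<^sub>F m in sequentially. (LINT t|half_line. (norm (w m t - u t))\<^sup>2) < e\<^sup>2 / 4"
    by (rule order_tendstoD(2))
  then obtain m where m: "(LINT t|half_line. (norm (w m t - u t))\<^sup>2) < e\<^sup>2 / 4"
    unfolding eventually_sequentially by blast
  \<comment> \<open>Each of the two squared errors gets \<open>e\<^sup>2 / 4\<close>, because
    squaring the sum doubles both.\<close>
  obtain f where f: "f \<in> Domain (H_pre x \<Lambda>)" "(LINT t|half_line. (norm (f t - w m t))\<^sup>2) < e\<^sup>2 / 4"
  proof (rule bounded_approximation[OF wm, where M="real (Suc m)" and m=m and \<epsilon>="e\<^sup>2 / 4"])
    show "norm (w m t) \<le> real (Suc m)" for t
      by (auto simp: w_def B_def indicator_def)
    show "w m t = 0" if "t \<ge> x m" for t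
      using that by (simp add: w_def B_def)
  qed (use \<open>e > 0\<close> that in auto)
  have fL: "f \<in> L2 half_line" using f(1) H_pre_subset_L2 by blast
  have wL: "w m \<in> L2 half_line"
    by (rule L2_dominated[OF wm L2_square_integrable[OF uL]]) (simp add: w_def indicator_def)
  have "(LINT t|half_line. (norm (f t - u t))\<^sup>2) \<le>
     (LINT t|half_line. 2 * (norm (f t - w m t))\<^sup>2 + 2 * (norm (w m t - u t))\<^sup>2)"
  proof (rule integral_mono)
    fix t
    show "(norm (f t - u t))\<^sup>2 \<le> 2 * (norm (f t - w m t))\<^sup>2 + 2 * (norm (w m t - u t))\<^sup>2"
      using norm_add_square_le[of "f t - w m t" "w m t - u t"] by simp
  qed (use L2_square_integrable[OF L2_diff[OF fL uL]] L2_square_integrable[OF L2_diff[OF fL wL]]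
      L2_square_integrable[OF L2_diff[OF wL uL]] in auto)
  also have "\<dots> = 2 * (LINT t|half_line. (norm (f t - w m t))\<^sup>2) + 2 * (LINT t|half_line. (norm (w m t - u t))\<^sup>2)"
    using L2_square_integrable[OF L2_diff[OF fL wL]] L2_square_integrable[OF L2_diff[OF wL uL]] by simp
  also have "\<dots> < e\<^sup>2" using f(2) m by simp
  finally have "L2_norm half_line (\<lambda>t. f t - u t) < e"
    using L2_norm_less_iff[OF \<open>e > 0\<close>] by blast
  then show "\<exists>f\<in>Domain (H_pre x \<Lambda>). L2_norm half_line (\<lambda>t. f t - u t) < e"
    using f(1) by blast
qed

end

theorem mainTheorem11:
  fixes x :: "nat \<Rightarrow> real" and \<Lambda> :: "nat \<Rightarrow> complex ^ 'p ^ 'p"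
  assumes "strict_mono x"
    and "x 0 = 0"
    and "filterlim x at_top sequentially"
    and "bdd_above (gap x ` {1..})"
    and "\<And>k. k \<ge> 1 \<Longrightarrow> conj_transpose (\<Lambda> k) = \<Lambda> k"
    and "filterlim (\<lambda>n. \<Sum>k=1..n. (gap x k)\<^sup>2) at_top sequentially"
  shows "self_adjoint half_line (H x \<Lambda>)"
proof -
  interpret partition x
    using assms(1-3) by unfold_locales
  obtain D where D: "\<And>k. k \<ge> 1 \<Longrightarrow> gap x k \<le> D"
    using assms(4) unfolding bdd_above_def by auto
  have sub: "H_pre x \<Lambda> \<subseteq> H x \<Lambda>"
    unfolding H_def by (rule graph_closure_superset[OF H_pre_subset_L2])
  \<comment> \<open>Taking adjoints reverses inclusion, so the adjoint of \<open>H\<close> lies in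
    that of \<open>H_pre\<close>, which the truncation argument places in the closure, that is, in
    \<open>H\<close>.\<close>
  have "graph_adjoint half_line (H x \<Lambda>) \<subseteq> H x \<Lambda>"
    using graph_adjoint_antimono[OF sub] adjoint_subset_closure[OF assms(5) D assms(6)]
    unfolding H_def by (rule order_trans)
  moreover have "H x \<Lambda> \<subseteq> graph_adjoint half_line (H x \<Lambda>)"
    unfolding H_def
    by (rule graph_closure_symmetric[OF H_pre_subset_L2]) (rule H_pre_symmetric[OF _ _ assms(5)])
  moreover have "densely_defined half_line (H x \<Lambda>)"
    using H_pre_densely_defined[of \<Lambda>] Domain_mono[OF sub] unfolding densely_defined_def by blast
  ultimately show ?thesis
    unfolding self_adjoint_def by blast
qed

end
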